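(* Let $n\ge2$, $\alpha\in(0,1)$, and let $E=\tilde E\cup B$, where \[ \tilde E=\{x\in\mathbb{R}^n: |x'|^{1+\alpha}<x_n<1\},\qquad B=\mathrm{B}_{\sqrt{1+(1+\alpha)^{-2}}}\Big(\big(0',\,1+\tfrac{1}{1+\alpha}\big)\Big). \] Then $E$ is convex, $\partial E=\partial^\ast E$ is of class $\mathrm{C}^{1,\alpha}$ but not of class $\mathrm{C}^{1,\beta}$ near $0$ for any $\beta>\alpha$, and for every open ball $U\subseteq\mathbb{R}^n$ with $E\Subset U$ there exists a (local) variational mean curvature $H$ of $E$ in $U$ such that $H\in\mathrm{L}^p(U)$ for every $p\in[1,\infty)$ with $\alpha>\frac{p-n}{p+1}$.
   Context: For $x\in\mathbb{R}^n$, $x'=(x_1,\dots,x_{n-1})$, and $0'$ is the origin of $\mathbb{R}^{n-1}$. $\mathrm{B}_\rho(z)$ is the open ball in $\mathbb{R}^n$. $\partial^\ast E$ is the reduced boundary. A set $E$ of finite perimeter in an open set $U$ has (local) variational mean curvature $H\in\mathrm{L}^1(U)$ in $U$ if $\mathrm{P}(E,U)-\int_{E\cap U}H\le \mathrm{P}(F,U)-\int_{F\cap U}H$ for all measurable $F$ with $F\triangle E\Subset U$, where $\mathrm{P}(\cdot,U)$ is the perimeter in $U$. *)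

theory Defs
  imports "HOL-Analysis.Analysis"
begin

definition c1c :: "(real^'n) set \<Rightarrow> (real^'n \<Rightarrow> real^'n) \<Rightarrow> bool" where
  "c1c U \<phi> \<longleftrightarrow> (\<forall>x. \<phi> differentiable (at x))
     \<and> (\<forall>i j. continuous_on UNIV (\<lambda>x. frechet_derivative \<phi> (at x) (axis j 1) $ i))
     \<and> compact (closure {x. \<phi> x \<noteq> 0}) \<and> closure {x. \<phi> x \<noteq> 0} \<subseteq> U"

definition divg :: "(real^'n \<Rightarrow> real^'n) \<Rightarrow> real^'n \<Rightarrow> real" where
  "divg \<phi> x = (\<Sum>i\<in>UNIV. frechet_derivative \<phi> (at x) (axis i 1) $ i)"

definition perimeter :: "(real^'n) set \<Rightarrow> (real^'n) set \<Rightarrow> ereal" where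
  "perimeter E U = (SUP \<phi> \<in> {\<phi>. c1c U \<phi> \<and> (\<forall>x. norm (\<phi> x) \<le> 1)}.
       ereal (set_lebesgue_integral lebesgue E (divg \<phi>)))"

text \<open>Gauss--Green measure of E, in polar form: total variation mu (a Radon measure)
  and unit density nu, with  int_E div phi = int phi . nu d mu.\<close>
definition gauss_green :: "(real^'n) set \<Rightarrow> (real^'n) measure \<Rightarrow> (real^'n \<Rightarrow> real^'n) \<Rightarrow> bool" where
  "gauss_green E \<mu> \<nu> \<longleftrightarrow> sets \<mu> = sets borel \<and> (\<forall>K. compact K \<longrightarrow> emeasure \<mu> K < \<infinity>)
     \<and> \<nu> \<in> borel_measurable borel \<and> (\<forall>x. norm (\<nu> x) = 1)
     \<and> (\<forall>\<phi>. c1c UNIV \<phi> \<longrightarrow> integrable \<mu> (\<lambda>x. \<phi> x \<bullet> \<nu> x) \<and>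
            set_lebesgue_integral lebesgue E (divg \<phi>) = (\<integral>x. \<phi> x \<bullet> \<nu> x \<partial>\<mu>))"

definition reduced_boundary :: "(real^'n) set \<Rightarrow> (real^'n) set" where
  "reduced_boundary E = {x. \<exists>\<mu> \<nu>. gauss_green E \<mu> \<nu> \<and> (\<forall>r>0. measure \<mu> (ball x r) > 0)
      \<and> (\<exists>v. norm v = 1 \<and>
           ((\<lambda>r. (1 / measure \<mu> (ball x r)) *\<^sub>R set_lebesgue_integral \<mu> (ball x r) \<nu>) \<longlongrightarrow> v) (at_right 0))}"

definition C1_holder_on :: "real \<Rightarrow> (real^'n) set \<Rightarrow> (real^'n \<Rightarrow> real) \<Rightarrow> bool" where
  "C1_holder_on a U f \<longleftrightarrow> (\<exists>f'. (\<forall>x\<in>U. (f has_derivative f' x) (at x))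
     \<and> (\<exists>C. \<forall>x\<in>U. \<forall>y\<in>U. onorm (\<lambda>v. f' x v - f' y v) \<le> C * dist x y powr a))"

text \<open>S is, near z, a C^{1,a} graph over the hyperplane orthogonal to some unit vector e:
  f depends only on the component orthogonal to e, and S = {x. x.e = f x} near z.\<close>
definition C1_holder_hypersurface_at :: "real \<Rightarrow> (real^'n) set \<Rightarrow> real^'n \<Rightarrow> bool" where
  "C1_holder_hypersurface_at a S z \<longleftrightarrow> (\<exists>r>0. \<exists>e f. norm e = 1
     \<and> (\<forall>y. f y = f (y - (y \<bullet> e) *\<^sub>R e)) \<and> C1_holder_on a (ball z r) f
     \<and> S \<inter> ball z r = {x \<in> ball z r. x \<bullet> e = f x})"

definition var_mean_curv :: "(real^'n) set \<Rightarrow> (real^'n) set \<Rightarrow> (real^'n \<Rightarrow> real) \<Rightarrow> bool" where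
  "var_mean_curv E U H \<longleftrightarrow> E \<in> sets lebesgue \<and> perimeter E U < \<infinity> \<and> set_integrable lebesgue U H
     \<and> (\<forall>F \<in> sets lebesgue. compact (closure ((F - E) \<union> (E - F))) \<and> closure ((F - E) \<union> (E - F)) \<subseteq> U
          \<longrightarrow> perimeter E U - ereal (set_lebesgue_integral lebesgue (E \<inter> U) H)
              \<le> perimeter F U - ereal (set_lebesgue_integral lebesgue (F \<inter> U) H))"

definition Lp_on :: "real \<Rightarrow> (real^'n) set \<Rightarrow> (real^'n \<Rightarrow> real) \<Rightarrow> bool" where
  "Lp_on p U H \<longleftrightarrow> set_borel_measurable lebesgue U H
     \<and> (\<integral>\<^sup>+x. indicator U x * ennreal (\<bar>H x\<bar> powr p) \<partial>lebesgue) < \<infinity>"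

text \<open>|x'| where k is the distinguished (last) coordinate.\<close>
definition normp :: "'n \<Rightarrow> real^'n \<Rightarrow> real" where
  "normp k x = sqrt (\<Sum>i\<in>UNIV - {k}. (x $ i)^2)"

end

theory Submission
  imports Defs
begin

text \<open>
  Put s = 1 / (1 + \<alpha>). The set is {x. |x'|^2 < Q (x_n)}, where Q y is y^(2 s) up to height 1 and
  the squared profile of a sphere above; sqrt Q is concave, and the outer unit normal is
  (P x', V) with P and V functions of the height x_n, V being increasing.

  For the Gauss--Green formula one integrates the divergence of u \<phi> over the whole space, where
  the cutoff u is a function of |x'|^2 / Q (x_n). When u approaches the indicator of the set, this
  becomes an average over thin shells inside the boundary. Horizontal scaling evaluates the
  averages and shows that the surface measure is the image of a weighted Lebesgue measure under
  the radial projection in horizontal slices.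

  The curvature is H = C x_n^(1 - 2 s) inside the set and 0 outside. It is calibrated by the field
  with vertical part V (x_n) and horizontal part P (x_n) x', the latter cut off at length
  sqrt (1 - V^2): this field extends the normal, has length at most 1 and nonnegative divergence,
  and its divergence inside the set is at most H. The slice at height y has diameter of order y^s,
  so H^p is integrable as soon as the integral of y^(s (n - 1) - p (2 s - 1)) converges at 0, which
  is the condition \<alpha> > (p - n) / (p + 1).
\<close>

section \<open>Calculus preliminaries\<close>

text \<open>The two pieces of E fit together because below height 1 the ball lies inside the other
  one, so a single profile \<open>Q\<close> describes the union. Three obstacles shape the proof.
  The function |x'|^2 / Q (x_n) degenerates at the tip and at the top point, so the boundary formula
  is first available only for functions that vanish near these heights; integrability of 1 / Q over
  the body removes the restriction. The calibrating field is not C1 and its horizontal factor blows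
  up at the tip, whereas test fields are C1 with compact support; hence it is averaged over upward
  windows in the height, truncated softly and cut off inside U. Its divergence stays nonnegative for
  two reasons: V is increasing, and where the truncation acts the horizontal part resembles a
  multiple of x' / |x'|, whose divergence is (n - 2) / |x'|, nonnegative for n \<ge> 2. Finally,
  failure of C^(1,\<beta>) at 0 has to be shown for graphs in every direction e, and membership in
  the reduced boundary concerns arbitrary representing pairs \<mu>, \<nu>; both are settled by
  testing, with curves on the surface and with fields vanishing on it.\<close>

lemma DERIV_If_less:
  fixes f g :: "real \<Rightarrow> real"
  assumes "(f has_real_derivative D) (at a)" "(g has_real_derivative D) (at a)" "f a = g a"
  shows "((\<lambda>x. if x < a then f x else g x) has_real_derivative D) (at a)"
proof -
  let ?h = "\<lambda>x. if x < a then f x else g x"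
  have l: "((\<lambda>x. (?h x - ?h a) / (x - a)) \<longlongrightarrow> D) (at_left a)"
  proof (rule Lim_transform_eventually)
    show "((\<lambda>x. (f x - f a) / (x - a)) \<longlongrightarrow> D) (at_left a)"
      using assms(1) by (auto simp: has_field_derivative_iff intro: filterlim_mono[OF _ order_refl at_le])
    show "\<forall>\<^sub>F x in at_left a. (f x - f a) / (x - a) = (?h x - ?h a) / (x - a)"
      using assms(3) by (auto simp: eventually_at_filter)
  qed
  have r: "((\<lambda>x. (?h x - ?h a) / (x - a)) \<longlongrightarrow> D) (at_right a)"
  proof (rule Lim_transform_eventually)
    show "((\<lambda>x. (g x - g a) / (x - a)) \<longlongrightarrow> D) (at_right a)"
      using assms(2) by (auto simp: has_field_derivative_iff intro: filterlim_mono[OF _ order_refl at_le])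
    show "\<forall>\<^sub>F x in at_right a. (g x - g a) / (x - a) = (?h x - ?h a) / (x - a)"
      by (auto simp: eventually_at_filter)
  qed
  show ?thesis unfolding has_field_derivative_iff using l r by (rule filterlim_split_at)
qed

lemma isCont_If_less:
  fixes f g :: "real \<Rightarrow> real"
  assumes "isCont f a" "isCont g a" "f a = g a"
  shows "isCont (\<lambda>x. if x < a then f x else g x) a"
proof -
  let ?h = "\<lambda>x. if x < a then f x else g x"
  have l: "(?h \<longlongrightarrow> ?h a) (at_left a)"
  proof (rule Lim_transform_eventually)
    show "(f \<longlongrightarrow> ?h a) (at_left a)"
      using assms by (auto simp: isCont_def intro: filterlim_mono[OF _ order_refl at_le])
    show "\<forall>\<^sub>F x in at_left a. f x = ?h x" by (auto simp: eventually_at_filter)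
  qed
  have r: "(?h \<longlongrightarrow> ?h a) (at_right a)"
  proof (rule Lim_transform_eventually)
    show "(g \<longlongrightarrow> ?h a) (at_right a)"
      using assms by (auto simp: isCont_def intro: filterlim_mono[OF _ order_refl at_le])
    show "\<forall>\<^sub>F x in at_right a. g x = ?h x" by (auto simp: eventually_at_filter)
  qed
  show ?thesis unfolding isCont_def using l r by (rule filterlim_split_at)
qed

lemma DERIV_cong_open:
  fixes f g :: "real \<Rightarrow> real"
  assumes "(f has_real_derivative D) (at x)" "open S" "x \<in> S" "\<And>y. y \<in> S \<Longrightarrow> f y = g y"
  shows "(g has_real_derivative D) (at x)"
  using assms by (metis has_field_derivative_transform_within_open)

lemma isCont_cong_open:
  fixes f g :: "real \<Rightarrow> real"
  assumes "isCont f x" "open S" "x \<in> S" "\<And>y. y \<in> S \<Longrightarrow> f y = g y"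
  shows "isCont g x"
  proof -
  have "\<forall>\<^sub>F y in nhds x. f y = g y"
    using assms by (auto simp: eventually_nhds)
  with assms(1) show ?thesis by (simp add: isCont_cong)
qed

section \<open>Smoothing by averages, and cutoff functions\<close>

text \<open>An antiderivative turns averages over [y, y + \<epsilon>] into a C1 function whose
  derivative is a difference quotient. Being a value of \<open>f\<close> on that window, the average
  inherits all pointwise bounds; the window looks upward so that an average taken at a positive
  height never sees heights closer to the singular height 0.\<close>

lemma forward_average:
  fixes f :: "real \<Rightarrow> real"
  assumes "continuous_on UNIV f" "\<epsilon> > 0"
  obtains F where "\<And>y. (F has_real_derivative (f (y + \<epsilon>) - f y) / \<epsilon>) (at y)"
    "\<And>y. \<exists>\<xi>\<in>{y..y+\<epsilon>}. F y = f \<xi>"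
proof -
  have "\<exists>G. \<forall>x::real. -\<infinity> < ereal x \<longrightarrow> ereal x < \<infinity> \<longrightarrow> (G has_vector_derivative f x) (at x)"
    by (rule einterval_antiderivative) (use assms in \<open>auto simp: continuous_on_eq_continuous_at\<close>)
  then obtain G where G: "\<And>x. (G has_real_derivative f x) (at x)"
    by (auto simp: has_real_derivative_iff_has_vector_derivative)
  define F where "F y = (G (y + \<epsilon>) - G y) / \<epsilon>" for y
  show ?thesis
  proof
    show "(F has_real_derivative (f (y + \<epsilon>) - f y) / \<epsilon>) (at y)" for y
    proof -
      have "((\<lambda>y. G (y + \<epsilon>)) has_real_derivative f (y + \<epsilon>)) (at y)"
        using G[of "y + \<epsilon>"] by (simp add: DERIV_shift)
      from DERIV_cdivide[OF DERIV_diff[OF this G[of y]], of \<epsilon>] show ?thesis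
        by (simp add: F_def[abs_def])
    qed
    show "\<exists>\<xi>\<in>{y..y+\<epsilon>}. F y = f \<xi>" for y
    proof -
      obtain z where "y < z" "z < y + \<epsilon>" "G (y + \<epsilon>) - G y = (y + \<epsilon> - y) * f z"
        using MVT2[of y "y + \<epsilon>" G f] G assms(2) by auto
      then show ?thesis using assms(2) by (auto intro!: bexI[of _ z] simp: F_def)
    qed
  qed
qed

definition clamp01 :: "real \<Rightarrow> real" where "clamp01 t = max 0 (min 1 t)"

lemma continuous_clamp01: "continuous_on S clamp01"
  unfolding clamp01_def[abs_def] by (intro continuous_intros)

lemma clamp01_lipschitz: "\<bar>clamp01 a - clamp01 b\<bar> \<le> \<bar>a - b\<bar>"
  by (auto simp: clamp01_def)

lemma smooth_step:
  obtains \<xi> \<xi>' :: "real \<Rightarrow> real" where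
    "\<And>y. (\<xi> has_real_derivative \<xi>' y) (at y)" "continuous_on UNIV \<xi>'"
    "\<And>y. 0 \<le> \<xi> y" "\<And>y. \<xi> y \<le> 1" "\<And>y. y \<le> 1 \<Longrightarrow> \<xi> y = 0" "\<And>y. y \<ge> 3 \<Longrightarrow> \<xi> y = 1"
    "\<And>y. \<bar>\<xi>' y\<bar> \<le> 1" "\<And>y. y \<ge> 3 \<Longrightarrow> \<xi>' y = 0"
proof -
  \<comment> \<open>\<open>?f\<close> is 0 up to 2 and 1 from 3 on; a window of length 1 looking
    upward moves only the lower threshold, from 2 to 1.\<close>
  let ?f = "\<lambda>t. clamp01 (t - 2)"
  have c: "continuous_on UNIV ?f"
    unfolding clamp01_def by (intro continuous_intros)
  obtain F where F: "\<And>y. (F has_real_derivative (?f (y + 1) - ?f y) / 1) (at y)"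
    "\<And>y. \<exists>\<xi>\<in>{y..y+1}. F y = ?f \<xi>"
    using forward_average[OF c, of 1] by auto
  show ?thesis
  proof (rule that[of F "\<lambda>y. (?f (y + 1) - ?f y) / 1"])
    show "(F has_real_derivative (?f (y + 1) - ?f y) / 1) (at y)" for y by (rule F)
    show "continuous_on UNIV (\<lambda>y. (?f (y + 1) - ?f y) / 1)"
      unfolding clamp01_def by (intro continuous_intros) auto
    show "0 \<le> F y" "F y \<le> 1" for y using F(2)[of y] by (auto simp: clamp01_def)
    show "F y = 0" if "y \<le> 1" for y using F(2)[of y] that by (auto simp: clamp01_def)
    show "F y = 1" if "y \<ge> 3" for y using F(2)[of y] that by (auto simp: clamp01_def)
    show "\<bar>(?f (y + 1) - ?f y) / 1\<bar> \<le> 1" for y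
      using clamp01_lipschitz[of "y + 1 - 2" "y - 2"] by simp
    show "(?f (y + 1) - ?f y) / 1 = 0" if "y \<ge> 3" for y using that by (auto simp: clamp01_def)
  qed
qed

section \<open>Scalar functions with continuous gradient, and test fields\<close>

text \<open>Carrying the gradient as explicit data reduces every divergence in the sequel to a
  finite sum of gradient components and avoids evaluating \<open>frechet_derivative\<close> for
  products and compositions.\<close>

definition C1_gradient :: "('a::euclidean_space \<Rightarrow> real) \<Rightarrow> ('a \<Rightarrow> 'a) \<Rightarrow> bool" where
  "C1_gradient f g \<longleftrightarrow> (\<forall>x. (f has_derivative (\<lambda>h. g x \<bullet> h)) (at x)) \<and> continuous_on UNIV g"

lemma C1_gradient_continuous: "C1_gradient f g \<Longrightarrow> continuous_on S f"
  unfolding C1_gradient_def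
  by (meson continuous_at_imp_continuous_on has_derivative_continuous)

lemma C1_gradient_const: "C1_gradient (\<lambda>x. c) (\<lambda>x. 0)"
  by (auto simp: C1_gradient_def)

lemma C1_gradient_coord: "C1_gradient (\<lambda>x. x $ i) (\<lambda>x. axis i 1)"
  for i :: "'n::finite"
  unfolding C1_gradient_def inner_axis'
  by (auto intro!: bounded_linear_imp_has_derivative bounded_linear_vec_nth)

lemma C1_gradient_add:
  "C1_gradient f f' \<Longrightarrow> C1_gradient g g' \<Longrightarrow> C1_gradient (\<lambda>x. f x + g x) (\<lambda>x. f' x + g' x)"
  unfolding C1_gradient_def inner_add_left
  by (auto intro!: derivative_intros continuous_intros)

lemma C1_gradient_mult:
  assumes "C1_gradient f f'" "C1_gradient g g'"
  shows "C1_gradient (\<lambda>x. f x * g x) (\<lambda>x. f x *\<^sub>R g' x + g x *\<^sub>R f' x)"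
  using assms C1_gradient_continuous[OF assms(1)] C1_gradient_continuous[OF assms(2)]
  unfolding C1_gradient_def inner_add_left inner_scaleR_left
  by (auto intro!: continuous_intros derivative_eq_intros simp: algebra_simps)

text \<open>\<open>\<phi>'\<close> depends on the point \<open>x\<close> rather than on
  \<open>f x\<close>: \<open>\<phi>\<close> has to be differentiable only at the values taken by
  \<open>f\<close>. This suits real powers, which are differentiated where the base is
  positive.\<close>

lemma C1_gradient_compose:
  assumes "C1_gradient f f'" "\<And>x. (\<phi> has_real_derivative \<phi>' x) (at (f x))" "continuous_on UNIV \<phi>'"
  shows "C1_gradient (\<lambda>x. \<phi> (f x)) (\<lambda>x. \<phi>' x *\<^sub>R f' x)"
  unfolding C1_gradient_def inner_scaleR_left
proof safe
  show "((\<lambda>x. \<phi> (f x)) has_derivative (\<lambda>h. \<phi>' x * (f' x \<bullet> h))) (at x)" for x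
    using has_derivative_compose[of f "\<lambda>h. f' x \<bullet> h" x UNIV \<phi> "\<lambda>h. \<phi>' x * h"] assms
    by (auto simp: C1_gradient_def has_field_derivative_def)
  show "continuous_on UNIV (\<lambda>x. \<phi>' x *\<^sub>R f' x)"
    using assms by (auto simp: C1_gradient_def intro!: continuous_intros)
qed

lemma C1_gradient_compose':
  assumes "C1_gradient f f'" "\<And>y. (\<phi> has_real_derivative \<phi>' y) (at y)" "continuous_on UNIV \<phi>'"
  shows "C1_gradient (\<lambda>x. \<phi> (f x)) (\<lambda>x. \<phi>' (f x) *\<^sub>R f' x)"
  using assms C1_gradient_continuous[OF assms(1)]
  by (intro C1_gradient_compose) (auto intro: continuous_on_compose2)

lemma C1_gradient_power2_norm: "C1_gradient (\<lambda>x. (norm (x - c))\<^sup>2) (\<lambda>x. 2 *\<^sub>R (x - c))"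
  unfolding C1_gradient_def power2_norm_eq_inner
  by (auto intro!: derivative_eq_intros continuous_intros simp: inner_commute)

lemma C1_gradient_line:
  assumes "C1_gradient f g"
  shows "((\<lambda>t. f (x + t *\<^sub>R v)) has_real_derivative g (x + t *\<^sub>R v) \<bullet> v) (at t)"
proof -
  have "((\<lambda>t. x + t *\<^sub>R v) has_derivative (\<lambda>h. h *\<^sub>R v)) (at t)"
    by (auto intro!: derivative_eq_intros)
  from has_derivative_compose[OF this, of f "\<lambda>h. g (x + t *\<^sub>R v) \<bullet> h"] assms
  show ?thesis
    by (auto simp: C1_gradient_def has_field_derivative_def mult_commute_abs)
qed

lemma C1_gradient_eq_0:
  assumes "C1_gradient f g" "open S" "x \<in> S" "\<And>y. y \<in> S \<Longrightarrow> f y = c"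
  shows "g x = 0"
proof -
  have "(f has_derivative (\<lambda>h. 0)) (at x)"
    using has_derivative_transform_within_open[OF has_derivative_const assms(2,3)] assms(4) by metis
  moreover have "(f has_derivative (\<lambda>h. g x \<bullet> h)) (at x)" using assms(1) by (auto simp: C1_gradient_def)
  ultimately have "(\<lambda>h. g x \<bullet> h) = (\<lambda>h. 0)" using has_derivative_unique by blast
  then show ?thesis by (metis inner_eq_zero_iff)
qed

lemma C1_gradient_components:
  fixes \<phi> :: "real^'n::finite \<Rightarrow> real^'n"
  assumes "\<And>i. C1_gradient (\<lambda>x. \<phi> x $ i) (g i)"
  shows "(\<phi> has_derivative (\<lambda>h. \<chi> i. g i x \<bullet> h)) (at x)"
    and "frechet_derivative \<phi> (at x) (axis j 1) $ i = g i x $ j"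
    and "divg \<phi> x = (\<Sum>i\<in>UNIV. g i x $ i)"
proof -
  show d: "(\<phi> has_derivative (\<lambda>h. \<chi> i. g i x \<bullet> h)) (at x)" for x
    using assms unfolding C1_gradient_def
    by (subst has_derivative_componentwise_within) (auto simp: Basis_vec_def inner_axis)
  then have "frechet_derivative \<phi> (at x) = (\<lambda>h. \<chi> i. g i x \<bullet> h)" for x
    using frechet_derivative_at by metis
  then show e: "frechet_derivative \<phi> (at x) (axis j 1) $ i = g i x $ j" for i j x
    by (simp add: inner_axis)
  show "divg \<phi> x = (\<Sum>i\<in>UNIV. g i x $ i)" by (simp add: divg_def e)
qed

lemma c1cI:
  fixes \<phi> :: "real^'n::finite \<Rightarrow> real^'n"
  assumes "\<And>i. C1_gradient (\<lambda>x. \<phi> x $ i) (g i)"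
    and "compact K" "K \<subseteq> U" "\<And>x. x \<notin> K \<Longrightarrow> \<phi> x = 0"
  shows "c1c U \<phi>"
proof -
  note c = C1_gradient_components[of \<phi> g, OF assms(1)]
  have sub: "closure {x. \<phi> x \<noteq> 0} \<subseteq> K"
    using assms by (intro closure_minimal compact_imp_closed) auto
  then have "compact (closure {x. \<phi> x \<noteq> 0})"
    using assms(2) by (metis closed_closure compact_Int_closed inf.absorb_iff2)
  moreover have "continuous_on UNIV (\<lambda>x. g i x $ j)" for i j
    using assms(1)[of i] unfolding C1_gradient_def by (intro continuous_on_component) auto
  moreover have "\<phi> differentiable (at x)" for x
    using c(1)[of x] unfolding differentiable_def by blast
  ultimately show ?thesis
    using subset_trans[OF sub assms(3)] by (simp add: c1c_def c(2))
qed

text \<open>The rows of the Jacobian serve as gradients. Differentiability recovers the full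
  derivative from the partial derivatives, by expansion in the coordinate basis, and continuity of
  the latter is part of \<open>c1c\<close>.\<close>

lemma c1cD:
  fixes \<phi> :: "real^'n::finite \<Rightarrow> real^'n"
  assumes "c1c U \<phi>"
  obtains g K where "\<And>i. C1_gradient (\<lambda>x. \<phi> x $ i) (g i)" "compact K" "K \<subseteq> U"
    "\<And>x. x \<notin> K \<Longrightarrow> \<phi> x = 0"
proof
  let ?g = "\<lambda>i x. \<chi> j. frechet_derivative \<phi> (at x) (axis j 1) $ i"
  let ?K = "closure {x. \<phi> x \<noteq> 0}"
  show "C1_gradient (\<lambda>x. \<phi> x $ i) (?g i)" for i
    unfolding C1_gradient_def
  proof safe
    show "continuous_on UNIV (?g i)"
      using assms unfolding c1c_def by (auto intro: continuous_intros)
    fix x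
    have d: "(\<phi> has_derivative frechet_derivative \<phi> (at x)) (at x)"
      using assms unfolding c1c_def by (meson frechet_derivative_works)
    then have lin: "linear (frechet_derivative \<phi> (at x))"
      by (rule has_derivative_linear)
    have e: "frechet_derivative \<phi> (at x) h $ i = ?g i x \<bullet> h" for h
    proof -
      have "frechet_derivative \<phi> (at x) h = frechet_derivative \<phi> (at x) (\<Sum>j\<in>UNIV. h $ j *\<^sub>R axis j 1)"
        using basis_expansion[of h] by (simp add: scalar_mult_eq_scaleR)
      also have "\<dots> = (\<Sum>j\<in>UNIV. h $ j *\<^sub>R frechet_derivative \<phi> (at x) (axis j 1))"
        using lin by (simp add: linear_sum linear_cmul)
      finally have "frechet_derivative \<phi> (at x) h $ i
          = (\<Sum>j\<in>UNIV. h $ j *\<^sub>R frechet_derivative \<phi> (at x) (axis j 1)) $ i" by (rule arg_cong)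
      also have "\<dots> = (\<Sum>j\<in>UNIV. h $ j * frechet_derivative \<phi> (at x) (axis j 1) $ i)"
        by (simp only: sum_component vector_scaleR_component real_scaleR_def)
      also have "\<dots> = ?g i x \<bullet> h" unfolding inner_vec_def by (intro sum.cong) auto
      finally show ?thesis .
    qed
    show "((\<lambda>x. \<phi> x $ i) has_derivative (\<lambda>h. ?g i x \<bullet> h)) (at x)"
      by (rule has_derivative_eq_rhs[OF bounded_linear.has_derivative[OF bounded_linear_vec_nth d]])
        (rule ext, rule e)
  qed
  show "compact ?K" "?K \<subseteq> U" using assms by (simp_all add: c1c_def)
  show "\<phi> x = 0" if "x \<notin> ?K" for x using that closure_subset[of "{x. \<phi> x \<noteq> 0}"] by blast
qed

lemma C1_gradient_bounded_support:
  assumes "C1_gradient f g" "compact K" "\<And>x. x \<notin> K \<Longrightarrow> f x = 0"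
  obtains B where "B > 0" "\<And>x. \<bar>f x\<bar> \<le> B" "\<And>x. norm (g x) \<le> B" "\<And>x. x \<notin> K \<Longrightarrow> g x = 0"
proof -
  have "bounded (f ` K)" "bounded (g ` K)"
    using assms C1_gradient_continuous[OF assms(1)]
    by (auto intro!: compact_imp_bounded compact_continuous_image simp: C1_gradient_def
        intro: continuous_on_subset)
  then obtain B1 B2 where B: "\<And>x. x \<in> K \<Longrightarrow> \<bar>f x\<bar> \<le> B1" "\<And>x. x \<in> K \<Longrightarrow> norm (g x) \<le> B2"
    unfolding bounded_iff by auto
  have z: "g x = 0" if "x \<notin> K" for x
    by (rule C1_gradient_eq_0[OF assms(1), of "- K" x 0]) (use that assms compact_imp_closed in auto)
  have "\<bar>f x\<bar> \<le> max 1 (max B1 B2)" "norm (g x) \<le> max 1 (max B1 B2)" for x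
    using B[of x] z[of x] assms(3)[of x] by (cases "x \<in> K"; force)+
  with z that[of "max 1 (max B1 B2)"] show ?thesis by force
qed

section \<open>Vanishing integrals of directional derivatives\<close>

text \<open>Translation invariance makes every difference quotient of \<open>g\<close> integrate to
  0, and dominated convergence passes to the limit. Only a bounded pointwise derivative in the
  direction \<open>v\<close> is asked for; \<open>G\<close> is measurable as a limit of the
  quotients.\<close>

lemma integral_directional_derivative_zero:
  fixes g G :: "'a::euclidean_space \<Rightarrow> real"
  assumes der: "\<And>x. ((\<lambda>t. g (x + t *\<^sub>R v)) has_real_derivative G x) (at 0)"
    and B: "\<And>x. \<bar>G x\<bar> \<le> B" and A: "\<And>x. \<bar>g x\<bar> \<le> A"
    and supp: "\<And>x. x \<notin> cball 0 \<rho> \<Longrightarrow> g x = 0" and [measurable]: "g \<in> borel_measurable borel"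
  shows "integrable lborel G" "(\<integral>x. G x \<partial>lborel) = 0"
proof -
  define D where "D m x = real (Suc m) * (g (x + (1 / real (Suc m)) *\<^sub>R v) - g x)" for m x
  have B0: "B \<ge> 0" using B[of undefined] by linarith
  have A0: "A \<ge> 0" using A[of undefined] by linarith
  have der': "((\<lambda>t. g (x + t *\<^sub>R v)) has_real_derivative G (x + t *\<^sub>R v)) (at t)" for x t
    using der[of "x + t *\<^sub>R v"] DERIV_shift[of "\<lambda>u. g (x + u *\<^sub>R v)" _ 0 t]
    by (simp add: algebra_simps)
  have Dm[measurable]: "D m \<in> borel_measurable borel" for m
    unfolding D_def[abs_def] by measurable
  \<comment> \<open>The mean value theorem bounds the quotient by \<open>B\<close>; since the shift
    has length at most \<open>norm v\<close>, the quotient vanishes outside the enlarged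
    ball.\<close>
  have Dle: "\<bar>D m x\<bar> \<le> B * indicator (cball 0 (\<bar>\<rho>\<bar> + norm v)) x" for m x
  proof (cases "x \<in> cball 0 (\<bar>\<rho>\<bar> + norm v)")
    case True
    obtain z where "g (x + (1 / real (Suc m)) *\<^sub>R v) - g (x + 0 *\<^sub>R v) = (1 / real (Suc m) - 0) * G (x + z *\<^sub>R v)"
      using MVT2[of 0 "1 / real (Suc m)" "\<lambda>t. g (x + t *\<^sub>R v)" "\<lambda>t. G (x + t *\<^sub>R v)"] der' by auto
    then have "D m x = G (x + z *\<^sub>R v)" by (simp add: D_def del: of_nat_Suc)
    with B True show ?thesis by simp
  next
    case False
    have "norm x \<le> norm (x + (1 / real (Suc m)) *\<^sub>R v) + norm v"
    proof -
      have "norm x \<le> norm (x + (1 / real (Suc m)) *\<^sub>R v) + norm ((1 / real (Suc m)) *\<^sub>R v)"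
        using norm_triangle_ineq4[of "x + (1 / real (Suc m)) *\<^sub>R v" "(1 / real (Suc m)) *\<^sub>R v"] by simp
      also have "norm ((1 / real (Suc m)) *\<^sub>R v) \<le> norm v"
        by (simp add: divide_le_eq mult_left_le_one_le field_simps)
      finally show ?thesis by simp
    qed
    then have "x + (1 / real (Suc m)) *\<^sub>R v \<notin> cball 0 \<rho>" "x \<notin> cball 0 \<rho>"
      using False norm_ge_zero[of v] by (auto simp del: of_nat_Suc norm_ge_zero)
    then show ?thesis using supp False by (simp add: D_def)
  qed
  have Dlim: "(\<lambda>m. D m x) \<longlonglongrightarrow> G x" for x
  proof -
    have "((\<lambda>h. (g (x + h *\<^sub>R v) - g x) / h) \<longlongrightarrow> G x) (at 0)"
      using der[of x] by (simp add: has_field_derivative_iff)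
    moreover have "filterlim (\<lambda>m. 1 / real (Suc m)) (at 0) sequentially"
      unfolding filterlim_at using LIMSEQ_inverse_real_of_nat by (auto simp: inverse_eq_divide)
    ultimately have "(\<lambda>m. (g (x + (1 / real (Suc m)) *\<^sub>R v) - g x) / (1 / real (Suc m))) \<longlonglongrightarrow> G x"
      by (rule filterlim_compose)
    then show ?thesis by (simp add: D_def mult.commute del: of_nat_Suc)
  qed
  have Gm[measurable]: "G \<in> borel_measurable borel"
    by (rule borel_measurable_LIMSEQ_real[OF Dlim]) auto
  have fin: "emeasure lborel (cball (0::'a) r) < top" for r
    using emeasure_lborel_cball_finite[of 0 r] by simp
  have w: "integrable lborel (\<lambda>x::'a. B * indicator (cball 0 (\<bar>\<rho>\<bar> + norm v)) x :: real)"
    by (intro integrable_mult_right integrable_real_indicator) (simp_all add: fin infinity_ennreal_def)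
  have int_g: "integrable lborel g"
  proof (rule Bochner_Integration.integrable_bound)
    show "integrable lborel (\<lambda>x::'a. A * indicator (cball 0 \<rho>) x :: real)"
      by (intro integrable_mult_right integrable_real_indicator) (simp_all add: fin infinity_ennreal_def)
    show "AE x in lborel. norm (g x) \<le> norm (A * indicator (cball 0 \<rho>) x)"
      using A A0 supp by (auto simp: indicator_def)
  qed simp
  have "integral\<^sup>L lborel (D m) = 0" for m
  proof -
    let ?c = "(1 / real (Suc m)) *\<^sub>R v"
    have tr: "distr lborel borel ((+) ?c) = (lborel :: 'a measure)"
      by (rule lborel_distr_plus)
    have "(\<integral>x. g (?c + x) \<partial>lborel) = (\<integral>x. g x \<partial>distr lborel borel ((+) ?c))"
      by (subst integral_distr) auto
    moreover have "integrable lborel (\<lambda>x. g (?c + x))"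
      using int_g by (subst (asm) tr[symmetric]) (simp add: integrable_distr_eq)
    ultimately show ?thesis using int_g
      unfolding D_def[abs_def] tr by (simp add: add.commute[of _ ?c] del: of_nat_Suc)
  qed
  moreover have "(\<lambda>m. integral\<^sup>L lborel (D m)) \<longlonglongrightarrow> integral\<^sup>L lborel G"
    by (rule integral_dominated_convergence[OF _ _ w]) (use Dlim Dle in auto)
  ultimately show "(\<integral>x. G x \<partial>lborel) = 0"
    by (simp add: LIMSEQ_const_iff)
  show "integrable lborel G"
    by (rule integrable_dominated_convergence[OF _ _ w, where s=D]) (use Dlim Dle in auto)
qed

section \<open>The profile\<close>

locale drop_profile =
  fixes \<alpha> :: real
  assumes \<alpha>_pos: "0 < \<alpha>" and \<alpha>_less_1: "\<alpha> < 1"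
begin

text \<open>
  \<open>Q\<close> is the square of the radius of the horizontal slice, and \<open>(P x', V)\<close> is the unit normal at a
  boundary point, so that \<open>P\<^sup>2 Q + V\<^sup>2 = 1\<close> and \<open>Q' = - 2 V / P\<close>. The extensions of \<open>Q\<close> by 0
  and of \<open>V\<close> by -1 below height 0, and of \<open>V\<close> by 1 above \<open>T\<close>, keep both continuous.
\<close>

definition s :: real where "s = 1 / (1 + \<alpha>)"
text \<open>\<open>R\<close> is the radius of the ball and \<open>c\<close> the height of its
  centre, so that \<open>T\<close> is the top height; \<open>c - 1 = s\<close> and
  \<open>R\<^sup>2 - s\<^sup>2 = 1\<close> say that the slice of the ball at height 1 has radius 1,
  like that of the lower piece.\<close>

definition R :: real where "R = sqrt (1 + s\<^sup>2)"
definition c :: real where "c = 1 + s"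
definition T :: real where "T = c + R"

definition Q :: "real \<Rightarrow> real" where
  "Q y = (if y < 1 then max 0 y powr (2 * s) else R\<^sup>2 - (y - c)\<^sup>2)"
definition P :: "real \<Rightarrow> real" where
  "P y = (if y < 1 then y powr (1 - 2 * s) / sqrt (s\<^sup>2 + y powr (2 - 2 * s)) else 1 / R)"
definition V :: "real \<Rightarrow> real" where
  "V y = (if y < 1 then - s / sqrt (s\<^sup>2 + max 0 y powr (2 - 2 * s)) else min 1 ((y - c) / R))"

lemma s_gt_half: "1 / 2 < s" and s_less_1: "s < 1" and s_pos: "0 < s"
  using \<alpha>_pos \<alpha>_less_1 by (auto simp: s_def field_simps)

lemma R_sq: "R\<^sup>2 = 1 + s\<^sup>2" by (simp add: R_def)
lemma R_gt_1: "1 < R" using s_pos by (simp add: R_def)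
lemma R_pos: "0 < R" using R_gt_1 by simp
lemma R_gt_s: "s < R" using R_gt_1 s_less_1 by simp
lemma T_gt_1: "1 < T" using s_pos R_pos by (simp add: T_def c_def)
lemma T_gt_c: "c < T" using R_pos by (simp add: T_def)

lemma Q_upper: "1 \<le> y \<Longrightarrow> Q y = (T - y) * (y - (c - R))"
  by (simp add: Q_def T_def power2_eq_square algebra_simps)

lemma Q_lower: "0 < y \<Longrightarrow> y \<le> 1 \<Longrightarrow> Q y = y powr (2 * s)"
  using R_sq by (auto simp: Q_def c_def)

lemma Q_nonpos: "y \<le> 0 \<Longrightarrow> Q y = 0"
  by (auto simp: Q_def)

lemma Q_T: "Q T = 0" using T_gt_1 by (simp add: Q_upper)

lemma Q_0: "Q 0 = 0" by (simp add: Q_nonpos)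

lemma Q_pos: "0 < y \<Longrightarrow> y < T \<Longrightarrow> 0 < Q y"
proof (cases "y < 1")
  case False
  assume "y < T"
  with False show ?thesis using R_gt_s by (auto simp: Q_upper c_def intro!: mult_pos_pos)
qed (auto simp: Q_def)

lemma Q_neg: "T < y \<Longrightarrow> Q y < 0"
  using T_gt_1 R_gt_s by (auto simp: Q_upper c_def intro!: mult_neg_pos)

lemma Q_pos_iff: "0 < Q y \<longleftrightarrow> 0 < y \<and> y < T"
  using Q_pos Q_neg Q_nonpos Q_T by (metis less_le_not_le linorder_neqE_linordered_idom order.irrefl order.refl)

lemma Q_le_R2: "Q y \<le> R\<^sup>2"
proof (cases "y < 1")
  case True
  then have "max 0 y powr (2 * s) \<le> 1 powr (2 * s)"
    using s_pos by (intro powr_mono2) auto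
  also have "\<dots> \<le> R\<^sup>2" by (simp add: R_sq)
  finally show ?thesis using True by (simp add: Q_def)
qed (simp add: Q_def)

lemma continuous_Q: "isCont Q y"
proof (cases "y = 1")
  case False
  have c1: "isCont (\<lambda>y. max 0 y powr (2 * s)) y"
    using s_pos by (intro continuous_on_interior[of UNIV] continuous_on_powr' continuous_intros) auto
  show ?thesis
  proof (cases "y < 1")
    case True
    show ?thesis
      by (rule isCont_cong_open[OF c1, of "{..<1}"]) (use True in \<open>auto simp: Q_def\<close>)
  next
    case F: False
    have "isCont (\<lambda>y. R\<^sup>2 - (y - c)\<^sup>2) y" by (intro continuous_intros)
    then show ?thesis
      by (rule isCont_cong_open[of _ _ "{1<..}"]) (use F False in \<open>auto simp: Q_def\<close>)
  qed
next
  case True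
  have c1: "isCont (\<lambda>y. max 0 y powr (2 * s)) y"
    using s_pos by (intro continuous_on_interior[of UNIV] continuous_on_powr' continuous_intros) auto
  show ?thesis unfolding Q_def[abs_def] True
    by (rule isCont_If_less) (use c1 True R_sq in \<open>auto simp: c_def intro!: continuous_intros\<close>)
qed

lemma continuous_on_Q: "continuous_on S Q"
  using continuous_Q by (simp add: continuous_at_imp_continuous_on)

lemma denom_pos: "0 < s\<^sup>2 + u powr a"
  using s_pos by (simp add: add_pos_nonneg)

lemma R_eq: "sqrt (s\<^sup>2 + 1) = R" by (simp add: R_def add.commute)

lemma V_lower: "y \<le> 1 \<Longrightarrow> V y = - s / sqrt (s\<^sup>2 + max 0 y powr (2 - 2 * s))"
  using R_pos s_pos R_eq by (cases "y = 1") (auto simp: V_def c_def min_def field_simps)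

lemma V_upper: "1 \<le> y \<Longrightarrow> V y = min 1 ((y - c) / R)"
  by (simp add: V_def)

lemma V_nonpos: "y \<le> 0 \<Longrightarrow> V y = -1"
  using s_pos by (simp add: V_def)

lemma P_lower: "0 < y \<Longrightarrow> y \<le> 1 \<Longrightarrow> P y = y powr (1 - 2 * s) / sqrt (s\<^sup>2 + y powr (2 - 2 * s))"
  using R_eq by (cases "y = 1") (auto simp: P_def)

lemma P_pos: "0 < y \<Longrightarrow> 0 < P y"
  using R_pos denom_pos by (simp add: P_def)

lemma isCont_P: assumes "0 < y" shows "isCont P y"
proof -
  have c1: "isCont (\<lambda>y. y powr (1 - 2 * s) / sqrt (s\<^sup>2 + y powr (2 - 2 * s))) y"
    using assms denom_pos[of y "2 - 2 * s"] by (intro continuous_intros) auto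
  consider "y < 1" | "y = 1" | "1 < y" by linarith
  then show ?thesis
  proof cases
    case 1
    show ?thesis
      by (rule isCont_cong_open[OF c1, of "{0<..<1}"]) (use 1 assms in \<open>auto simp: P_def\<close>)
  next
    case 2
    show ?thesis unfolding P_def[abs_def] 2
      by (rule isCont_If_less) (use c1 2 R_eq in \<open>auto intro!: continuous_intros\<close>)
  next
    case 3
    show ?thesis
      by (rule isCont_cong_open[OF continuous_const[of "at y" "1 / R"], of "{1<..}"]) (use 3 in \<open>auto simp: P_def\<close>)
  qed
qed

text \<open>Below 1 the numerator decreases because 2 s > 1 and the denominator increases because s
  < 1; above 1 \<open>P\<close> is the constant 1 / R. An average of \<open>P\<close> over an upward
  window is therefore at most the value of \<open>P\<close> at its lower end.\<close>

lemma P_antimono: assumes "0 < a" "a \<le> b" shows "P b \<le> P a"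
proof -
  have *: "P b \<le> P a" if "0 < a" "a \<le> b" "b \<le> 1" for a b
  proof -
    have "b powr (1 - 2 * s) \<le> a powr (1 - 2 * s)"
      using that s_gt_half by (intro powr_mono2') auto
    moreover have "a powr (2 - 2 * s) \<le> b powr (2 - 2 * s)"
      using that s_less_1 by (intro powr_mono2) auto
    ultimately show ?thesis using that denom_pos
      by (auto simp: P_lower intro!: frac_le)
  qed
  consider "b \<le> 1" | "a \<le> 1" "1 \<le> b" | "1 \<le> a" by linarith
  then show ?thesis
  proof cases
    case 2
    then have "P b = P 1" by (simp add: P_def)
    with *[of a 1] assms 2 show ?thesis by simp
  qed (use * assms in \<open>auto simp: P_def\<close>)
qed

lemma P_ge: "0 < y \<Longrightarrow> 1 / R \<le> P y"
  using P_antimono[of y "max 1 y"] by (simp add: P_def)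

lemma isCont_V: "isCont V y"
proof -
  have c1: "isCont (\<lambda>y. - s / sqrt (s\<^sup>2 + max 0 y powr (2 - 2 * s))) y"
    using s_less_1 denom_pos s_pos
    by (intro continuous_on_interior[of UNIV] continuous_on_powr' continuous_intros)
       (auto simp: less_imp_neq[symmetric])
  have c2: "isCont (\<lambda>y. min 1 ((y - c) / R)) y" using R_pos by (intro continuous_intros) auto
  consider "y < 1" | "y = 1" | "1 < y" by linarith
  then show ?thesis
  proof cases
    case 1
    show ?thesis
      by (rule isCont_cong_open[OF c1, of "{..<1}"]) (use 1 in \<open>auto simp: V_def\<close>)
  next
    case 2
    show ?thesis unfolding V_def[abs_def] 2
      by (rule isCont_If_less) (use c1 c2 2 V_lower[of 1] V_upper[of 1] in \<open>auto\<close>)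
  next
    case 3
    show ?thesis
      by (rule isCont_cong_open[OF c2, of "{1<..}"]) (use 3 in \<open>auto simp: V_def\<close>)
  qed
qed

lemma continuous_on_V: "continuous_on S V"
  using isCont_V by (simp add: continuous_at_imp_continuous_on)

text \<open>Monotonicity of the vertical normal component is the analytic form of convexity; it also
  gives the vertical part of the calibration a nonnegative divergence.\<close>

lemma V_mono: assumes "a \<le> b" shows "V a \<le> V b"
proof -
  have *: "V a \<le> V b" if "a \<le> b" "b \<le> 1" for a b
  proof -
    have "max 0 a powr (2 - 2 * s) \<le> max 0 b powr (2 - 2 * s)"
      using that s_less_1 by (intro powr_mono2) auto
    then have "s / sqrt (s\<^sup>2 + max 0 b powr (2 - 2 * s)) \<le> s / sqrt (s\<^sup>2 + max 0 a powr (2 - 2 * s))"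
      using s_pos denom_pos by (intro divide_left_mono) (auto intro!: mult_pos_pos)
    then show ?thesis using that by (simp add: V_lower)
  qed
  have **: "V a \<le> V b" if "a \<le> b" "1 \<le> a" for a b
    using that R_pos by (auto simp: V_upper min_def divide_simps)
  show ?thesis using *[of a b] **[of a b] *[of a 1] **[of 1 b] assms by linarith
qed

lemma V_le_1: "V y \<le> 1" and V_ge_m1: "- 1 \<le> V y"
proof -
  show "V y \<le> 1" using V_mono[of y "max y 1"] by (auto simp: V_upper)
  show "- 1 \<le> V y" using V_mono[of "min 0 y" y] by (auto simp: V_nonpos)
qed

lemma PQV: assumes "0 < y" "y < T" shows "(P y)\<^sup>2 * Q y + (V y)\<^sup>2 = 1"
proof (cases "y < 1")
  case True
  let ?d = "s\<^sup>2 + y powr (2 - 2 * s)"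
  have d: "?d > 0" by (rule denom_pos)
  have "(y powr (1 - 2 * s))\<^sup>2 * y powr (2 * s) = y powr (2 - 2 * s)"
    by (simp add: power2_eq_square powr_add[symmetric])
  then have "(P y)\<^sup>2 * Q y = y powr (2 - 2 * s) / ?d"
    using True assms d by (simp add: P_def Q_def power_divide)
  moreover have "(V y)\<^sup>2 = s\<^sup>2 / ?d"
    using True assms d by (simp add: V_def power_divide)
  ultimately show ?thesis using d by (simp add: add_divide_distrib[symmetric] add.commute)
next
  case False
  then have "V y = (y - c) / R" using assms R_pos by (simp add: V_upper T_def divide_simps min_def)
  then have "(V y)\<^sup>2 = (y - c)\<^sup>2 / R\<^sup>2" by (simp add: power_divide)
  moreover have "(P y)\<^sup>2 * Q y = (R\<^sup>2 - (y - c)\<^sup>2) / R\<^sup>2"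
    using False by (simp add: P_def Q_def power_divide)
  ultimately show ?thesis using R_pos by (simp add: add_divide_distrib[symmetric])
qed

lemma abs_V_less_1: assumes "0 < y" "y < T" shows "(V y)\<^sup>2 < 1"
  using PQV[OF assms] P_pos[of y] Q_pos[of y] assms by (smt (verit) mult_pos_pos zero_less_power)

text \<open>At height 1 both branches have slope 2 s, because c - 1 = s: the sphere continues the
  lower profile in a C1 fashion. Expressing the slope by \<open>V\<close> and \<open>P\<close> keeps
  later formulas free of the case distinction.\<close>

lemma DERIV_Q: assumes "0 < y" "y < T" shows "(Q has_real_derivative (- 2 * V y / P y)) (at y)"
proof -
  have l: "- 2 * V y / P y = 2 * s * y powr (2 * s - 1)" if "y \<le> 1"
    using that assms denom_pos[of y "2 - 2 * s"]
    by (simp add: V_lower P_lower powr_minus_divide[symmetric] divide_powr_uminus)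
  have u: "- 2 * V y / P y = - 2 * (y - c)" if "1 \<le> y"
    using that assms R_pos by (simp add: V_upper P_def T_def divide_simps min_def)
  have d1: "((\<lambda>y. max 0 y powr (2 * s)) has_real_derivative 2 * s * y powr (2 * s - 1)) (at y)"
  proof (rule DERIV_cong_open)
    show "((\<lambda>y. y powr (2 * s)) has_real_derivative 2 * s * y powr (2 * s - 1)) (at y)"
      using assms by (auto intro!: derivative_eq_intros)
  qed (use assms in \<open>auto intro: open_greaterThan\<close>)
  have d2: "((\<lambda>y. R\<^sup>2 - (y - c)\<^sup>2) has_real_derivative - 2 * (y - c)) (at y)"
    by (auto intro!: derivative_eq_intros)
  consider "y < 1" | "y = 1" | "1 < y" by linarith
  then show ?thesis
  proof cases
    case 1
    show ?thesis unfolding l[OF less_imp_le[OF 1]]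
      by (rule DERIV_cong_open[OF d1, of "{..<1}"]) (use 1 in \<open>auto simp: Q_def\<close>)
  next
    case 2
    show ?thesis unfolding Q_def[abs_def] using 2 l u d1 d2 R_sq
      by (auto intro!: DERIV_If_less simp: c_def)
  next
    case 3
    show ?thesis unfolding u[OF less_imp_le[OF 3]]
      by (rule DERIV_cong_open[OF d2, of "{1<..}"]) (use 3 in \<open>auto simp: Q_def\<close>)
  qed
qed

text \<open>Serves to write bounds that are constant above height 1 as multiples of
  \<open>y powr (1 - 2 * s)\<close>, the growth rate at the tip, on the whole range up to
  \<open>T\<close>.\<close>

lemma T_powr_bound: "0 < y \<Longrightarrow> y \<le> T \<Longrightarrow> 1 \<le> T powr (2 * s - 1) * y powr (1 - 2 * s)"
proof -
  assume y: "0 < y" "y \<le> T"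
  then have "T powr (1 - 2 * s) \<le> y powr (1 - 2 * s)"
    using s_gt_half by (intro powr_mono2') auto
  then have "T powr (2 * s - 1) * T powr (1 - 2 * s) \<le> T powr (2 * s - 1) * y powr (1 - 2 * s)"
    by (intro mult_left_mono) auto
  then show ?thesis using T_gt_1 by (simp add: powr_add[symmetric])
qed

lemma P_le: assumes "0 < y" "y \<le> T"
  shows "P y \<le> (1 / s + T powr (2 * s - 1)) * y powr (1 - 2 * s)"
proof (cases "y < 1")
  case True
  have "s \<le> sqrt (s\<^sup>2 + y powr (2 - 2 * s))" using s_pos by (intro real_le_rsqrt) auto
  then have "P y \<le> 1 / s * y powr (1 - 2 * s)"
    using True assms s_pos by (auto simp: P_def intro!: frac_le)
  moreover have "0 \<le> T powr (2 * s - 1) * y powr (1 - 2 * s)" by simp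
  ultimately show ?thesis unfolding distrib_right by linarith
next
  case False
  have "P y \<le> 1" using False R_gt_1 by (simp add: P_def)
  also have "\<dots> \<le> T powr (2 * s - 1) * y powr (1 - 2 * s)" using T_powr_bound assms by blast
  also have "\<dots> \<le> (1 / s + T powr (2 * s - 1)) * y powr (1 - 2 * s)"
    using s_pos by (intro mult_right_mono) auto
  finally show ?thesis .
qed

text \<open>Below 1 the derivative of \<open>V\<close> is s (1 - s) y^(1 - 2 s) / (s^2 + y^(2 - 2
  s))^(3/2), at most y^(1 - 2 s) / s^2; above 1 the slope is at most 1 / R < 1. The power is
  decreasing and is taken at the left end \<open>a\<close>; \<open>b\<close> may exceed
  \<open>T\<close>, since an upward window may reach above the body.\<close>

lemma V_increment: assumes "0 < a" "a \<le> b" "a \<le> T"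
  shows "V b - V a \<le> (1 / s\<^sup>2 + T powr (2 * s - 1)) * (b - a) * a powr (1 - 2 * s)"
proof -
  have lo: "V b - V a \<le> (1 / s\<^sup>2) * (b - a) * a powr (1 - 2 * s)" if "0 < a" "a \<le> b" "b \<le> 1" for a b
  proof (cases "a = b")
    case False
    let ?f = "\<lambda>y. - s / sqrt (s\<^sup>2 + y powr (2 - 2 * s))"
    let ?g = "\<lambda>y. s * (1 - s) * y powr (1 - 2 * s) / (sqrt (s\<^sup>2 + y powr (2 - 2 * s)) ^ 3)"
    have "\<exists>z>a. z < b \<and> ?f b - ?f a = (b - a) * ?g z"
    proof (rule MVT2)
      show "a < b" using False that by simp
      fix y assume "a \<le> y" "y \<le> b"
      then have y: "y > 0" using that by simp
      have d: "s\<^sup>2 + y powr (2 - 2 * s) > 0" by (rule denom_pos)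
      have "((\<lambda>y. s\<^sup>2 + y powr (2 - 2 * s)) has_real_derivative (2 - 2 * s) * y powr (1 - 2 * s)) (at y)"
        using y by (auto intro!: derivative_eq_intros)
      from DERIV_chain2[where g = "\<lambda>y. s\<^sup>2 + y powr (2 - 2 * s)", OF DERIV_real_sqrt[OF d] this]
      have "((\<lambda>y. sqrt (s\<^sup>2 + y powr (2 - 2 * s))) has_real_derivative
         inverse (sqrt (s\<^sup>2 + y powr (2 - 2 * s))) / 2 * ((2 - 2 * s) * y powr (1 - 2 * s))) (at y)" .
      note D = DERIV_divide[OF DERIV_const[of "- s"] this]
      have eq: "(0 * u - - s * (inverse u / 2 * ((2 - 2 * s) * p))) / (u * u) = s * (1 - s) * p / u ^ 3"
        if "0 < u" for u p :: real
        using that by (simp add: field_simps power3_eq_cube)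
      show "(?f has_real_derivative ?g y) (at y)"
        by (rule DERIV_cong[OF D eq]) (use d in auto)
    qed
    then obtain z where z: "a < z" "z < b" "?f b - ?f a = (b - a) * ?g z" by blast
    have "s \<le> sqrt (s\<^sup>2 + z powr (2 - 2 * s))" using s_pos by (intro real_le_rsqrt) auto
    then have "s ^ 3 \<le> sqrt (s\<^sup>2 + z powr (2 - 2 * s)) ^ 3" using s_pos by (intro power_mono) auto
    moreover have "s * (1 - s) * z powr (1 - 2 * s) \<le> s * 1 * a powr (1 - 2 * s)"
      using z that s_pos s_less_1 s_gt_half by (intro mult_mono powr_mono2') auto
    ultimately have "?g z \<le> s * 1 * a powr (1 - 2 * s) / s ^ 3"
      using s_pos s_less_1 by (intro frac_le) auto
    also have "\<dots> = 1 / s\<^sup>2 * a powr (1 - 2 * s)" using s_pos by (simp add: power3_eq_cube power2_eq_square)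
    finally have "(b - a) * ?g z \<le> (b - a) * (1 / s\<^sup>2 * a powr (1 - 2 * s))"
      using that by (intro mult_left_mono) auto
    with z(3) that show ?thesis by (simp add: V_lower mult_ac)
  qed simp
  have up: "V b - V a \<le> b - a" if "1 \<le> a" "a \<le> b" for a b
  proof -
    have "V b - V a \<le> (b - a) / R"
    proof -
      have "(a - c) / R \<le> (b - c) / R" using that R_pos by (simp add: divide_right_mono)
      moreover have "(b - c) / R - (a - c) / R = (b - a) / R" by (simp add: diff_divide_distrib)
      ultimately show ?thesis using that by (auto simp: V_upper min_def)
    qed
    also have "\<dots> \<le> b - a" using R_gt_1 that by (simp add: divide_le_eq mult_le_cancel_left1)
    finally show ?thesis .
  qed
  have one: "b - a \<le> T powr (2 * s - 1) * (b - a) * a' powr (1 - 2 * s)" if "a \<le> b" "0 < a'" "a' \<le> T" for a b a'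
    using mult_left_mono[OF T_powr_bound[OF that(2,3)], of "b - a"] that by (simp add: mult_ac)
  have nn: "0 \<le> T powr (2 * s - 1) * (b - a) * a powr (1 - 2 * s)"
     "0 \<le> 1 / s\<^sup>2 * (b - a) * a powr (1 - 2 * s)" if "a \<le> b" for a b using that by auto
  consider "b \<le> 1" | "a < 1" "1 < b" | "1 \<le> a" by linarith
  then show ?thesis
  proof cases
    case 1
    then show ?thesis using lo[OF assms(1,2)] nn(1)[OF assms(2)] unfolding distrib_right by linarith
  next
    case 2
    have "V b - V a = (V 1 - V a) + (V b - V 1)" by simp
    also have "\<dots> \<le> (1 / s\<^sup>2) * (1 - a) * a powr (1 - 2 * s) + T powr (2 * s - 1) * (b - 1) * a powr (1 - 2 * s)"
      using assms 2 by (intro add_mono lo order_trans[OF up one]) auto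
    also have "\<dots> \<le> (1 / s\<^sup>2) * (b - a) * a powr (1 - 2 * s) + T powr (2 * s - 1) * (b - a) * a powr (1 - 2 * s)"
      using 2 by (intro add_mono mult_right_mono mult_left_mono) auto
    finally show ?thesis by (simp add: distrib_right)
  next
    case 3
    then show ?thesis
      using up[OF _ assms(2)] one[OF assms(2,1,3)] nn(2)[OF assms(2)] unfolding distrib_right by linarith
  qed
qed

end

section \<open>Convexity and the boundary\<close>

locale convex_drop = drop_profile \<alpha> for \<alpha> :: real +
  fixes k :: "'n::finite"
  assumes card_ge_2: "2 \<le> CARD('n)"
begin

definition hp :: "real^'n \<Rightarrow> real^'n" where "hp x = x - x $ k *\<^sub>R axis k 1"

definition body :: "(real^'n) set" where "body = {x. (normp k x)\<^sup>2 < Q (x $ k)}"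

text \<open>\<open>Q\<close> is 0 at all negative heights, so the equation alone would also admit
  the axis below the tip; the bounds on the height exclude it.\<close>

definition surf :: "(real^'n) set" where
  "surf = {x. (normp k x)\<^sup>2 = Q (x $ k) \<and> 0 \<le> x $ k \<and> x $ k \<le> T}"

lemma hp_nth: "hp x $ i = (if i = k then 0 else x $ i)"
  by (simp add: hp_def axis_def)

lemma normp_eq: "normp k x = norm (hp x)"
proof -
  have "(\<Sum>i\<in>UNIV. (hp x $ i)\<^sup>2) = (\<Sum>i\<in>UNIV - {k}. (x $ i)\<^sup>2)"
    by (subst sum.remove[of _ k]) (auto simp: hp_nth intro!: sum.cong)
  then show ?thesis by (simp add: normp_def norm_vec_def L2_set_def)
qed

lemma normp_nonneg: "0 \<le> normp k x" by (simp add: normp_eq)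

lemma linear_hp: "linear hp"
  unfolding hp_def by (intro linearI) (auto simp: algebra_simps)

lemma hp_inner_axis: "hp x \<bullet> axis k 1 = 0"
  by (simp add: inner_axis hp_nth)

lemma hp_decomp: "x = hp x + x $ k *\<^sub>R axis k 1"
  by (simp add: hp_def)

lemma norm_decomp: "(norm (a + b *\<^sub>R axis k 1))\<^sup>2 = (norm a)\<^sup>2 + b\<^sup>2" if "a $ k = 0"
  for a :: "real^'n"
proof -
  have "orthogonal a (b *\<^sub>R axis k 1)" using that by (simp add: orthogonal_def inner_axis)
  from norm_add_Pythagorean[OF this] show ?thesis by simp
qed

lemma norm_sq: "(norm x)\<^sup>2 = (normp k x)\<^sup>2 + (x $ k)\<^sup>2"
  using norm_decomp[of "hp x" "x $ k"] by (simp add: hp_nth hp_decomp[symmetric] normp_eq)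

lemma normp_axis: "normp k (axis k a) = 0"
  by (simp add: normp_def axis_def)

lemma normp_diff_axis: "normp k (x - axis k a) = normp k x"
  by (simp add: normp_def axis_def)

lemma ball_axis: "x \<in> ball (axis k a) r \<longleftrightarrow> (normp k x)\<^sup>2 + (x $ k - a)\<^sup>2 < r\<^sup>2" if "r > 0"
proof -
  have "x \<in> ball (axis k a) r \<longleftrightarrow> (norm (x - axis k a))\<^sup>2 < r\<^sup>2"
    using that by (simp add: dist_norm norm_minus_commute abs_le_square_iff power2_less_imp_less
        power_strict_mono linorder_not_le[symmetric])
  then show ?thesis by (simp add: norm_sq normp_diff_axis)
qed

lemma continuous_normp: "continuous_on S (normp k)"
  unfolding normp_eq[abs_def] hp_def by (intro continuous_intros)

lemma continuous_nth: "continuous_on S (\<lambda>x. x $ k)" for S :: "(real^'n) set"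
  by (intro continuous_intros)

lemma continuous_Q_nth: "continuous_on S (\<lambda>x. Q (x $ k))" for S :: "(real^'n) set"
  by (rule continuous_on_compose2[OF continuous_on_Q[of UNIV] continuous_nth]) auto

lemma open_body: "open body"
  unfolding body_def
  by (intro open_Collect_less continuous_on_power continuous_normp continuous_Q_nth)

lemma closed_surf: "closed surf"
  unfolding surf_def
  by (intro closed_Collect_conj closed_Collect_eq closed_Collect_le continuous_on_power
      continuous_normp continuous_Q_nth continuous_nth continuous_on_const)

lemma body_nth: "x \<in> body \<Longrightarrow> 0 < x $ k \<and> x $ k < T"
  unfolding body_def Q_pos_iff[symmetric] by (auto intro: le_less_trans[OF zero_le_power2])

lemma powr_inv: "0 \<le> r \<Longrightarrow> (r powr (1 + \<alpha>)) powr s = r"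
  using \<alpha>_pos by (simp add: powr_powr s_def)

lemma powr_inv': "0 < r \<Longrightarrow> (r powr s) powr (1 + \<alpha>) = r"
  using \<alpha>_pos by (simp add: powr_powr s_def)

text \<open>The exponents 1 + \<alpha> and s are reciprocal; squaring then turns the condition into
  one on |x'|^2, the quantity compared with \<open>Q\<close>.\<close>

lemma lower_iff: "r powr (1 + \<alpha>) < y \<longleftrightarrow> r\<^sup>2 < y powr (2 * s)" if "0 < y" "0 \<le> r"
proof -
  have "r powr (1 + \<alpha>) < y \<longleftrightarrow> r < y powr s"
  proof
    assume "r powr (1 + \<alpha>) < y"
    then have "(r powr (1 + \<alpha>)) powr s < y powr s" using s_pos by (intro powr_less_mono2) auto
    then show "r < y powr s" using that by (simp add: powr_inv)
  next
    assume "r < y powr s"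
    then have "r powr (1 + \<alpha>) < (y powr s) powr (1 + \<alpha>)" using \<alpha>_pos that by (intro powr_less_mono2) auto
    then show "r powr (1 + \<alpha>) < y" using that by (simp add: powr_inv')
  qed
  also have "\<dots> \<longleftrightarrow> r\<^sup>2 < (y powr s)\<^sup>2"
    using that by (simp add: abs_le_square_iff[symmetric] linorder_not_le[symmetric])
  also have "(y powr s)\<^sup>2 = y powr (2 * s)" by (simp add: power2_eq_square powr_add[symmetric])
  finally show ?thesis .
qed

text \<open>The right side minus the left side vanishes at 1, where the profiles meet, and its
  derivative is at most 2 (y - 1), hence not positive. Below height 1 the ball thus adds nothing to
  the lower piece.\<close>

lemma ball_below: "R\<^sup>2 - (y - c)\<^sup>2 \<le> y powr (2 * s)" if "0 < y" "y \<le> 1"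
proof -
  let ?G = "\<lambda>y. y powr (2 * s) - R\<^sup>2 + (y - c)\<^sup>2"
  have "?G 1 \<le> ?G y"
  proof (rule DERIV_nonpos_imp_nonincreasing[OF that(2)])
    fix x assume x: "y \<le> x" "x \<le> 1"
    then have "x powr (2 * s - 1) \<le> 1 powr (2 * s - 1)"
      using that s_gt_half by (intro powr_mono2) auto
    then have "s * x powr (2 * s - 1) \<le> s" using s_pos by (simp add: mult_left_le)
    moreover have "(?G has_real_derivative 2 * s * x powr (2 * s - 1) + 2 * (x - c)) (at x)"
      using x that by (auto intro!: derivative_eq_intros)
    ultimately show "\<exists>d. (?G has_real_derivative d) (at x) \<and> d \<le> 0"
      using x by (intro exI[of _ "2 * s * x powr (2 * s - 1) + 2 * (x - c)"]) (auto simp: c_def)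
  qed
  then show ?thesis by (simp add: R_sq c_def)
qed

lemma body_eq:
  "{x. normp k x powr (1 + \<alpha>) < x $ k \<and> x $ k < 1}
     \<union> ball (axis k (1 + 1 / (1 + \<alpha>))) (sqrt (1 + (1 + \<alpha>) powr (-2))) = body"
proof -
  have e: "sqrt (1 + (1 + \<alpha>) powr (-2)) = R" "1 + 1 / (1 + \<alpha>) = c"
    using \<alpha>_pos by (auto simp: R_def s_def c_def powr_minus power_divide divide_simps)
  show ?thesis
  proof (intro set_eqI iffI)
    fix x assume "x \<in> {x. normp k x powr (1 + \<alpha>) < x $ k \<and> x $ k < 1}
     \<union> ball (axis k (1 + 1 / (1 + \<alpha>))) (sqrt (1 + (1 + \<alpha>) powr (-2)))"
    then consider "normp k x powr (1 + \<alpha>) < x $ k" "x $ k < 1" |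
        "(normp k x)\<^sup>2 + (x $ k - c)\<^sup>2 < R\<^sup>2"
      unfolding e using ball_axis[of R x c] R_pos by auto
    then show "x \<in> body"
    proof cases
      case 1
      then have "0 < x $ k" using powr_ge_zero[of "normp k x" "1 + \<alpha>"] by linarith
      with 1 show ?thesis by (auto simp: body_def Q_lower lower_iff[OF _ normp_nonneg])
    next
      case 2
      show ?thesis
      proof (cases "x $ k < 1")
        case True
        have "(x $ k - c)\<^sup>2 < R\<^sup>2" using 2 zero_le_power2[of "normp k x"] by linarith
        \<comment> \<open>1 + s^2 < (1 + s)^2: the ball does not reach down to height 0.\<close>
        moreover have "R\<^sup>2 < c\<^sup>2" using s_pos by (simp add: R_sq c_def power2_sum)
        ultimately have "(x $ k - c)\<^sup>2 < c\<^sup>2" by linarith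
        then have "\<bar>x $ k - c\<bar> < \<bar>c\<bar>" by (meson abs_le_square_iff not_le)
        then have "0 < x $ k" using s_pos by (auto simp: c_def)
        then show ?thesis using True 2 ball_below[of "x $ k"] by (auto simp: body_def Q_lower)
      next
        case False
        then show ?thesis using 2 by (simp add: body_def Q_def)
      qed
    qed
  next
    fix x assume x: "x \<in> body"
    show "x \<in> {x. normp k x powr (1 + \<alpha>) < x $ k \<and> x $ k < 1}
     \<union> ball (axis k (1 + 1 / (1 + \<alpha>))) (sqrt (1 + (1 + \<alpha>) powr (-2)))"
    proof (cases "x $ k < 1")
      case True
      then show ?thesis using body_nth[OF x] x
        by (auto simp: lower_iff[OF _ normp_nonneg] body_def Q_lower)
    next
      case False
      then show ?thesis unfolding e Un_iff using x ball_axis[of R x c] R_pos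
        by (auto simp: body_def Q_def)
    qed
  qed
qed

text \<open>By \<open>PQV\<close> the derivative of - sqrt Q is V / sqrt (1 - V^2). This is an
  increasing function of \<open>V\<close>, as the sign cases verify, and \<open>V\<close> increases
  with the height.\<close>

lemma sqrt_Q_convex: "convex_on {0<..<T} (\<lambda>y. - sqrt (Q y))"
proof (rule convex_on_realI[where f' = "\<lambda>y. V y / sqrt (1 - (V y)\<^sup>2)"])
  show "connected {0<..<T}" by simp
  fix y assume y: "y \<in> {0<..<T}"
  have p: "P y > 0" "Q y > 0" using P_pos Q_pos y by auto
  have "1 - (V y)\<^sup>2 = (P y)\<^sup>2 * Q y" using PQV[of y] y by auto
  then have sq: "sqrt (1 - (V y)\<^sup>2) = P y * sqrt (Q y)" using p by (simp add: real_sqrt_mult)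
  have "((\<lambda>y. - sqrt (Q y)) has_real_derivative - (inverse (sqrt (Q y)) / 2 * (- 2 * V y / P y))) (at y)"
    using DERIV_minus[OF DERIV_chain2[OF DERIV_real_sqrt[OF p(2)] DERIV_Q]] y by auto
  then show "((\<lambda>y. - sqrt (Q y)) has_real_derivative V y / sqrt (1 - (V y)\<^sup>2)) (at y)"
    unfolding sq by (rule DERIV_cong) (simp add: field_simps)
next
  fix x y assume "x \<in> {0<..<T}" "y \<in> {0<..<T}" and "x \<le> y"
  then have v: "(V x)\<^sup>2 < 1" "(V y)\<^sup>2 < 1" "V x \<le> V y" using abs_V_less_1 V_mono by auto
  show "V x / sqrt (1 - (V x)\<^sup>2) \<le> V y / sqrt (1 - (V y)\<^sup>2)"
  proof -
    consider "V x \<ge> 0" | "V x < 0" "V y \<ge> 0" | "V y < 0" by linarith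
    then show ?thesis
    proof cases
      case 1
      then show ?thesis using v by (intro frac_le) (auto intro: power_mono)
    next
      case 2
      then show ?thesis using v
        by (intro order_trans[OF divide_nonpos_nonneg divide_nonneg_nonneg]) auto
    next
      case 3
      then have "(V y)\<^sup>2 \<le> (V x)\<^sup>2" using v by (simp add: abs_le_square_iff[symmetric])
      then have "(- V y) / sqrt (1 - (V y)\<^sup>2) \<le> (- V x) / sqrt (1 - (V x)\<^sup>2)"
        using v 3 by (intro frac_le) auto
      then show ?thesis by simp
    qed
  qed
qed

lemma body_iff: "x \<in> body \<longleftrightarrow> 0 < x $ k \<and> x $ k < T \<and> normp k x < sqrt (Q (x $ k))"
proof (cases "0 < x $ k \<and> x $ k < T")
  case True
  then show ?thesis using Q_pos[of "x $ k"] normp_nonneg[of x]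
    by (auto simp: body_def real_less_rsqrt intro: real_sqrt_less_iff[THEN iffD1] dest: power_strict_mono[of _ _ 2])
qed (use body_nth in blast)

lemma normp_convex: "normp k (u *\<^sub>R x + v *\<^sub>R z) \<le> u * normp k x + v * normp k z" if "0 \<le> u" "0 \<le> v"
  unfolding normp_eq linear_add[OF linear_hp] linear_cmul[OF linear_hp]
  by (rule order_trans[OF norm_triangle_ineq]) (use that in simp)

lemma convex_body: "convex body"
proof (rule convexI)
  fix x z :: "real^'n" and u v :: real
  assume xz: "x \<in> body" "z \<in> body" and uv: "0 \<le> u" "0 \<le> v" "u + v = 1"
  have y: "u *\<^sub>R (x $ k) + v *\<^sub>R (z $ k) \<in> {0<..<T}"
    by (rule convexD) (use xz uv body_nth in \<open>auto\<close>)
  have "normp k (u *\<^sub>R x + v *\<^sub>R z) \<le> u * normp k x + v * normp k z"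
    using uv by (intro normp_convex)
  \<comment> \<open>At least one of the weights is positive, and strictness comes from its
    term.\<close>
  also have "\<dots> < u * sqrt (Q (x $ k)) + v * sqrt (Q (z $ k))"
  proof (cases "u = 0")
    case True
    then show ?thesis using xz uv by (simp add: body_iff)
  next
    case False
    then have "u * normp k x < u * sqrt (Q (x $ k))" using uv xz by (simp add: body_iff)
    moreover have "v * normp k z \<le> v * sqrt (Q (z $ k))" using uv xz by (intro mult_left_mono) (auto simp: body_iff)
    ultimately show ?thesis by linarith
  qed
  also have "\<dots> \<le> sqrt (Q (u *\<^sub>R (x $ k) + v *\<^sub>R (z $ k)))"
  proof -
    have u: "u = 1 - v" using uv by simp
    show ?thesis unfolding u
      using convex_onD[OF sqrt_Q_convex, of v "x $ k" "z $ k"] xz uv body_nth by auto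
  qed
  finally show "u *\<^sub>R x + v *\<^sub>R z \<in> body" using y by (simp add: body_iff)
qed

lemma closure_body_subset: "closure body \<subseteq> {x. (normp k x)\<^sup>2 \<le> Q (x $ k) \<and> 0 \<le> x $ k \<and> x $ k \<le> T}"
proof (rule closure_minimal)
  show "body \<subseteq> {x. (normp k x)\<^sup>2 \<le> Q (x $ k) \<and> 0 \<le> x $ k \<and> x $ k \<le> T}"
    using body_nth by (auto simp: body_def less_imp_le)
  show "closed {x::real^'n. (normp k x)\<^sup>2 \<le> Q (x $ k) \<and> 0 \<le> x $ k \<and> x $ k \<le> T}"
    by (intro closed_Collect_conj closed_Collect_le continuous_on_power
      continuous_normp continuous_Q_nth continuous_nth continuous_on_const)
qed

lemma normp_scale: "normp k (t *\<^sub>R hp x + b *\<^sub>R axis k 1) = \<bar>t\<bar> * normp k x"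
proof -
  have "hp (t *\<^sub>R hp x + b *\<^sub>R axis k 1) = t *\<^sub>R hp x"
    by (simp add: vec_eq_iff hp_nth axis_def)
  then show ?thesis by (simp add: normp_eq)
qed

lemma nth_scale: "(t *\<^sub>R hp x + b *\<^sub>R axis k 1) $ k = b"
  by (simp add: hp_nth)

lemma axis_in_closure: "b *\<^sub>R axis k 1 \<in> closure body" if "0 \<le> b" "b \<le> T"
proof -
  have sub: "(\<lambda>b. b *\<^sub>R axis k 1) ` {0<..<T} \<subseteq> body"
    using normp_axis[of 0] normp_scale[of 0 0] nth_scale[of 0 0] Q_pos by (auto simp: body_def)
  have "b \<in> closure {0<..<T}" using that T_gt_1 by simp
  then have "b *\<^sub>R axis k 1 \<in> (\<lambda>b. b *\<^sub>R axis k 1 :: real^'n) ` closure {0<..<T}" by blast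
  also have "\<dots> \<subseteq> closure ((\<lambda>b. b *\<^sub>R axis k 1) ` {0<..<T})"
    by (intro image_closure_subset continuous_intros closure_subset closed_closure)
  also have "\<dots> \<subseteq> closure body" by (rule closure_mono[OF sub])
  finally show ?thesis .
qed

text \<open>Points at heights strictly between 0 and \<open>T\<close> are reached by shrinking their
  horizontal part towards the axis; at the two extreme heights the horizontal part is 0 and the
  point is a limit of points of the axis.\<close>

lemma surf_subset_closure: "surf \<subseteq> closure body"
proof
  fix x assume x: "x \<in> surf"
  show "x \<in> closure body"
  proof (cases "x $ k = 0 \<or> x $ k = T")
    case True
    then have "(normp k x)\<^sup>2 = 0" using x Q_0 Q_T unfolding surf_def by force
    then have "hp x = 0" by (simp add: normp_eq)
    then have "x = x $ k *\<^sub>R axis k 1" using hp_decomp[of x] by simp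
    then show ?thesis using axis_in_closure[of "x $ k"] x by (auto simp: surf_def)
  next
    case False
    then have y: "0 < x $ k" "x $ k < T" using x by (auto simp: surf_def)
    let ?f = "\<lambda>t. t *\<^sub>R hp x + x $ k *\<^sub>R axis k 1"
    have "?f ` {0<..<1} \<subseteq> body"
    proof
      fix z assume "z \<in> ?f ` {0<..<1}"
      then obtain t where t: "0 < t" "t < 1" "z = ?f t" by auto
      have "(t * normp k x)\<^sup>2 = t\<^sup>2 * Q (x $ k)" using x by (simp add: power_mult_distrib surf_def)
      also have "\<dots> < 1 * Q (x $ k)" using t Q_pos[OF y] by (intro mult_strict_right_mono) (auto simp: power_less_one_iff)
      finally show "z \<in> body"
        using t(1) unfolding t(3) body_def mem_Collect_eq normp_scale nth_scale by simp
    qed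
    moreover have "x \<in> ?f ` closure {0<..<1}"
      by (rule image_eqI[of _ _ 1]) (auto simp: hp_decomp[symmetric])
    moreover have "?f ` closure {0<..<1} \<subseteq> closure (?f ` {0<..<1})"
      by (intro image_closure_subset continuous_intros closure_subset closed_closure)
    ultimately show ?thesis using closure_mono by blast
  qed
qed

lemma frontier_body: "frontier body = surf"
proof -
  have "frontier body = closure body - body"
    by (simp add: frontier_def interior_open[OF open_body])
  moreover have "surf \<inter> body = {}" by (auto simp: surf_def body_def)
  moreover have "closure body - body \<subseteq> surf"
    using closure_body_subset by (auto simp: surf_def body_def)
  ultimately show ?thesis using surf_subset_closure by blast
qed

lemma bounded_body: "bounded body"
proof (rule boundedI)
  fix x assume x: "x \<in> body"
  have "(normp k x)\<^sup>2 + (x $ k)\<^sup>2 \<le> R\<^sup>2 + T\<^sup>2"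
    using x Q_le_R2[of "x $ k"] body_nth[OF x] by (intro add_mono power_mono[of "x $ k"]) (auto simp: body_def)
  then show "norm x \<le> sqrt (R\<^sup>2 + T\<^sup>2)" by (intro real_le_rsqrt) (simp add: norm_sq)
qed

end

section \<open>Regularity of the boundary\<close>

text \<open>For a unit vector \<open>e\<close> this is the orthogonal projection along
  \<open>e\<close>, the only part of the argument on which a graph function in
  \<open>C1_holder_hypersurface_at\<close> may depend.\<close>

definition reject :: "'a::real_inner \<Rightarrow> 'a \<Rightarrow> 'a" where "reject e x = x - (x \<bullet> e) *\<^sub>R e"

lemma bounded_linear_reject: "bounded_linear (reject e)"
  unfolding reject_def
  by (intro bounded_linear_sub bounded_linear_ident
      bounded_linear_compose[OF bounded_linear_scaleR_left bounded_linear_inner_left])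

lemma norm_reject: "norm e = 1 \<Longrightarrow> (norm x)\<^sup>2 = (norm (reject e x))\<^sup>2 + (x \<bullet> e)\<^sup>2"
  unfolding power2_norm_eq_inner reject_def
  by (simp add: inner_diff_left inner_diff_right inner_commute norm_eq_1 power2_eq_square algebra_simps)

lemma norm_reject_le: "norm e = 1 \<Longrightarrow> norm (reject e x) \<le> norm x"
  using norm_reject[of e x] by (metis abs_le_square_iff abs_norm_cancel le_add_same_cancel1 zero_le_power2)

text \<open>Scaling to b = 1 reduces the claim to u \<le> u^p on [0, 1]. It is what makes t^\<alpha>
  Hoelder continuous with exponent \<alpha>.\<close>

lemma powr_diff_le:
  fixes a b :: real
  assumes "0 \<le> a" "a \<le> b" "0 < p" "p \<le> 1"
  shows "b powr p - a powr p \<le> (b - a) powr p"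
proof (cases "b = 0")
  case False
  then have b: "b > 0" using assms by simp
  have *: "u \<le> u powr p" if "0 \<le> u" "u \<le> 1" for u :: real
    using that assms powr_mono'[of p 1 u] by (cases "u = 0") auto
  have "1 = (b - a) / b + a / b" using b by (simp add: field_simps)
  also have "\<dots> \<le> ((b - a) / b) powr p + (a / b) powr p"
    using assms b by (intro add_mono *) (auto simp: divide_le_eq)
  also have "\<dots> = ((b - a) powr p + a powr p) / b powr p"
    using assms b by (simp add: powr_divide add_divide_distrib)
  finally show ?thesis using b by (simp add: pos_le_divide_eq)
qed (use assms in auto)

text \<open>The field is the gradient of a radial function. Its direction varies like |p - q| / |p|
  near the centre, which is compensated by |g (|p|)| \<le> L |p|^a when \<open>p\<close> is the
  shorter vector. The constant 3 is 2 for the change of direction plus 1 for the change of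
  size.\<close>

lemma holder_radial_field:
  fixes p q :: "'a::real_inner" and g :: "real \<Rightarrow> real"
  assumes a: "0 < a" "a \<le> 1" and g0: "g 0 = 0" and L: "0 \<le> L"
    and hol: "\<And>u v. 0 \<le> u \<Longrightarrow> u \<le> v \<Longrightarrow> v < \<rho> \<Longrightarrow> \<bar>g v - g u\<bar> \<le> L * (v - u) powr a"
    and pq: "norm p < \<rho>" "norm q < \<rho>"
  shows "norm (g (norm p) *\<^sub>R sgn p - g (norm q) *\<^sub>R sgn q) \<le> 3 * L * norm (p - q) powr a"
proof -
  have *: "norm (g (norm p) *\<^sub>R sgn p - g (norm q) *\<^sub>R sgn q) \<le> 3 * L * norm (p - q) powr a"
    if le: "norm p \<le> norm q" and pq: "norm p < \<rho>" "norm q < \<rho>" for p q :: 'a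
  proof (cases "p = 0")
    case True
    have "\<bar>g (norm q)\<bar> \<le> L * norm q powr a" using hol[of 0 "norm q"] pq g0 by simp
    moreover have "\<bar>g (norm q)\<bar> * norm (sgn q) \<le> \<bar>g (norm q)\<bar>" by (simp add: norm_sgn)
    moreover have "L * norm q powr a \<le> 3 * L * norm q powr a" using L by simp
    ultimately show ?thesis using True by simp
  next
    case False
    let ?d = "norm (p - q)"
    have np: "norm p > 0" using False by simp
    have "norm q > 0" using np le by linarith
    have nd: "norm q - norm p \<le> ?d" by (metis norm_minus_commute norm_triangle_ineq2)
    have 1: "\<bar>g (norm q) - g (norm p)\<bar> \<le> L * ?d powr a"
      by (rule order_trans[OF hol]) (use le pq nd L a in \<open>auto intro!: mult_left_mono powr_mono2\<close>)
    have 2: "\<bar>g (norm p)\<bar> \<le> L * norm p powr a" using hol[of 0 "norm p"] pq g0 by simp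
    have "sgn p - sgn q = (1 / norm p) *\<^sub>R (p - q) + (1 / norm p - 1 / norm q) *\<^sub>R q"
      by (simp add: sgn_div_norm algebra_simps divide_inverse)
    then have "norm (sgn p - sgn q) \<le> norm ((1 / norm p) *\<^sub>R (p - q)) + norm ((1 / norm p - 1 / norm q) *\<^sub>R q)"
      using norm_triangle_ineq by metis
    also have "norm ((1 / norm p) *\<^sub>R (p - q)) = ?d / norm p" by simp
    also have "norm ((1 / norm p - 1 / norm q) *\<^sub>R q) = (norm q - norm p) / norm p"
    proof -
      have "1 / norm q \<le> 1 / norm p" using np le by (intro divide_left_mono) (auto intro!: mult_pos_pos)
      then have "norm ((1 / norm p - 1 / norm q) *\<^sub>R q) = (1 / norm p - 1 / norm q) * norm q" by simp
      then show ?thesis using np \<open>norm q > 0\<close> by (simp add: left_diff_distrib diff_divide_distrib)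
    qed
    also have "?d / norm p + (norm q - norm p) / norm p \<le> 2 * (?d / norm p)"
      using divide_right_mono[OF nd, of "norm p"] by simp
    finally have s1: "norm (sgn p - sgn q) \<le> 2 * (?d / norm p)" .
    have s2: "norm (sgn p - sgn q) \<le> 2"
      using norm_triangle_ineq4[of "sgn p" "sgn q"] by (simp add: norm_sgn split: if_splits)
    \<comment> \<open>Of the bounds 2 |p - q| / |p| and 2, the first serves when the ratio |p - q| /
      |p| is at most 1 and the second otherwise; each is then at most twice the power of the
      ratio.\<close>
    have 3: "norm (sgn p - sgn q) \<le> 2 * (?d / norm p) powr a"
    proof (cases "?d / norm p \<le> 1")
      case True
      have "(?d / norm p) \<le> (?d / norm p) powr a"
        using powr_mono'[of a 1 "?d / norm p"] a True by (cases "?d = 0") auto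
      then show ?thesis using s1 by linarith
    next
      case False
      then have "1 \<le> (?d / norm p) powr a" using a by (intro ge_one_powr_ge_zero) auto
      then show ?thesis using s2 by linarith
    qed
    have "norm (g (norm p) *\<^sub>R sgn p - g (norm q) *\<^sub>R sgn q)
       = norm (g (norm p) *\<^sub>R (sgn p - sgn q) - (g (norm q) - g (norm p)) *\<^sub>R sgn q)"
      by (simp add: algebra_simps)
    also have "\<dots> \<le> \<bar>g (norm p)\<bar> * norm (sgn p - sgn q) + \<bar>g (norm q) - g (norm p)\<bar> * norm (sgn q)"
      by (rule order_trans[OF norm_triangle_ineq4]) simp
    also have "\<dots> \<le> (L * norm p powr a) * (2 * (?d / norm p) powr a) + (L * ?d powr a) * 1"
      using 1 2 3 L by (intro add_mono mult_mono) (auto simp: norm_sgn)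
    also have "\<dots> = 3 * L * ?d powr a" using np by (simp add: powr_divide)
    finally show ?thesis .
  qed
  show ?thesis
  proof (cases "norm p \<le> norm q")
    case True
    then show ?thesis using * pq by blast
  next
    case False
    then have "norm (g (norm q) *\<^sub>R sgn q - g (norm p) *\<^sub>R sgn p) \<le> 3 * L * norm (q - p) powr a"
      using *[of q p] pq by linarith
    then show ?thesis by (simp add: norm_minus_commute)
  qed
qed

text \<open>The norm is not differentiable at 0, but a profile with zero right slope there makes the
  composition differentiable with derivative 0; \<open>g 0 = 0\<close> and \<open>sgn 0 = 0\<close>
  fit the same formula.\<close>

lemma has_derivative_radial:
  fixes p :: "'a::real_inner" and h g :: "real \<Rightarrow> real"
  assumes der: "\<And>t. 0 < t \<Longrightarrow> t < \<rho> \<Longrightarrow> (h has_real_derivative g t) (at t)"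
    and der0: "((\<lambda>t. (h t - h 0) / t) \<longlongrightarrow> 0) (at_right 0)" and g0: "g 0 = 0"
    and p: "norm p < \<rho>"
  shows "((\<lambda>p. h (norm p)) has_derivative (\<lambda>v. (g (norm p) *\<^sub>R sgn p) \<bullet> v)) (at p)"
proof (cases "p = 0")
  case False
  then have "(h has_real_derivative g (norm p)) (at (norm p))" using der p by simp
  then have "(h has_derivative (\<lambda>v. g (norm p) * v)) (at (norm p))"
    by (simp add: has_field_derivative_def)
  from has_derivative_compose[OF has_derivative_norm[OF False] this]
  show ?thesis by (simp add: inner_commute)
next
  case True
  have "filterlim (norm :: 'a \<Rightarrow> real) (at_right 0) (at 0)"
    unfolding filterlim_at by (auto intro!: tendsto_eq_intros simp: eventually_at_filter)
  from tendsto_norm[OF filterlim_compose[OF der0 this]]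
  have "((\<lambda>y. norm (h (norm (0 + y)) - h (norm (0::'a)) - 0) / norm (y::'a)) \<longlongrightarrow> 0) (at 0)"
    by (simp)
  then show ?thesis unfolding True has_derivative_at by (simp add: bounded_linear_inner_right)
qed

text \<open>Centre \<open>z\<close> and direction \<open>e\<close> are arbitrary, so that graphs
  over horizontal and over tilted hyperplanes are both covered. The projection does not increase
  norms, hence precomposition with it keeps the Hoelder constant.\<close>

lemma C1_holder_on_radial:
  fixes e z :: "real^'n::finite" and h g :: "real \<Rightarrow> real"
  assumes a: "0 < a" "a \<le> 1" and g0: "g 0 = 0" and L: "0 \<le> L"
    and hol: "\<And>u v. 0 \<le> u \<Longrightarrow> u \<le> v \<Longrightarrow> v < \<rho> \<Longrightarrow> \<bar>g v - g u\<bar> \<le> L * (v - u) powr a"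
    and der: "\<And>t. 0 < t \<Longrightarrow> t < \<rho> \<Longrightarrow> (h has_real_derivative g t) (at t)"
    and der0: "((\<lambda>t. (h t - h 0) / t) \<longlongrightarrow> 0) (at_right 0)"
    and e: "norm e = 1" and U: "\<And>x. x \<in> U \<Longrightarrow> norm (reject e (x - z)) < \<rho>"
  shows "C1_holder_on a U (\<lambda>x. h (norm (reject e (x - z))))"
proof -
  define G where "G x = g (norm (reject e (x - z))) *\<^sub>R sgn (reject e (x - z))" for x
  show ?thesis unfolding C1_holder_on_def
  proof (intro exI[of _ "\<lambda>x v. G x \<bullet> reject e v"] exI[of _ "3 * L"] conjI ballI)
    fix x assume x: "x \<in> U"
    have "((\<lambda>x. reject e (x - z)) has_derivative reject e) (at x)"
      by (rule bounded_linear.has_derivative[OF bounded_linear_reject]) (auto intro!: derivative_eq_intros)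
    from has_derivative_compose[OF this has_derivative_radial[OF der der0 g0 U[OF x]]]
    show "((\<lambda>x. h (norm (reject e (x - z)))) has_derivative (\<lambda>v. G x \<bullet> reject e v)) (at x)"
      by (simp add: G_def)
    fix y assume y: "y \<in> U"
    have "reject e (x - z) - reject e (y - z) = reject e (x - y)"
      by (simp add: reject_def algebra_simps inner_diff_left)
    then have d: "norm (reject e (x - z) - reject e (y - z)) \<le> dist x y"
      using norm_reject_le[OF e] by (simp add: dist_norm)
    have "norm (G x - G y) \<le> 3 * L * norm (reject e (x - z) - reject e (y - z)) powr a"
      unfolding G_def by (rule holder_radial_field[OF a g0 L hol U[OF x] U[OF y]])
    also have "\<dots> \<le> 3 * L * dist x y powr a"
      using d L a by (intro mult_left_mono powr_mono2) auto
    finally have b: "norm (G x - G y) \<le> 3 * L * dist x y powr a" .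
    have "onorm (\<lambda>v. G x \<bullet> reject e v - G y \<bullet> reject e v) \<le> norm (G x - G y)"
    proof (rule onorm_bound)
      fix v
      have "\<bar>(G x - G y) \<bullet> reject e v\<bar> \<le> norm (G x - G y) * norm (reject e v)"
        by (rule Cauchy_Schwarz_ineq2)
      also have "\<dots> \<le> norm (G x - G y) * norm v"
        by (intro mult_left_mono norm_reject_le e) auto
      finally show "norm (G x \<bullet> reject e v - G y \<bullet> reject e v) \<le> norm (G x - G y) * norm v"
        by (simp add: inner_diff_left)
    qed simp
    with b show "onorm (\<lambda>v. G x \<bullet> reject e v - G y \<bullet> reject e v) \<le> 3 * L * dist x y powr a"
      by linarith
  qed
qed

context convex_drop
begin

text \<open>The slope has derivative R^2 / (R^2 - t^2)^(3/2), bounded away from the equator t = R,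
  and a Lipschitz bound on [0, \<rho>] implies a Hoelder bound because v - u \<le> \<rho>^(1 -
  \<alpha>) (v - u)^\<alpha>.\<close>

lemma arc_slope_holder:
  assumes "0 < \<rho>" "\<rho> < R"
  obtains L where "0 \<le> L" "\<And>u v. 0 \<le> u \<Longrightarrow> u \<le> v \<Longrightarrow> v \<le> \<rho> \<Longrightarrow>
    \<bar>v / sqrt (R\<^sup>2 - v\<^sup>2) - u / sqrt (R\<^sup>2 - u\<^sup>2)\<bar> \<le> L * (v - u) powr \<alpha>"
proof -
  let ?g = "\<lambda>t. t / sqrt (R\<^sup>2 - t\<^sup>2)"
  let ?g' = "\<lambda>t. R\<^sup>2 / sqrt (R\<^sup>2 - t\<^sup>2) ^ 3"
  define K where "K = R\<^sup>2 / sqrt (R\<^sup>2 - \<rho>\<^sup>2) ^ 3"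
  have \<rho>: "R\<^sup>2 - \<rho>\<^sup>2 > 0" using assms by (simp add: power_strict_mono)
  have K: "0 \<le> K" using \<rho> unfolding K_def by auto
  have pos: "R\<^sup>2 - t\<^sup>2 \<ge> R\<^sup>2 - \<rho>\<^sup>2" if "0 \<le> t" "t \<le> \<rho>" for t using that by (simp add: power_mono)
  have D: "(?g has_real_derivative ?g' t) (at t)" if "0 \<le> t" "t \<le> \<rho>" for t
  proof -
    have p: "R\<^sup>2 - t\<^sup>2 > 0" using pos[OF that] \<rho> by linarith
    have "((\<lambda>t. R\<^sup>2 - t\<^sup>2) has_real_derivative - 2 * t) (at t)" by (auto intro!: derivative_eq_intros)
    from DERIV_chain2[where g = "\<lambda>t. R\<^sup>2 - t\<^sup>2", OF DERIV_real_sqrt[OF p] this]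
    have "((\<lambda>t. sqrt (R\<^sup>2 - t\<^sup>2)) has_real_derivative inverse (sqrt (R\<^sup>2 - t\<^sup>2)) / 2 * (- 2 * t)) (at t)" .
    note D = DERIV_divide[OF DERIV_ident this]
    have eq: "(1 * q - t * (inverse q / 2 * (- 2 * t))) / (q * q) = R\<^sup>2 / q ^ 3"
      if "0 < q" "q\<^sup>2 = R\<^sup>2 - t\<^sup>2" for q
    proof -
      have R2: "R\<^sup>2 = q\<^sup>2 + t\<^sup>2" using that by simp
      have "1 * q - t * (inverse q / 2 * (- 2 * t)) = (q\<^sup>2 + t\<^sup>2) / q"
        using that(1) by (simp add: field_simps power2_eq_square)
      then show ?thesis using that(1) unfolding R2 by (simp add: power3_eq_cube)
    qed
    show ?thesis by (rule DERIV_cong[OF D eq]) (use p in auto)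
  qed
  show ?thesis
  proof (rule that[of "K * \<rho> powr (1 - \<alpha>)"])
    fix u v assume uv: "0 \<le> u" "u \<le> v" "v \<le> \<rho>"
    show "\<bar>?g v - ?g u\<bar> \<le> K * \<rho> powr (1 - \<alpha>) * (v - u) powr \<alpha>"
    proof (cases "u = v")
      case False
      then obtain t where t: "u < t" "t < v" "?g v - ?g u = (v - u) * ?g' t"
        using MVT2[of u v ?g ?g'] D uv by force
      have post: "0 < R\<^sup>2 - t\<^sup>2" "R\<^sup>2 - \<rho>\<^sup>2 \<le> R\<^sup>2 - t\<^sup>2" using pos[of t] t uv \<rho> by linarith+
      then have "sqrt (R\<^sup>2 - \<rho>\<^sup>2) ^ 3 \<le> sqrt (R\<^sup>2 - t\<^sup>2) ^ 3"
        using \<rho> by (intro power_mono) auto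
      then have "?g' t \<le> K" unfolding K_def using \<rho> by (intro frac_le) auto
      then have "(v - u) * ?g' t \<le> (v - u) * K" using uv by (intro mult_left_mono) auto
      moreover have "0 \<le> (v - u) * ?g' t"
        using post uv by (intro mult_nonneg_nonneg divide_nonneg_nonneg) auto
      ultimately have "\<bar>?g v - ?g u\<bar> \<le> (v - u) * K" unfolding t(3) by linarith
      moreover have "v - u \<le> \<rho> powr (1 - \<alpha>) * (v - u) powr \<alpha>"
      proof -
        have "v - u = (v - u) powr (1 - \<alpha>) * (v - u) powr \<alpha>"
          using False uv by (simp add: powr_add[symmetric])
        also have "\<dots> \<le> \<rho> powr (1 - \<alpha>) * (v - u) powr \<alpha>"
          using uv \<alpha>_less_1 by (intro mult_right_mono powr_mono2) auto
        finally show ?thesis .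
      qed
      from mult_right_mono[OF this K] have "(v - u) * K \<le> K * \<rho> powr (1 - \<alpha>) * (v - u) powr \<alpha>"
        by (simp add: mult_ac)
      ultimately show ?thesis by linarith
    qed (use K in auto)
  qed (use K in auto)
qed

text \<open>The lower part of the boundary is the graph of \<open>hl\<close> as a function of \<open>|x'|\<close>, with slope \<open>gl\<close>.\<close>

definition hl :: "real \<Rightarrow> real" where
  "hl t = (if t < 1 then t powr (1 + \<alpha>) else c - sqrt (R\<^sup>2 - t\<^sup>2))"
definition gl :: "real \<Rightarrow> real" where
  "gl t = (if t < 1 then (1 + \<alpha>) * t powr \<alpha> else t / sqrt (R\<^sup>2 - t\<^sup>2))"

lemma inv_s: "1 + \<alpha> = 1 / s" using \<alpha>_pos by (simp add: s_def)

lemma sqrt_R1: "sqrt (R\<^sup>2 - 1) = s" using s_pos by (simp add: R_sq)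

lemma gl_lower: "t \<le> 1 \<Longrightarrow> gl t = (1 + \<alpha>) * t powr \<alpha>"
  using sqrt_R1 inv_s by (cases "t = 1") (auto simp: gl_def)

lemma hl_deriv: assumes "0 < t" "t < R" shows "(hl has_real_derivative gl t) (at t)"
proof -
  have d1: "((\<lambda>t. t powr (1 + \<alpha>)) has_real_derivative (1 + \<alpha>) * t powr \<alpha>) (at t)"
    using assms by (auto intro!: derivative_eq_intros)
  have p: "R\<^sup>2 - t\<^sup>2 > 0" using assms by (simp add: power_strict_mono)
  have "((\<lambda>t. R\<^sup>2 - t\<^sup>2) has_real_derivative - 2 * t) (at t)" by (auto intro!: derivative_eq_intros)
  from DERIV_diff[OF DERIV_const[of c] DERIV_chain2[where g = "\<lambda>t. R\<^sup>2 - t\<^sup>2", OF DERIV_real_sqrt[OF p] this]]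
  have d2: "((\<lambda>t. c - sqrt (R\<^sup>2 - t\<^sup>2)) has_real_derivative t / sqrt (R\<^sup>2 - t\<^sup>2)) (at t)"
    by (rule DERIV_cong) (simp add: field_simps)
  consider "t < 1" | "t = 1" | "1 < t" by linarith
  then show ?thesis
  proof cases
    case 1
    show ?thesis
      by (rule DERIV_cong_open[of "\<lambda>t. t powr (1 + \<alpha>)" _ _ "{..<1}"])
         (use 1 d1 in \<open>auto simp: hl_def gl_def\<close>)
  next
    case 2
    have e: "gl t = (1 + \<alpha>) * t powr \<alpha>" "gl t = t / sqrt (R\<^sup>2 - t\<^sup>2)"
      using gl_lower[of t] 2 by (auto simp: gl_def)
    show ?thesis unfolding hl_def[abs_def] using d1[folded e(1)] d2[folded e(2)] sqrt_R1
      unfolding 2 by (intro DERIV_If_less) (auto simp: c_def)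
  next
    case 3
    show ?thesis
      by (rule DERIV_cong_open[of "\<lambda>t. c - sqrt (R\<^sup>2 - t\<^sup>2)" _ _ "{1<..}"])
         (use 3 d2 in \<open>auto simp: hl_def gl_def\<close>)
  qed
qed

lemma hl_deriv0: "((\<lambda>t. (hl t - hl 0) / t) \<longlongrightarrow> 0) (at_right 0)"
proof (rule Lim_transform_eventually)
  have "((\<lambda>t. t powr \<alpha>) \<longlongrightarrow> 0 powr \<alpha>) (at_right 0)"
    using \<alpha>_pos by (intro tendsto_powr' tendsto_ident_at tendsto_const) (auto simp: eventually_at_filter)
  then show "((\<lambda>t::real. t powr \<alpha>) \<longlongrightarrow> 0) (at_right 0)" by simp
  have "eventually (\<lambda>t::real. t \<in> {0<..<1}) (at_right 0)"
    by (rule eventually_at_right_real) simp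
  then show "\<forall>\<^sub>F t in at_right 0. t powr \<alpha> = (hl t - hl 0) / t"
    by eventually_elim (auto simp: hl_def powr_add)
qed

text \<open>The power part is Hoelder with exponent \<alpha> and constant 1 + \<alpha> \<le> 2, the
  circular part is covered by \<open>arc_slope_holder\<close> since \<rho> < R, and an increment
  across 1 is split there.\<close>

lemma gl_holder:
  assumes "1 \<le> \<rho>" "\<rho> < R"
  obtains L where "0 \<le> L" "\<And>u v. 0 \<le> u \<Longrightarrow> u \<le> v \<Longrightarrow> v < \<rho> \<Longrightarrow> \<bar>gl v - gl u\<bar> \<le> L * (v - u) powr \<alpha>"
proof -
  obtain L where L: "0 \<le> L" "\<And>u v. 0 \<le> u \<Longrightarrow> u \<le> v \<Longrightarrow> v \<le> \<rho> \<Longrightarrow>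
    \<bar>v / sqrt (R\<^sup>2 - v\<^sup>2) - u / sqrt (R\<^sup>2 - u\<^sup>2)\<bar> \<le> L * (v - u) powr \<alpha>"
    using arc_slope_holder[of \<rho>] assms by auto
  have lo: "\<bar>gl v - gl u\<bar> \<le> 2 * (v - u) powr \<alpha>" if "0 \<le> u" "u \<le> v" "v \<le> 1" for u v
  proof -
    have "u powr \<alpha> \<le> v powr \<alpha>" using that \<alpha>_pos by (intro powr_mono2) auto
    moreover have "v powr \<alpha> - u powr \<alpha> \<le> (v - u) powr \<alpha>"
      using that \<alpha>_pos \<alpha>_less_1 by (intro powr_diff_le) auto
    ultimately have "(1 + \<alpha>) * \<bar>v powr \<alpha> - u powr \<alpha>\<bar> \<le> 2 * (v - u) powr \<alpha>"
      using \<alpha>_pos \<alpha>_less_1 by (intro mult_mono) auto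
    moreover have "\<bar>gl v - gl u\<bar> = (1 + \<alpha>) * \<bar>v powr \<alpha> - u powr \<alpha>\<bar>"
      using that \<alpha>_pos by (simp add: gl_lower right_diff_distrib[symmetric] abs_mult)
    ultimately show ?thesis by simp
  qed
  have up: "\<bar>gl v - gl u\<bar> \<le> L * (v - u) powr \<alpha>" if "1 \<le> u" "u \<le> v" "v \<le> \<rho>" for u v
    using L(2)[of u v] that by (simp add: gl_def)
  show ?thesis
  proof (rule that[of "2 + L"])
    show "0 \<le> 2 + L" using L by simp
    fix u v assume uv: "0 \<le> u" "u \<le> v" "v < \<rho>"
    have n: "0 \<le> 2 * (v - u) powr \<alpha>" "0 \<le> L * (v - u) powr \<alpha>" using L by auto
    consider "v \<le> 1" | "u < 1" "1 < v" | "1 \<le> u" by linarith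
    then show "\<bar>gl v - gl u\<bar> \<le> (2 + L) * (v - u) powr \<alpha>"
    proof cases
      case 1
      then show ?thesis using lo[OF uv(1,2)] n unfolding distrib_right by linarith
    next
      case 2
      have "\<bar>gl v - gl u\<bar> \<le> \<bar>gl 1 - gl u\<bar> + \<bar>gl v - gl 1\<bar>" by linarith
      also have "\<dots> \<le> 2 * (1 - u) powr \<alpha> + L * (v - 1) powr \<alpha>"
        using 2 uv by (intro add_mono lo up) auto
      also have "\<dots> \<le> 2 * (v - u) powr \<alpha> + L * (v - u) powr \<alpha>"
        using 2 uv L \<alpha>_pos by (intro add_mono mult_left_mono powr_mono2) auto
      finally show ?thesis by (simp add: distrib_right)
    next
      case 3
      then show ?thesis using up[OF 3 uv(2)] uv n unfolding distrib_right by linarith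
    qed
  qed
qed

text \<open>Below the equator of the sphere \<open>hl\<close> inverts the slice radius
  \<open>sqrt (Q y)\<close>; the hypothesis on the height excludes the upper hemisphere, where the
  same slice radii occur again.\<close>

lemma surf_lower: assumes "x $ k < c" "normp k x < R"
  shows "x \<in> surf \<longleftrightarrow> x $ k = hl (normp k x)"
proof -
  define r y where "r = normp k x" and "y = x $ k"
  have r: "0 \<le> r" "r < R" and y: "y < c" using assms normp_nonneg by (auto simp: r_def y_def)
  have "(r\<^sup>2 = Q y \<and> 0 \<le> y \<and> y \<le> T) \<longleftrightarrow> y = hl r"
  proof
    assume a: "r\<^sup>2 = Q y \<and> 0 \<le> y \<and> y \<le> T"
    show "y = hl r"
    proof (cases "y < 1")
      case True
      then have "r\<^sup>2 = (y powr s)\<^sup>2" using a by (auto simp: Q_def power2_eq_square powr_add[symmetric])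
      then have rs: "r = y powr s" using r by (simp add: power2_eq_iff_nonneg)
      have "y powr s < 1 powr s" using True a s_pos by (intro powr_less_mono2) auto
      then have "hl r = (y powr s) powr (1 + \<alpha>)" by (simp add: hl_def rs)
      then show ?thesis using powr_inv'[of y] a by (cases "y = 0") auto
    next
      case False
      then have e: "R\<^sup>2 - r\<^sup>2 = (c - y)\<^sup>2" using a by (simp add: Q_def power2_commute)
      have "(c - y)\<^sup>2 \<le> s\<^sup>2" using False y by (intro power_mono) (auto simp: c_def)
      then have "1 \<le> r\<^sup>2" using e R_sq by simp
      then have "1 \<le> r" using r by (metis abs_1 abs_le_square_iff abs_of_nonneg one_power2)
      then show ?thesis using e y by (simp add: hl_def)
    qed
  next
    assume a: "y = hl r"
    show "r\<^sup>2 = Q y \<and> 0 \<le> y \<and> y \<le> T"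
    proof (cases "r < 1")
      case True
      have "r powr (1 + \<alpha>) < 1 powr (1 + \<alpha>)" using True r \<alpha>_pos by (intro powr_less_mono2) auto
      then have y1: "y < 1" "y = r powr (1 + \<alpha>)" using a True by (auto simp: hl_def)
      have "y powr (2 * s) = r\<^sup>2"
      proof -
        have "y powr s = r" using powr_inv[OF r(1)] y1(2) by simp
        then have "y powr (s + s) = r\<^sup>2" by (simp only: powr_add power2_eq_square)
        then show ?thesis by (simp only: mult_2)
      qed
      then show ?thesis using y1 T_gt_1 by (simp add: Q_def max_def)
    next
      case False
      then have e: "y = c - sqrt (R\<^sup>2 - r\<^sup>2)" using a by (simp add: hl_def)
      have p: "0 \<le> R\<^sup>2 - r\<^sup>2" using r by (simp add: power_mono)
      have "1 \<le> r\<^sup>2" using False by (simp add: one_le_power)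
      then have "sqrt (R\<^sup>2 - r\<^sup>2) \<le> sqrt (R\<^sup>2 - 1)" by (intro real_sqrt_le_mono) simp
      then have "1 \<le> y" using e sqrt_R1 by (simp add: c_def)
      moreover have "y - c = - sqrt (R\<^sup>2 - r\<^sup>2)" using e by simp
      then have "(y - c)\<^sup>2 = R\<^sup>2 - r\<^sup>2" using p by simp
      moreover have "y \<le> T" using y T_gt_c by simp
      ultimately show ?thesis by (simp add: Q_def)
    qed
  qed
  then show ?thesis by (simp add: surf_def r_def y_def)
qed

lemma surf_upper: assumes "1 \<le> x $ k"
  shows "x \<in> surf \<longleftrightarrow> norm (x - axis k c) = R"
proof -
  have "norm (x - axis k c) = R \<longleftrightarrow> (norm (x - axis k c))\<^sup>2 = R\<^sup>2"
    using R_pos by (simp add: power2_eq_iff_nonneg)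
  also have "\<dots> \<longleftrightarrow> (normp k x)\<^sup>2 + (x $ k - c)\<^sup>2 = R\<^sup>2"
    by (simp only: norm_sq normp_diff_axis) (simp add: axis_def)
  also have "\<dots> \<longleftrightarrow> x \<in> surf"
  proof -
    have "x $ k \<le> T" if "(normp k x)\<^sup>2 + (x $ k - c)\<^sup>2 = R\<^sup>2"
    proof -
      have "(x $ k - c)\<^sup>2 \<le> R\<^sup>2" using that zero_le_power2[of "normp k x"] by linarith
      then have "\<bar>x $ k - c\<bar> \<le> R" using R_pos abs_le_square_iff[of "x $ k - c" R] by simp
      then show ?thesis by (simp add: T_def)
    qed
    then show ?thesis using assms by (auto simp: surf_def Q_def)
  qed
  finally show ?thesis by simp
qed

lemma reject_axis: "reject (axis k 1) x = hp x"
  by (simp add: reject_def hp_def inner_axis)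

lemma reject_idem: "norm e = 1 \<Longrightarrow> reject e (x - (x \<bullet> e) *\<^sub>R e - z) = reject e (x - z)"
  for e :: "'a::real_inner"
  by (simp add: reject_def norm_eq_1 inner_diff_left algebra_simps)

lemma normp_dist: "normp k x \<le> normp k z + dist x z"
proof -
  have "norm (hp x) \<le> norm (hp z) + norm (hp x - hp z)" by (metis norm_triangle_sub add.commute)
  also have "hp x - hp z = reject (axis k 1) (x - z)" by (simp add: reject_axis linear_diff[OF linear_hp])
  finally show ?thesis
    using norm_reject_le[of "axis k 1 :: real^'n" "x - z"] by (simp add: normp_eq dist_norm)
qed

lemma nth_dist: "\<bar>x $ k - z $ k\<bar> \<le> dist x z" for x z :: "real^'n"
  using component_le_norm_cart[of "x - z" k] by (simp add: dist_norm)

lemma surf_regular_lower: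
  assumes z: "z \<in> surf" "z $ k \<le> 1"
  shows "C1_holder_hypersurface_at \<alpha> surf z"
proof -
  define \<rho> where "\<rho> = (1 + R) / 2"
  \<comment> \<open>Within \<open>r\<close> of a surface point at height at most 1, heights stay
    below 1 + s = c and slice radii below 1 + r \<le> \<rho> < R.\<close>
  define r where "r = min s ((R - 1) / 2)"
  have \<rho>: "1 < \<rho>" "\<rho> < R" and r: "0 < r" "r \<le> s" "1 + r \<le> \<rho>"
    using R_gt_1 s_pos by (auto simp: \<rho>_def r_def min_def field_simps)
  obtain L where L: "0 \<le> L" "\<And>u v. 0 \<le> u \<Longrightarrow> u \<le> v \<Longrightarrow> v < \<rho> \<Longrightarrow> \<bar>gl v - gl u\<bar> \<le> L * (v - u) powr \<alpha>"
    using gl_holder[of \<rho>] \<rho> by auto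
  have "(normp k z)\<^sup>2 \<le> 1\<^sup>2"
  proof -
    have "(z $ k) powr (2 * s) \<le> 1 powr (2 * s)" if "0 \<le> z $ k"
      using that z s_pos by (intro powr_mono2) auto
    then show ?thesis using z Q_lower[of "z $ k"] Q_0 by (cases "z $ k = 0") (auto simp: surf_def)
  qed
  then have nz: "normp k z \<le> 1" using abs_le_square_iff[of "normp k z" 1] normp_nonneg[of z] by simp
  have n: "normp k x < \<rho>" if "x \<in> ball z r" for x
    using normp_dist[of x z] nz r that by (simp add: dist_commute)
  have y: "x $ k < c" if "x \<in> ball z r" for x
    using nth_dist[of x z] z r that by (auto simp: dist_commute c_def)
  have f: "(\<lambda>x. hl (norm (reject (axis k 1) (x - 0)))) = (\<lambda>x. hl (normp k x))"
    by (simp add: reject_axis normp_eq)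
  show ?thesis unfolding C1_holder_hypersurface_at_def
  proof (intro exI[of _ r] exI[of _ "axis k 1"] exI[of _ "\<lambda>x. hl (normp k x)"] conjI allI)
    show "C1_holder_on \<alpha> (ball z r) (\<lambda>x. hl (normp k x))"
      unfolding f[symmetric]
      by (rule C1_holder_on_radial[where g = gl and \<rho> = \<rho> and L = L])
         (use \<alpha>_pos \<alpha>_less_1 L \<rho> hl_deriv hl_deriv0 n in \<open>auto simp: gl_def reject_axis normp_eq\<close>)
    show "surf \<inter> ball z r = {x \<in> ball z r. x \<bullet> axis k 1 = hl (normp k x)}"
      using surf_lower n y \<rho> by (auto simp: inner_axis) force+
    show "hl (normp k y) = hl (normp k (y - (y \<bullet> axis k 1) *\<^sub>R axis k 1))" for y
      using normp_scale[of 1 y 0] by (simp add: inner_axis hp_def)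
  qed (use r in auto)
qed

text \<open>The sphere is written as a graph in the direction \<open>e\<close> of its outer normal
  at \<open>z\<close> itself; a vertical graph would have infinite slope at the equator.\<close>

lemma surf_regular_upper:
  assumes z: "z \<in> surf" "1 < z $ k"
  shows "C1_holder_hypersurface_at \<alpha> surf z"
proof -
  define o' where "o' = (axis k c :: real^'n)"
  define e where "e = (1 / R) *\<^sub>R (z - o')"
  \<comment> \<open>The first bound keeps the ball in the spherical part; the second keeps slopes
    bounded and excludes the opposite sheet of the sphere, where (x - o') has negative product with
    \<open>e\<close>.\<close>
  define r where "r = min (z $ k - 1) (R / 2)"
  define h where "h t = o' \<bullet> e + sqrt (R\<^sup>2 - t\<^sup>2)" for t
  define g where "g t = - (t / sqrt (R\<^sup>2 - t\<^sup>2))" for t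
  have r: "0 < r" "r \<le> z $ k - 1" "r \<le> R / 2" using z R_pos by (auto simp: r_def min_def)
  have nz: "norm (z - o') = R" using surf_upper[of z] z by (simp add: o'_def)
  then have e: "norm e = 1" using R_pos by (simp add: e_def)
  have ze: "z - o' = R *\<^sub>R e" using R_pos by (simp add: e_def)
  obtain L where L: "0 \<le> L" "\<And>u v. 0 \<le> u \<Longrightarrow> u \<le> v \<Longrightarrow> v \<le> R / 2 \<Longrightarrow>
    \<bar>v / sqrt (R\<^sup>2 - v\<^sup>2) - u / sqrt (R\<^sup>2 - u\<^sup>2)\<bar> \<le> L * (v - u) powr \<alpha>"
    using arc_slope_holder[of "R / 2"] R_pos by auto
  have D: "(h has_real_derivative g t) (at t)" if "0 \<le> t" "t < R" for t
  proof -
    have p: "R\<^sup>2 - t\<^sup>2 > 0" using that by (simp add: power_strict_mono)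
    have "((\<lambda>t. R\<^sup>2 - t\<^sup>2) has_real_derivative - 2 * t) (at t)" by (auto intro!: derivative_eq_intros)
    from DERIV_add[OF DERIV_const[of "o' \<bullet> e"] DERIV_chain2[where g = "\<lambda>t. R\<^sup>2 - t\<^sup>2", OF DERIV_real_sqrt[OF p] this]]
    show ?thesis unfolding h_def g_def by (rule DERIV_cong) (simp add: field_simps)
  qed
  have zz: "reject e (z - o') = 0" using e by (simp add: ze reject_def norm_eq_1)
  have rx: "reject e (x - o') = reject e (x - z)" for x
    using zz by (simp add: reject_def algebra_simps inner_diff_left)
  have n: "norm (reject e (x - o')) < R / 2" if "x \<in> ball z r" for x
    unfolding rx using norm_reject_le[OF e, of "x - z"] that r by (simp add: dist_norm norm_minus_commute)
  have pos: "0 < (x - o') \<bullet> e" if "x \<in> ball z r" for x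
  proof -
    have "(x - o') \<bullet> e = R + (x - z) \<bullet> e"
      using arg_cong[OF ze, of "\<lambda>v. v \<bullet> e"] e by (simp add: inner_diff_left norm_eq_1)
    moreover have "\<bar>(x - z) \<bullet> e\<bar> \<le> norm (x - z)" using Cauchy_Schwarz_ineq2[of "x - z" e] e by simp
    moreover have "norm (x - z) < R" using that r R_pos by (simp add: dist_norm norm_minus_commute)
    ultimately show ?thesis by linarith
  qed
  show ?thesis unfolding C1_holder_hypersurface_at_def
  proof (intro exI[of _ r] exI[of _ e] exI[of _ "\<lambda>x. h (norm (reject e (x - o')))"] conjI allI)
    show "C1_holder_on \<alpha> (ball z r) (\<lambda>x. h (norm (reject e (x - o'))))"
    proof (rule C1_holder_on_radial[where g = g and \<rho> = "R / 2" and L = L])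
      show "((\<lambda>t. (h t - h 0) / t) \<longlongrightarrow> 0) (at_right 0)"
        using D[of 0] R_pos by (auto simp: has_field_derivative_iff g_def intro: filterlim_mono[OF _ order_refl at_le])
      show "\<bar>g v - g u\<bar> \<le> L * (v - u) powr \<alpha>" if "0 \<le> u" "u \<le> v" "v < R / 2" for u v
        using L(2)[of u v] that by (simp add: g_def abs_minus_commute)
    qed (use \<alpha>_pos \<alpha>_less_1 L D n e R_pos in \<open>auto simp: g_def\<close>)
    show "surf \<inter> ball z r = {x \<in> ball z r. x \<bullet> e = h (norm (reject e (x - o')))}"
    proof -
      have "x \<in> surf \<longleftrightarrow> x \<bullet> e = h (norm (reject e (x - o')))" if x: "x \<in> ball z r" for x
      proof -
        have "1 \<le> x $ k" using nth_dist[of x z] x r by (auto simp: dist_commute)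
        then have "x \<in> surf \<longleftrightarrow> (norm (x - o'))\<^sup>2 = R\<^sup>2"
          using surf_upper R_pos by (simp add: o'_def power2_eq_iff_nonneg)
        also have "\<dots> \<longleftrightarrow> ((x - o') \<bullet> e)\<^sup>2 = R\<^sup>2 - (norm (reject e (x - o')))\<^sup>2"
          using norm_reject[OF e, of "x - o'"] by auto
        also have "\<dots> \<longleftrightarrow> (x - o') \<bullet> e = sqrt (R\<^sup>2 - (norm (reject e (x - o')))\<^sup>2)"
        proof
          assume "((x - o') \<bullet> e)\<^sup>2 = R\<^sup>2 - (norm (reject e (x - o')))\<^sup>2"
          then have "sqrt (((x - o') \<bullet> e)\<^sup>2) = sqrt (R\<^sup>2 - (norm (reject e (x - o')))\<^sup>2)" by (rule arg_cong)
          then show "(x - o') \<bullet> e = sqrt (R\<^sup>2 - (norm (reject e (x - o')))\<^sup>2)" using pos[OF x] by simp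
        next
          assume "(x - o') \<bullet> e = sqrt (R\<^sup>2 - (norm (reject e (x - o')))\<^sup>2)"
          moreover have "(norm (reject e (x - o')))\<^sup>2 \<le> R\<^sup>2"
            using n[OF x] R_pos by (intro power_mono) auto
          ultimately show "((x - o') \<bullet> e)\<^sup>2 = R\<^sup>2 - (norm (reject e (x - o')))\<^sup>2" by simp
        qed
        finally show ?thesis by (auto simp: h_def inner_diff_left)
      qed
      then show ?thesis by auto
    qed
    show "h (norm (reject e (y - o'))) = h (norm (reject e (y - (y \<bullet> e) *\<^sub>R e - o')))" for y
      using reject_idem[OF e] by simp
  qed (use r e in auto)
qed

lemma surf_regular: "z \<in> surf \<Longrightarrow> C1_holder_hypersurface_at \<alpha> surf z"
  using surf_regular_lower surf_regular_upper by (cases "z $ k \<le> 1") auto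

end

section \<open>Failure of every higher Hoelder exponent at the tip\<close>

lemma le_powr_imp_nonpos:
  fixes D K :: real
  assumes "0 < p" "0 < t0" "\<And>t. 0 < t \<Longrightarrow> t < t0 \<Longrightarrow> D \<le> K * t powr p"
  shows "D \<le> 0"
proof (rule tendsto_lowerbound)
  have "((\<lambda>t. t powr p) \<longlongrightarrow> 0 powr p) (at_right 0)"
    using assms by (intro tendsto_powr' tendsto_ident_at tendsto_const) (auto simp: eventually_at_filter)
  then show "((\<lambda>t. K * t powr p) \<longlongrightarrow> 0) (at_right 0)"
    using tendsto_mult_left[of "\<lambda>t. t powr p" "0 powr p" "at_right 0" K] by simp
  have "eventually (\<lambda>t. t \<in> {0<..<t0}) (at_right 0)"
    by (rule eventually_at_right_real) (use assms in simp)
  then show "\<forall>\<^sub>F t in at_right 0. D \<le> K * t powr p"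
    by eventually_elim (use assms in auto)
qed simp

text \<open>The mean value inequality is applied to \<open>f\<close> minus its derivative at 0, on
  the closed ball of radius |y|, where the derivative of this difference has norm at most |C|
  |y|^b.\<close>

lemma C1_holder_on_taylor:
  fixes f :: "real^'n::finite \<Rightarrow> real"
  assumes "C1_holder_on b (ball 0 r) f" "0 < r" "0 < b"
  obtains L C where "bounded_linear L" "0 \<le> C"
    "\<And>y. y \<in> ball 0 r \<Longrightarrow> \<bar>f y - f 0 - L y\<bar> \<le> C * norm y powr (1 + b)"
proof -
  obtain f' C where f': "\<And>x. x \<in> ball 0 r \<Longrightarrow> (f has_derivative f' x) (at x)"
    and C: "\<And>x y :: real^'n. x \<in> ball 0 r \<Longrightarrow> y \<in> ball 0 r \<Longrightarrow>
      onorm (\<lambda>v. f' x v - f' y v) \<le> C * dist x y powr b"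
    using assms(1) unfolding C1_holder_on_def by blast
  have z: "0 \<in> ball (0::real^'n) r" using assms by simp
  have bl: "bounded_linear (f' 0)" using f'[OF z] by (rule has_derivative_bounded_linear)
  have "\<bar>f y - f 0 - f' 0 y\<bar> \<le> \<bar>C\<bar> * norm y powr (1 + b)" if y: "y \<in> ball 0 r" for y
  proof -
    have sub: "cball (0::real^'n) (norm y) \<subseteq> ball 0 r"
    proof
      fix x :: "real^'n" assume "x \<in> cball 0 (norm y)"
      then have "norm x \<le> norm y" by simp
      also have "norm y < r" using y by simp
      finally show "x \<in> ball 0 r" by simp
    qed
    let ?S = "cball (0::real^'n) (norm y)"
    define F where "F x = f x - f' 0 x" for x
    have der: "(F has_derivative (\<lambda>v. f' x v - f' 0 v)) (at x within ?S)" if "x \<in> ?S" for x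
    proof -
      have "x \<in> ball 0 r" using that sub by (rule rev_subsetD)
      from has_derivative_diff[OF f'[OF this] bounded_linear_imp_has_derivative[OF bl]]
      have "(F has_derivative (\<lambda>v. f' x v - f' 0 v)) (at x)"
        unfolding F_def[abs_def] .
      then show ?thesis by (rule has_derivative_at_withinI)
    qed
    have bnd: "onorm (\<lambda>v. f' x v - f' 0 v) \<le> \<bar>C\<bar> * norm y powr b" if x: "x \<in> ?S" for x
    proof -
      have "x \<in> ball 0 r" using that sub by (rule rev_subsetD)
      from C[OF this z] have "onorm (\<lambda>v. f' x v - f' 0 v) \<le> C * dist x 0 powr b" .
      also have "\<dots> \<le> \<bar>C\<bar> * dist x 0 powr b" by (intro mult_right_mono) auto
      also have "\<dots> \<le> \<bar>C\<bar> * norm y powr b"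
        using x assms by (intro mult_left_mono powr_mono2) auto
      finally show ?thesis .
    qed
    have "norm (F y - F 0) \<le> (\<bar>C\<bar> * norm y powr b) * norm (y - 0)"
      by (rule differentiable_bound[OF convex_cball der bnd]) auto
    then have "\<bar>f y - f 0 - f' 0 y\<bar> \<le> \<bar>C\<bar> * (norm y powr b * norm y)"
      using linear_0[OF bounded_linear.linear[OF bl]] by (simp add: F_def algebra_simps)
    moreover have "norm y powr b * norm y = norm y powr (1 + b)"
      by (cases "y = 0") (auto simp: powr_add)
    ultimately show ?thesis by simp
  qed
  then show ?thesis using that[of "f' 0" "\<bar>C\<bar>"] bl by simp
qed

context convex_drop
begin

lemma surf_curve:
  assumes "\<tau> $ k = 0" "norm \<tau> = 1" "\<bar>t\<bar> < 1"
  shows "t *\<^sub>R \<tau> + (\<bar>t\<bar> powr (1 + \<alpha>)) *\<^sub>R axis k 1 \<in> surf"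
proof -
  let ?y = "\<bar>t\<bar> powr (1 + \<alpha>)" and ?x = "t *\<^sub>R \<tau> + (\<bar>t\<bar> powr (1 + \<alpha>)) *\<^sub>R axis k 1"
  have "hp \<tau> = \<tau>" using assms(1) by (simp add: hp_def)
  then have n: "normp k ?x = \<bar>t\<bar>" using normp_scale[of t \<tau> ?y] assms(2) by (simp add: normp_eq)
  have yk: "?x $ k = ?y" using nth_scale[of t \<tau> ?y] \<open>hp \<tau> = \<tau>\<close> by simp
  have "?y < 1 powr (1 + \<alpha>)" using assms \<alpha>_pos by (intro powr_less_mono2) auto
  then have y1: "?y < 1" by simp
  have "?y powr s = \<bar>t\<bar>" by (rule powr_inv) simp
  then have "?y powr (s + s) = t\<^sup>2" by (simp only: powr_add) (simp add: power2_eq_square)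
  then have "?y powr (2 * s) = t\<^sup>2" by (simp only: mult_2)
  then have "Q ?y = t\<^sup>2" using y1 by (simp add: Q_def max_def)
  moreover have "0 \<le> ?y" "?y \<le> T" using y1 T_gt_1 by auto
  ultimately show ?thesis unfolding surf_def mem_Collect_eq n yk by simp
qed

lemma axis_nth_other: "j \<noteq> i \<Longrightarrow> axis j a $ i = 0" for i j :: 'n
  by (simp add: axis_def)

text \<open>n \<ge> 2 provides a horizontal unit vector even when \<open>e\<close> is vertical. The
  plane of \<tau> and the axis contains \<open>e\<close> and also the curve of
  \<open>surf_curve\<close>.\<close>

lemma unit_decomp:
  assumes "norm e = 1"
  obtains \<tau> b where "\<tau> $ k = 0" "norm \<tau> = 1" "e = e $ k *\<^sub>R axis k 1 + b *\<^sub>R \<tau>"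
proof (cases "hp e = 0")
  case False
  have "norm (hp e) *\<^sub>R sgn (hp e) = hp e" using False by (simp add: sgn_div_norm)
  then have "e = e $ k *\<^sub>R axis k 1 + norm (hp e) *\<^sub>R sgn (hp e)"
    by (simp add: hp_def)
  moreover have "sgn (hp e) $ k = 0" by (simp add: sgn_div_norm hp_nth)
  ultimately show ?thesis using that[of "sgn (hp e)" "norm (hp e)"] False by (simp add: norm_sgn)
next
  case True
  have "\<exists>j. j \<noteq> k"
  proof (rule ccontr)
    assume "\<not> ?thesis"
    then have "(UNIV::'n set) = {k}" by auto
    then have "CARD('n) = 1" by (metis card_1_singleton_iff One_nat_def)
    then show False using card_ge_2 by simp
  qed
  then obtain j where "j \<noteq> k" by blast
  moreover have "e = e $ k *\<^sub>R axis k 1" using True by (simp add: hp_def)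
  ultimately show ?thesis
    using that[of "axis j 1" 0] by (simp add: axis_nth_other)
qed

text \<open>The curve (t \<tau>, |t|^(1 + \<alpha>)) lies on the surface. If it satisfied x . e = f
  x with a Taylor remainder of order 1 + \<beta>, comparing the terms of order 1 + \<alpha> and of
  order 1 would give \<open>L u = a\<close> and \<open>L \<tau> = b\<close>, so L e = a^2 + b^2 = 1.
  But \<open>f\<close> is constant along \<open>e\<close>, which forces L e = 0. This excludes every
  direction \<open>e\<close>.\<close>

lemma surf_not_regular:
  assumes \<beta>: "\<alpha> < \<beta>"
  shows "\<not> C1_holder_hypersurface_at \<beta> surf 0"
proof
  assume "C1_holder_hypersurface_at \<beta> surf 0"
  then obtain r e f where r: "0 < r" and e: "norm e = 1"
    and inv: "\<And>y. f y = f (y - (y \<bullet> e) *\<^sub>R e)" and hol: "C1_holder_on \<beta> (ball 0 r) f"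
    and graph: "surf \<inter> ball 0 r = {x \<in> ball 0 r. x \<bullet> e = f x}"
    unfolding C1_holder_hypersurface_at_def by blast
  have \<beta>0: "0 < \<beta>" using \<beta> \<alpha>_pos by simp
  obtain L C where L: "bounded_linear L" and C: "0 \<le> C"
    and tay: "\<And>y. y \<in> ball 0 r \<Longrightarrow> \<bar>f y - f 0 - L y\<bar> \<le> C * norm y powr (1 + \<beta>)"
    using C1_holder_on_taylor[OF hol r \<beta>0] by blast
  interpret L: bounded_linear L by (rule L)
  obtain \<tau> b where \<tau>: "\<tau> $ k = 0" "norm \<tau> = 1" "e = e $ k *\<^sub>R axis k 1 + b *\<^sub>R \<tau>"
    using unit_decomp[OF e] by blast
  define a where "a = e $ k"
  define u where "u = (axis k 1 :: real^'n)"
  have e_eq: "e = a *\<^sub>R u + b *\<^sub>R \<tau>" using \<tau>(3) by (simp add: a_def u_def)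
  have u: "u \<bullet> u = 1" "\<tau> \<bullet> u = 0" "u \<bullet> \<tau> = 0" "\<tau> \<bullet> \<tau> = 1"
  proof -
    show "u \<bullet> u = 1" by (simp add: u_def norm_eq_1[symmetric])
    show "\<tau> \<bullet> u = 0" by (simp add: u_def inner_axis \<tau>(1))
    then show "u \<bullet> \<tau> = 0" by (simp add: inner_commute)
    show "\<tau> \<bullet> \<tau> = 1" using \<tau>(2) by (simp add: norm_eq_1)
  qed
  have ab: "a * a + b * b = 1"
  proof -
    have "e \<bullet> e = 1" using e by (simp add: norm_eq_1)
    then show ?thesis unfolding e_eq by (simp add: inner_add_left inner_add_right u)
  qed
  have "0 \<in> surf" using Q_0 T_gt_1 by (simp add: surf_def normp_def)
  then have "0 \<in> surf \<inter> ball 0 r" using r by simp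
  then have f0: "f 0 = 0" unfolding graph by simp
  define t0 where "t0 = min 1 (r / 2)"
  have t0: "0 < t0" "t0 \<le> 1" "t0 \<le> r / 2" using r by (auto simp: t0_def min_def)
  define K where "K = C * 2 powr (1 + \<beta>)"
  have est: "\<bar>t * b + a * \<bar>t\<bar> powr (1 + \<alpha>) - (t * L \<tau> + \<bar>t\<bar> powr (1 + \<alpha>) * L u)\<bar> \<le> K * \<bar>t\<bar> powr (1 + \<beta>)"
    if t: "\<bar>t\<bar> < t0" for t
  proof -
    define x where "x = t *\<^sub>R \<tau> + (\<bar>t\<bar> powr (1 + \<alpha>)) *\<^sub>R u"
    have xs: "x \<in> surf" using surf_curve[OF \<tau>(1,2), of t] t t0 by (simp add: x_def u_def)
    have "\<bar>t\<bar> powr (1 + \<alpha>) \<le> \<bar>t\<bar> powr 1" using t t0 \<alpha>_pos by (intro powr_mono') auto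
    then have nx: "norm x \<le> 2 * \<bar>t\<bar>"
      unfolding x_def using \<tau>(2) by (intro order_trans[OF norm_triangle_ineq]) (auto simp: u_def)
    then have xb: "x \<in> ball 0 r" using t t0 by simp
    have "x \<in> {x \<in> ball 0 r. x \<bullet> e = f x}" using xs xb unfolding graph[symmetric] by simp
    then have "f x = x \<bullet> e" by simp
    also have "\<dots> = t * b + a * \<bar>t\<bar> powr (1 + \<alpha>)"
      by (simp add: x_def e_eq inner_add_left inner_add_right u)
    finally have "\<bar>t * b + a * \<bar>t\<bar> powr (1 + \<alpha>) - L x\<bar> \<le> C * norm x powr (1 + \<beta>)"
      using tay[OF xb] f0 by simp
    also have "\<dots> \<le> C * (2 * \<bar>t\<bar>) powr (1 + \<beta>)" using nx C \<beta>0 by (intro mult_left_mono powr_mono2) auto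
    finally show ?thesis
      by (simp add: x_def L.add L.scale K_def powr_mult mult.assoc)
  qed
  have K: "0 \<le> K" using C by (simp add: K_def)
  have "\<bar>a - L u\<bar> \<le> 0"
  proof (rule le_powr_imp_nonpos[of "\<beta> - \<alpha>" t0 _ K])
    fix t assume t: "0 < t" "t < t0"
    \<comment> \<open>Adding the expansions at t and -t cancels the odd terms and isolates the
      coefficient of t^(1 + \<alpha>).\<close>
    have eq: "2 * ((a - L u) * t powr (1 + \<alpha>))
        = (t * b + a * t powr (1 + \<alpha>) - (t * L \<tau> + t powr (1 + \<alpha>) * L u))
         + (- t * b + a * t powr (1 + \<alpha>) - (- t * L \<tau> + t powr (1 + \<alpha>) * L u))"
      by (simp add: algebra_simps)
    have "\<bar>2 * ((a - L u) * t powr (1 + \<alpha>))\<bar> \<le> K * t powr (1 + \<beta>) + K * t powr (1 + \<beta>)"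
      unfolding eq using est[of t] est[of "- t"] t
      by (intro order_trans[OF abs_triangle_ineq add_mono]) auto
    then have "\<bar>a - L u\<bar> * t powr (1 + \<alpha>) \<le> K * t powr (1 + \<beta>)"
      by (simp add: abs_mult)
    also have "t powr (1 + \<beta>) = t powr (\<beta> - \<alpha>) * t powr (1 + \<alpha>)"
      by (simp add: powr_add[symmetric] add.commute)
    finally have "\<bar>a - L u\<bar> * t powr (1 + \<alpha>) \<le> (K * t powr (\<beta> - \<alpha>)) * t powr (1 + \<alpha>)"
      by (simp add: mult.assoc)
    then show "\<bar>a - L u\<bar> \<le> K * t powr (\<beta> - \<alpha>)" using t by simp
  qed (use \<beta> t0 in auto)
  then have Lu: "L u = a" by simp
  have "\<bar>b - L \<tau>\<bar> \<le> 0"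
  proof (rule le_powr_imp_nonpos[of \<beta> t0 _ K])
    fix t assume t: "0 < t" "t < t0"
    have "t * b + a * t powr (1 + \<alpha>) - (t * L \<tau> + t powr (1 + \<alpha>) * L u) = t * (b - L \<tau>)"
      by (simp add: Lu algebra_simps)
    then have "\<bar>t * (b - L \<tau>)\<bar> \<le> K * t powr (1 + \<beta>)" using est[of t] t by simp
    also have "\<dots> = t * (K * t powr \<beta>)" using t by (simp add: powr_add)
    finally show "\<bar>b - L \<tau>\<bar> \<le> K * t powr \<beta>" using t by (simp add: abs_mult)
  qed (use \<beta>0 t0 in auto)
  then have Lt: "L \<tau> = b" by simp
  have "\<bar>L e\<bar> \<le> 0"
  proof (rule le_powr_imp_nonpos[of \<beta> t0 _ C])
    fix t assume t: "0 < t" "t < t0"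
    have eq: "t *\<^sub>R e - ((t *\<^sub>R e) \<bullet> e) *\<^sub>R e = 0" using e by (simp add: norm_eq_1)
    have "f (t *\<^sub>R e) = 0" using inv[of "t *\<^sub>R e", unfolded eq] f0 by (rule trans)
    moreover have "t *\<^sub>R e \<in> ball 0 r" using e t t0 r by simp
    ultimately have "\<bar>t * L e\<bar> \<le> C * t powr (1 + \<beta>)"
      using tay[of "t *\<^sub>R e"] f0 e t by (simp add: L.scale)
    also have "\<dots> = t * (C * t powr \<beta>)" using t by (simp add: powr_add)
    finally show "\<bar>L e\<bar> \<le> C * t powr \<beta>" using t by (simp add: abs_mult)
  qed (use \<beta>0 t0 in auto)
  then show False using ab by (simp add: e_eq L.add L.scale Lu Lt)
qed

end

section \<open>Integrability of negative powers of the height\<close>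

lemma nn_integral_powr_finite:
  fixes a M :: real
  assumes "-1 < a" "0 \<le> M"
  shows "(\<integral>\<^sup>+u. indicator {0..M} u * ennreal (u powr a) \<partial>lborel) < \<infinity>"
proof -
  have "((\<lambda>x. x powr a) has_integral (M powr (a + 1) / (a + 1))) {0..M}"
    using has_integral_powr_from_0[OF assms] .
  moreover have "(\<lambda>x. indicator {0..M} x * x powr a) = (\<lambda>x. if x \<in> {0..M} then x powr a else 0)"
    by (auto simp: indicator_def)
  ultimately have "((\<lambda>x. indicator {0..M} x * x powr a) has_integral (M powr (a + 1) / (a + 1))) UNIV"
    by (simp only: has_integral_restrict_UNIV)
  from nn_integral_has_integral_lborel[OF _ _ this]
  have "(\<integral>\<^sup>+u. ennreal (indicator {0..M} u * u powr a) \<partial>lborel) = ennreal (M powr (a + 1) / (a + 1))"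
    by auto
  then show ?thesis by (simp add: ennreal_mult' ennreal_indicator)
qed

lemma nn_integral_powr_reflect_finite:
  fixes a M t :: real
  assumes "-1 < a" "0 \<le> M"
  shows "(\<integral>\<^sup>+u. indicator {t - M..t} u * ennreal ((t - u) powr a) \<partial>lborel) < \<infinity>"
proof -
  have "(\<integral>\<^sup>+u. indicator {t - M..t} u * ennreal ((t - u) powr a) \<partial>lborel)
     = (\<integral>\<^sup>+u. indicator {t - M..t} (t + (-1) * u) * ennreal ((t - (t + (-1) * u)) powr a) \<partial>lborel)"
    by (subst nn_integral_real_affine[where c = "-1" and t = t]) auto
  also have "\<dots> = (\<integral>\<^sup>+u. indicator {0..M} u * ennreal (u powr a) \<partial>lborel)"
    by (intro nn_integral_cong) (auto simp: indicator_def)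
  finally show ?thesis using nn_integral_powr_finite[OF assms] by simp
qed

lemma nn_integral_abs_powr_finite:
  fixes a M :: real
  assumes "-1 < a" "0 \<le> M"
  shows "(\<integral>\<^sup>+u. indicator {-M..M} u * ennreal (\<bar>u\<bar> powr a) \<partial>lborel) < \<infinity>"
proof -
  have "(\<integral>\<^sup>+u. indicator {-M..M} u * ennreal (\<bar>u\<bar> powr a) \<partial>lborel)
     \<le> (\<integral>\<^sup>+u. indicator {0..M} u * ennreal (u powr a) + indicator {0 - M..0} u * ennreal ((0 - u) powr a) \<partial>lborel)"
    by (intro nn_integral_mono) (auto simp: indicator_def)
  also have "\<dots> = (\<integral>\<^sup>+u. indicator {0..M} u * ennreal (u powr a) \<partial>lborel)
      + (\<integral>\<^sup>+u. indicator {0 - M..0} u * ennreal ((0 - u) powr a) \<partial>lborel)"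
    by (intro nn_integral_add) auto
  also have "\<dots> < \<infinity>"
    using nn_integral_powr_finite[OF assms] nn_integral_powr_reflect_finite[OF assms, of 0] by simp
  finally show ?thesis .
qed

text \<open>Split at T / 2: on either half only one factor is singular, and the other is at most its
  value at T / 2.\<close>

lemma nn_integral_two_powr_finite:
  fixes a b T :: real
  assumes "-1 < a" "-1 < b" "a \<le> 0" "b \<le> 0" "0 < T"
  shows "(\<integral>\<^sup>+u. indicator {0<..<T} u * ennreal (u powr a * (T - u) powr b) \<partial>lborel) < \<infinity>"
proof -
  let ?A = "(T / 2) powr b" and ?B = "(T / 2) powr a"
  have "(\<integral>\<^sup>+u. indicator {0<..<T} u * ennreal (u powr a * (T - u) powr b) \<partial>lborel)
     \<le> (\<integral>\<^sup>+u. ennreal ?A * (indicator {0..T} u * ennreal (u powr a))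
        + ennreal ?B * (indicator {T - T..T} u * ennreal ((T - u) powr b)) \<partial>lborel)"
  proof (intro nn_integral_mono)
    fix u
    have "u powr a * (T - u) powr b \<le> ?A * u powr a + ?B * (T - u) powr b" if "0 < u" "u < T"
    proof (cases "u \<le> T / 2")
      case True
      then have "(T - u) powr b \<le> ?A" using that assms by (intro powr_mono2') auto
      then have "u powr a * (T - u) powr b \<le> u powr a * ?A" by (intro mult_left_mono) auto
      then have "u powr a * (T - u) powr b \<le> ?A * u powr a" by (simp only: mult.commute)
      then show ?thesis by (simp add: add_increasing2)
    next
      case False
      then have "u powr a \<le> ?B" using that assms by (intro powr_mono2') auto
      then have "u powr a * (T - u) powr b \<le> ?B * (T - u) powr b" by (simp add: mult_right_mono)
      then show ?thesis by (simp add: add_increasing)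
    qed
    then show "indicator {0<..<T} u * ennreal (u powr a * (T - u) powr b)
      \<le> ennreal ?A * (indicator {0..T} u * ennreal (u powr a))
        + ennreal ?B * (indicator {T - T..T} u * ennreal ((T - u) powr b))"
      by (auto simp: indicator_def ennreal_mult[symmetric] ennreal_plus[symmetric] simp del: ennreal_plus intro!: ennreal_leI)
  qed
  also have "\<dots> = ennreal ?A * (\<integral>\<^sup>+u. indicator {0..T} u * ennreal (u powr a) \<partial>lborel)
      + ennreal ?B * (\<integral>\<^sup>+u. indicator {T - T..T} u * ennreal ((T - u) powr b) \<partial>lborel)"
    by (simp add: nn_integral_add nn_integral_cmult)
  also have "\<dots> < \<infinity>"
    using nn_integral_powr_finite[OF assms(1), of T] nn_integral_powr_reflect_finite[OF assms(2), of T T] assms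
    by (simp add: ennreal_mult_less_top)
  finally show ?thesis .
qed

lemma AE_lborel_nth_nonzero: "AE x in lborel. (x :: real^'n::finite) $ i \<noteq> 0"
proof -
  have "negligible {x. axis i 1 \<bullet> (x :: real^'n) = 0}" by (rule negligible_hyperplane) (simp add: axis_eq_0_iff)
  then have "{x. (x :: real^'n) $ i = 0} \<in> null_sets lebesgue"
    by (simp add: negligible_iff_null_sets inner_axis')
  moreover have "{x. (x :: real^'n) $ i = 0} \<in> sets borel"
    by (intro borel_closed closed_Collect_eq continuous_intros)
  ultimately have "{x. (x :: real^'n) $ i = 0} \<in> null_sets lborel"
    by (simp add: null_sets_completion_iff)
  from AE_not_in[OF this] show ?thesis by simp
qed

lemma prod_mono_ennreal:
  fixes f g :: "'a \<Rightarrow> ennreal"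
  shows "(\<And>i. i \<in> I \<Longrightarrow> f i \<le> g i) \<Longrightarrow> prod f I \<le> prod g I"
  by (induction I rule: infinite_finite_induct) (auto intro: mult_mono)

text \<open>Each factor \<open>(W / \<bar>x_i\<bar>) powr \<gamma>\<close> is at least 1 on the domain of integration; inserting
  these factors splits the integral into one-dimensional ones.\<close>

lemma nn_integral_tapered_finite:
  fixes g W :: "real \<Rightarrow> real" and k :: "'n::finite"
  assumes [measurable]: "g \<in> borel_measurable borel" "W \<in> borel_measurable borel"
    and g: "\<And>y. y \<in> {0<..<T} \<Longrightarrow> 0 \<le> g y" and W: "\<And>y. y \<in> {0<..<T} \<Longrightarrow> 0 < W y"
    and \<gamma>: "0 \<le> \<gamma>" "\<gamma> < 1" and M: "0 \<le> M"
    and fin: "(\<integral>\<^sup>+y. indicator {0<..<T} y * ennreal (g y * W y powr (\<gamma> * real (CARD('n) - 1))) \<partial>lborel) < \<infinity>"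
  shows "(\<integral>\<^sup>+x. indicator {x. x $ k \<in> {0<..<T} \<and> (\<forall>i. i \<noteq> k \<longrightarrow> \<bar>x $ i\<bar> \<le> W (x $ k) \<and> \<bar>x $ i\<bar> \<le> M)} x
      * ennreal (g (x $ k)) \<partial>lborel) < \<infinity>"
proof -
  define Fk where "Fk y = indicator {0<..<T} y * ennreal (g y * W y powr (\<gamma> * real (CARD('n) - 1)))" for y
  define Fo where "Fo u = indicator {-M..M} u * ennreal (\<bar>u\<bar> powr (-\<gamma>))" for u :: real
  \<comment> \<open>A product over the coordinates, so that its integral factors. \<gamma> < 1 makes
    the n - 1 horizontal factors integrable; the price is a height factor W^(\<gamma> (n - 1)) in
    place of the slice volume of order W^(n - 1).\<close>
  define f where "f b = (if b = axis k 1 then Fk else Fo)" for b :: "real^'n"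
  have [measurable]: "Fk \<in> borel_measurable borel" "Fo \<in> borel_measurable borel"
    unfolding Fk_def[abs_def] Fo_def[abs_def] by measurable
  have m: "f b \<in> borel_measurable borel" for b by (simp add: f_def)
  have k: "axis k 1 \<in> (Basis :: (real^'n) set)" by (simp add: axis_in_Basis_iff)
  have card: "card (Basis - {axis k 1} :: (real^'n) set) = CARD('n) - 1"
    using k by (simp add: card_Diff_singleton)
  have prod: "(\<Prod>b\<in>Basis. f b (x \<bullet> b)) = Fk (x $ k) * (\<Prod>b\<in>Basis - {axis k 1}. Fo (x \<bullet> b))" for x
    by (subst prod.remove[OF _ k]) (auto simp: f_def inner_axis intro!: arg_cong2[where f = "(*)"] prod.cong)
  \<comment> \<open>\<open>0 powr (-\<gamma>)\<close> is 0, so the lower bound for the inserted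
    factors fails on the coordinate hyperplanes; these are null sets.\<close>
  have ae: "AE x in lborel. \<forall>i\<in>(UNIV::'n set). (x :: real^'n) $ i \<noteq> 0"
    by (rule AE_finite_allI) (auto intro: AE_lborel_nth_nonzero)
  have "(\<integral>\<^sup>+x. indicator {x. x $ k \<in> {0<..<T} \<and> (\<forall>i. i \<noteq> k \<longrightarrow> \<bar>x $ i\<bar> \<le> W (x $ k) \<and> \<bar>x $ i\<bar> \<le> M)} x
      * ennreal (g (x $ k)) \<partial>lborel) \<le> (\<integral>\<^sup>+x. (\<Prod>b\<in>Basis. f b (x \<bullet> b)) \<partial>lborel)"
  proof (rule nn_integral_mono_AE, use ae in eventually_elim)
    fix x :: "real^'n" assume nz: "\<forall>i\<in>UNIV. x $ i \<noteq> 0"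
    show "indicator {x. x $ k \<in> {0<..<T} \<and> (\<forall>i. i \<noteq> k \<longrightarrow> \<bar>x $ i\<bar> \<le> W (x $ k) \<and> \<bar>x $ i\<bar> \<le> M)} x
      * ennreal (g (x $ k)) \<le> (\<Prod>b\<in>Basis. f b (x \<bullet> b))"
    proof (cases "x $ k \<in> {0<..<T} \<and> (\<forall>i. i \<noteq> k \<longrightarrow> \<bar>x $ i\<bar> \<le> W (x $ k) \<and> \<bar>x $ i\<bar> \<le> M)")
      case True
      have Wp: "0 < W (x $ k)" and gp: "0 \<le> g (x $ k)" using True W g by auto
      have Fo: "ennreal (W (x $ k) powr (-\<gamma>)) \<le> Fo (x \<bullet> b)" if b: "b \<in> Basis - {axis k 1}" for b
      proof -
        obtain i where i: "b = axis i 1" using b by (auto simp: Basis_vec_def)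
        then have ik: "i \<noteq> k" using b by auto
        have xi: "x \<bullet> b = x $ i" by (simp add: i inner_axis)
        have "W (x $ k) powr (-\<gamma>) \<le> \<bar>x $ i\<bar> powr (-\<gamma>)"
          using True ik nz \<gamma> by (intro powr_mono2') auto
        moreover have "x $ i \<in> {-M..M}" using True ik by (auto simp: abs_le_iff minus_le_iff)
        ultimately show ?thesis by (simp add: Fo_def xi ennreal_leI)
      qed
      have "ennreal (W (x $ k) powr (-\<gamma>)) ^ (CARD('n) - 1) = (\<Prod>b\<in>Basis - {axis k 1 :: real^'n}. ennreal (W (x $ k) powr (-\<gamma>)))"
        by (simp add: card)
      also have "\<dots> \<le> (\<Prod>b\<in>Basis - {axis k 1}. Fo (x \<bullet> b))"
        by (rule prod_mono_ennreal[OF Fo])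
      finally have le: "ennreal ((W (x $ k) powr (-\<gamma>)) ^ (CARD('n) - 1)) \<le> (\<Prod>b\<in>Basis - {axis k 1}. Fo (x \<bullet> b))"
        by (simp add: ennreal_power)
      have "g (x $ k) = (g (x $ k) * W (x $ k) powr (\<gamma> * real (CARD('n) - 1))) * (W (x $ k) powr (-\<gamma>)) ^ (CARD('n) - 1)"
        using Wp by (simp add: powr_power powr_add[symmetric] powr_realpow[symmetric] powr_powr)
      then have "ennreal (g (x $ k)) = ennreal (g (x $ k) * W (x $ k) powr (\<gamma> * real (CARD('n) - 1)))
          * ennreal ((W (x $ k) powr (-\<gamma>)) ^ (CARD('n) - 1))"
        using gp by (subst ennreal_mult[symmetric]) auto
      also have "\<dots> \<le> Fk (x $ k) * (\<Prod>b\<in>Basis - {axis k 1}. Fo (x \<bullet> b))"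
        using True by (intro mult_mono le) (auto simp: Fk_def)
      finally show ?thesis unfolding prod using True by simp
    qed simp
  qed
  also have "\<dots> = (\<Prod>b\<in>(Basis :: (real^'n) set). (\<integral>\<^sup>+u. f b u \<partial>lborel))"
    using m by (intro nn_integral_lborel_prod) auto
  also have "\<dots> < \<infinity>"
  proof -
    have "(\<integral>\<^sup>+u. f b u \<partial>lborel) < \<infinity>" for b
      using fin nn_integral_abs_powr_finite[of "-\<gamma>" M] \<gamma> M by (simp add: f_def Fk_def[abs_def] Fo_def[abs_def])
    then show ?thesis by (simp add: ennreal_prod_eq_top less_top[symmetric])
  qed
  finally show ?thesis .
qed

context convex_drop
begin

definition hscale :: "real \<Rightarrow> real^'n \<Rightarrow> real^'n" where
  "hscale t x = t *\<^sub>R hp x + x $ k *\<^sub>R axis k 1"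

lemma hscale_nth: "hscale t x $ i = (if i = k then x $ k else t * x $ i)"
  by (simp add: hscale_def hp_nth axis_def)

text \<open>The scaling is a diagonal map with entry 1 in the direction \<open>k\<close> and
  \<open>t\<close> in the n - 1 others.\<close>

lemma integral_hscale:
  fixes f :: "real^'n \<Rightarrow> real"
  assumes [measurable]: "f \<in> borel_measurable borel" and t: "0 < t"
  shows "(\<integral>x. f x \<partial>lborel) = t ^ (CARD('n) - 1) * (\<integral>x. f (hscale t x) \<partial>lborel)"
proof -
  define a where "a j = (if j = axis k 1 then 1 else t)" for j :: "real^'n"
  define S where "S x = 0 + (\<Sum>j\<in>Basis. (a j * (x \<bullet> j)) *\<^sub>R j)" for x :: "real^'n"
  have k: "axis k 1 \<in> (Basis :: (real^'n) set)" by (simp add: axis_in_Basis_iff)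
  have S: "S = hscale t"
  proof
    fix x show "S x = hscale t x"
    proof (rule euclidean_eqI)
      fix b :: "real^'n" assume b: "b \<in> Basis"
      then obtain i where i: "b = axis i 1" by (auto simp: Basis_vec_def)
      have "S x \<bullet> b = a b * (x \<bullet> b)"
        using b by (simp add: S_def inner_sum_left_Basis)
      then show "S x \<bullet> b = hscale t x \<bullet> b"
        by (auto simp: i inner_axis hscale_nth a_def axis_eq_axis)
    qed
  qed
  have "(\<Prod>j\<in>Basis. \<bar>a j\<bar>) = \<bar>a (axis k 1)\<bar> * (\<Prod>j\<in>Basis - {axis k 1 :: real^'n}. \<bar>a j\<bar>)"
    by (rule prod.remove[OF _ k]) simp
  also have "\<dots> = (\<Prod>j\<in>Basis - {axis k 1 :: real^'n}. t)"
    using t by (auto simp: a_def intro!: prod.cong)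
  also have "\<dots> = t ^ (CARD('n) - 1)" using k by (simp add: card_Diff_singleton)
  finally have p: "(\<Prod>j\<in>Basis. \<bar>a j\<bar>) = t ^ (CARD('n) - 1)" .
  have l: "lborel = density (distr lborel borel (hscale t)) (\<lambda>_. ennreal (t ^ (CARD('n) - 1)))"
    using lborel_affine_euclidean[of a 0] t unfolding p S_def[abs_def, symmetric] S by (auto simp: a_def)
  have [measurable]: "hscale t \<in> borel_measurable borel"
    unfolding S[symmetric] S_def by (auto intro!: borel_measurable_continuous_onI continuous_intros)
  have "(\<integral>x. f x \<partial>lborel) = (\<integral>x. t ^ (CARD('n) - 1) *\<^sub>R f x \<partial>distr lborel borel (hscale t))"
    using t by (subst l, subst integral_density) auto
  also have "\<dots> = t ^ (CARD('n) - 1) * (\<integral>x. f (hscale t x) \<partial>lborel)"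
    by (subst integral_distr) auto
  finally show ?thesis .
qed

text \<open>\<open>Q\<close> vanishes like y^(2 s) at the tip and linearly at the top. Below 1 the
  factor T - y is at most T; above 1 the cofactor y - (c - R) of T - y is at least R - s.\<close>

lemma Q_lower_bound: assumes "0 < y" "y < T"
  obtains \<kappa> where "0 < \<kappa>" "\<And>y. 0 < y \<Longrightarrow> y < T \<Longrightarrow> \<kappa> * (y powr (2 * s) * (T - y)) \<le> Q y"
proof -
  define \<kappa> where "\<kappa> = min (1 / T) ((R - s) / T powr (2 * s))"
  show ?thesis
  proof (rule that[of \<kappa>])
    show "0 < \<kappa>" using T_gt_1 R_gt_s by (simp add: \<kappa>_def)
    fix y assume y: "0 < y" "y < T"
    have n: "0 \<le> y powr (2 * s) * (T - y)" using y by simp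
    show "\<kappa> * (y powr (2 * s) * (T - y)) \<le> Q y"
    proof (cases "y < 1")
      case True
      have "\<kappa> * (y powr (2 * s) * (T - y)) \<le> 1 / T * (y powr (2 * s) * T)"
        using y n T_gt_1 by (intro mult_mono) (auto simp: \<kappa>_def)
      also have "\<dots> = Q y" using T_gt_1 y True by (simp add: Q_lower)
      finally show ?thesis .
    next
      case False
      have "y powr (2 * s) \<le> T powr (2 * s)" using y s_pos by (intro powr_mono2) auto
      then have "\<kappa> * (y powr (2 * s) * (T - y)) \<le> (R - s) / T powr (2 * s) * (T powr (2 * s) * (T - y))"
        using y n R_gt_s by (intro mult_mono mult_right_mono) (auto simp: \<kappa>_def)
      also have "\<dots> = (T - y) * (R - s)" using T_gt_1 by simp
      also have "\<dots> \<le> (T - y) * (y - (c - R))" using y False by (intro mult_left_mono) (auto simp: c_def)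
      also have "\<dots> = Q y" using False by (simp add: Q_upper)
      finally show ?thesis .
    qed
  qed
qed

lemma body_coord_le: assumes "x \<in> body" "i \<noteq> k" shows "\<bar>x $ i\<bar> \<le> sqrt (Q (x $ k)) \<and> \<bar>x $ i\<bar> \<le> R"
proof -
  have "\<bar>x $ i\<bar> = \<bar>hp x $ i\<bar>" using assms by (simp add: hp_nth)
  also have "\<dots> \<le> normp k x" unfolding normp_eq by (rule component_le_norm_cart)
  finally have a: "\<bar>x $ i\<bar> \<le> sqrt (Q (x $ k))" using assms by (simp add: body_iff)
  also have "\<dots> \<le> sqrt (R\<^sup>2)" using Q_le_R2 by (rule real_sqrt_le_mono)
  finally show ?thesis using a R_pos by simp
qed

lemma borel_Q[measurable]: "Q \<in> borel_measurable borel"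
  by (intro borel_measurable_continuous_onI continuous_on_Q)

lemma borel_V[measurable]: "V \<in> borel_measurable borel"
  by (intro borel_measurable_continuous_onI continuous_on_V)

lemma borel_P[measurable]: "P \<in> borel_measurable borel"
  unfolding P_def[abs_def] by measurable

lemma borel_body[measurable]: "body \<in> sets borel"
  using open_body by simp

lemma borel_nth[measurable]: "(\<lambda>x. (x :: real^'n) $ i) \<in> borel_measurable borel"
  by (intro borel_measurable_continuous_onI continuous_intros)

text \<open>The weight of the surface measure is dominated by 1 / Q, and slices have volume of order
  Q^((n - 1) / 2). For n = 2 this leaves Q^(-1/2), that is y^(-s) at the tip and (T - y)^(-1/2) at
  the top, both integrable; further horizontal directions only add bounded factors.\<close>

lemma nn_integral_inverse_Q_finite:
  "(\<integral>\<^sup>+x. indicator body x * ennreal (1 / Q (x $ k)) \<partial>lborel) < \<infinity>"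
proof -
  \<comment> \<open>Then b = 1/2 + \<alpha>/4 and 2 s b = (1 + \<alpha>/2) / (1 + \<alpha>) < 1: the
    loss from \<gamma> < 1 is small enough for convergence at the tip.\<close>
  define \<gamma> where "\<gamma> = 1 - \<alpha> / 2"
  define b where "b = 1 - \<gamma> / 2"
  have \<gamma>: "0 \<le> \<gamma>" "\<gamma> < 1" and b: "0 < b" "b < 1" using \<alpha>_pos \<alpha>_less_1 by (auto simp: \<gamma>_def b_def)
  have sb: "2 * s * b < 1" using \<alpha>_pos by (simp add: s_def b_def \<gamma>_def divide_simps)
  obtain \<kappa> where \<kappa>: "0 < \<kappa>" "\<And>y. 0 < y \<Longrightarrow> y < T \<Longrightarrow> \<kappa> * (y powr (2 * s) * (T - y)) \<le> Q y"
    using Q_lower_bound[of 1] T_gt_1 by auto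
  define D where "D = (R\<^sup>2) powr (\<gamma> * real (CARD('n) - 2) / 2) * \<kappa> powr (-b)"
  have pw: "1 / Q y * sqrt (Q y) powr (\<gamma> * real (CARD('n) - 1)) \<le> D * (y powr (-(2 * s * b)) * (T - y) powr (-b))"
    if y: "0 < y" "y < T" for y
  proof -
    have q: "Q y > 0" using Q_pos y by simp
    have "1 / Q y * sqrt (Q y) powr (\<gamma> * real (CARD('n) - 1)) = Q y powr (-1) * Q y powr (\<gamma> * real (CARD('n) - 1) / 2)"
      using q by (simp add: powr_half_sqrt[symmetric] powr_powr powr_minus_divide)
    \<comment> \<open>The share of n - 2 of the n - 1 horizontal directions is split off; its
      exponent is nonnegative, so Q \<le> R^2 bounds it.\<close>
    also have "\<dots> = Q y powr (\<gamma> * real (CARD('n) - 2) / 2) * Q y powr (- b)"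
    proof -
      obtain m where "CARD('n) = m + 2" using card_ge_2 by (metis add.commute le_Suc_ex)
      then have "-1 + \<gamma> * real (CARD('n) - 1) / 2 = \<gamma> * real (CARD('n) - 2) / 2 + - b"
        by (simp add: b_def field_simps)
      then show ?thesis by (simp only: powr_add[symmetric])
    qed
    also have "\<dots> \<le> (R\<^sup>2) powr (\<gamma> * real (CARD('n) - 2) / 2) * (\<kappa> * (y powr (2 * s) * (T - y))) powr (-b)"
      using q Q_le_R2 \<gamma> b \<kappa> y by (intro mult_mono powr_mono2 powr_mono2') auto
    also have "\<dots> = D * (y powr (-(2 * s * b)) * (T - y) powr (-b))"
      using \<kappa> y by (simp add: D_def powr_mult powr_powr)
    finally show ?thesis .
  qed
  have "(\<integral>\<^sup>+y. indicator {0<..<T} y * ennreal (1 / Q y * sqrt (Q y) powr (\<gamma> * real (CARD('n) - 1))) \<partial>lborel)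
     \<le> (\<integral>\<^sup>+y. ennreal D * (indicator {0<..<T} y * ennreal (y powr (-(2 * s * b)) * (T - y) powr (-b))) \<partial>lborel)"
    using pw by (intro nn_integral_mono) (auto simp: indicator_def D_def ennreal_mult[symmetric] intro!: ennreal_leI)
  also have "\<dots> = ennreal D * (\<integral>\<^sup>+y. indicator {0<..<T} y * ennreal (y powr (-(2 * s * b)) * (T - y) powr (-b)) \<partial>lborel)"
    by (intro nn_integral_cmult) measurable
  also have "\<dots> < \<infinity>"
    using nn_integral_two_powr_finite[of "-(2 * s * b)" "-b" T] sb b s_pos T_gt_1
    by (simp add: ennreal_mult_less_top)
  finally have fin: "(\<integral>\<^sup>+y. indicator {0<..<T} y * ennreal (1 / Q y * sqrt (Q y) powr (\<gamma> * real (CARD('n) - 1))) \<partial>lborel) < \<infinity>" .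
  have "(\<integral>\<^sup>+x. indicator body x * ennreal (1 / Q (x $ k)) \<partial>lborel) \<le>
    (\<integral>\<^sup>+x. indicator {x. x $ k \<in> {0<..<T} \<and> (\<forall>i. i \<noteq> k \<longrightarrow> \<bar>x $ i\<bar> \<le> sqrt (Q (x $ k)) \<and> \<bar>x $ i\<bar> \<le> R)} x
      * ennreal (1 / Q (x $ k)) \<partial>lborel)"
    using body_nth body_coord_le by (intro nn_integral_mono) (auto simp: indicator_def)
  also have "\<dots> < \<infinity>"
    by (rule nn_integral_tapered_finite[OF _ _ _ _ \<gamma> _ fin])
       (use Q_pos R_pos in \<open>auto simp: less_imp_le\<close>)
  finally show ?thesis .
qed

lemma sqrt_Q_le: assumes "0 < y" "y < T" shows "sqrt (Q y) \<le> R * y powr s"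
proof (cases "y < 1")
  case True
  have "sqrt (Q y) = y powr s" using True assms
    by (simp add: Q_lower powr_half_sqrt[symmetric] powr_powr)
  then show ?thesis using R_gt_1 by (simp add: mult_le_cancel_right1)
next
  case False
  have "sqrt (Q y) \<le> sqrt (R\<^sup>2)" using Q_le_R2 by (rule real_sqrt_le_mono)
  also have "\<dots> \<le> R * 1" using R_pos by simp
  also have "\<dots> \<le> R * y powr s" using False R_pos s_pos by (intro mult_left_mono ge_one_powr_ge_zero) auto
  finally show ?thesis .
qed

text \<open>The hypothesis is the convergence condition at 0 for y^(s (n - 1) - a); being strict, it
  leaves room for the exponent \<gamma> (n - 1) with some \<gamma> < 1.\<close>

lemma nn_integral_nth_powr_finite:
  assumes a: "a < s * real (CARD('n) - 1) + 1"
  shows "(\<integral>\<^sup>+x. indicator body x * ennreal ((x $ k) powr (-a)) \<partial>lborel) < \<infinity>"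
proof -
  define N where "N = real (CARD('n) - 1)"
  have N: "1 \<le> N" using card_ge_2 by (simp add: N_def)
  have sN: "0 < s * N" using s_pos N by simp
  \<comment> \<open>The midpoint of 1 and the critical ratio (a - 1) / (s N), replaced by 0 when it
    is negative.\<close>
  define \<gamma> where "\<gamma> = max 0 (((a - 1) / (s * N) + 1) / 2)"
  have q1: "(a - 1) / (s * N) < 1" using a sN by (simp add: N_def divide_less_eq)
  have mx: "max 0 ((q + 1) / 2) < 1 \<and> q < max 0 ((q + 1) / 2)" if "q < 1" for q :: real
    using that by (auto simp: max_def)
  have \<gamma>: "0 \<le> \<gamma>" "\<gamma> < 1" "(a - 1) / (s * N) < \<gamma>"
    using mx[OF q1, folded \<gamma>_def] by (auto simp: \<gamma>_def)
  have "a - 1 < \<gamma> * (s * N)" using \<gamma>(3) sN by (simp only: pos_divide_less_eq)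
  moreover have "\<gamma> * (s * N) = s * \<gamma> * N" by simp
  ultimately have ex: "-1 < s * \<gamma> * N - a" by linarith
  have pw: "y powr (-a) * (R * y powr s) powr (\<gamma> * N) = R powr (\<gamma> * N) * y powr (s * \<gamma> * N - a)" if "0 < y" for y
    using that R_pos by (simp add: powr_mult powr_powr powr_add[symmetric] mult_ac)
  have "(\<integral>\<^sup>+y. indicator {0<..<T} y * ennreal (y powr (-a) * (R * y powr s) powr (\<gamma> * real (CARD('n) - 1))) \<partial>lborel)
     \<le> (\<integral>\<^sup>+y. ennreal (R powr (\<gamma> * N)) * (indicator {0..T} y * ennreal (y powr (s * \<gamma> * N - a))) \<partial>lborel)"
    using pw unfolding N_def[symmetric]
    by (intro nn_integral_mono) (auto simp: indicator_def ennreal_mult[symmetric])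
  also have "\<dots> = ennreal (R powr (\<gamma> * N)) * (\<integral>\<^sup>+y. indicator {0..T} y * ennreal (y powr (s * \<gamma> * N - a)) \<partial>lborel)"
    by (intro nn_integral_cmult) measurable
  also have "\<dots> < \<infinity>"
    using nn_integral_powr_finite[OF ex, of T] T_gt_1 by (simp add: ennreal_mult_less_top)
  finally have fin: "(\<integral>\<^sup>+y. indicator {0<..<T} y * ennreal (y powr (-a) * (R * y powr s) powr (\<gamma> * real (CARD('n) - 1))) \<partial>lborel) < \<infinity>" .
  have "(\<integral>\<^sup>+x. indicator body x * ennreal ((x $ k) powr (-a)) \<partial>lborel) \<le>
    (\<integral>\<^sup>+x. indicator {x. x $ k \<in> {0<..<T} \<and> (\<forall>i. i \<noteq> k \<longrightarrow> \<bar>x $ i\<bar> \<le> R * (x $ k) powr s \<and> \<bar>x $ i\<bar> \<le> R)} x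
      * ennreal ((x $ k) powr (-a)) \<partial>lborel)"
    using body_nth body_coord_le order_trans[OF _ sqrt_Q_le]
    by (intro nn_integral_mono) (auto simp: indicator_def)
  also have "\<dots> < \<infinity>"
    by (rule nn_integral_tapered_finite[OF _ _ _ _ \<gamma>(1,2) _ fin])
       (use R_pos in \<open>auto\<close>)
  finally show ?thesis .
qed

section \<open>The Gauss--Green formula\<close>

text \<open>The axis is removed since the radial direction used by \<open>rproj\<close> is undefined
  there.\<close>

definition core :: "(real^'n) set" where "core = {x \<in> body. 0 < normp k x}"

definition rproj :: "real^'n \<Rightarrow> real^'n" where
  "rproj x = (sqrt (Q (x $ k)) / normp k x) *\<^sub>R hp x + x $ k *\<^sub>R axis k 1"

definition normal :: "real^'n \<Rightarrow> real^'n" where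
  "normal x = P (x $ k) *\<^sub>R hp x + V (x $ k) *\<^sub>R axis k 1"

text \<open>Origin of the weight: radial projection sends Lebesgue measure on a slice of radius w =
  sqrt Q to w / (n - 1) times the measure of its bounding sphere, and the area element of the
  surface is the latter measure times dy / (P w), as P w is the length of the horizontal part of the
  normal. The quotient of the two is (n - 1) / (P w^2).\<close>

definition dens :: "real^'n \<Rightarrow> real" where
  "dens x = indicator core x * (real (CARD('n) - 1) / (Q (x $ k) * P (x $ k)))"

text \<open>The square of the radial gauge of the slices; squaring keeps it differentiable on the
  axis.\<close>

definition N2 :: "real^'n \<Rightarrow> real" where "N2 x = (normp k x)\<^sup>2 / Q (x $ k)"

definition strip :: "(real^'n) set" where "strip = {x. 0 < x $ k \<and> x $ k < T}"

lemma borel_normp[measurable]: "normp k \<in> borel_measurable borel"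
  by (intro borel_measurable_continuous_onI continuous_normp)

lemma continuous_hp: "continuous_on S hp"
  unfolding hp_def[abs_def] by (intro continuous_intros)

lemma borel_hp[measurable]: "hp \<in> borel_measurable borel"
  by (intro borel_measurable_continuous_onI continuous_hp)

lemma borel_rproj[measurable]: "rproj \<in> borel_measurable borel"
  unfolding rproj_def[abs_def] by measurable

lemma borel_normal[measurable]: "normal \<in> borel_measurable borel"
  unfolding normal_def[abs_def] by measurable

lemma borel_core[measurable]: "core \<in> sets borel"
proof -
  have "core = body \<inter> {x \<in> space borel. 0 < normp k x}" by (auto simp: core_def)
  also have "\<dots> \<in> sets borel" by measurable
  finally show ?thesis .
qed

lemma borel_dens[measurable]: "dens \<in> borel_measurable borel"
  unfolding dens_def[abs_def] by measurable

lemma borel_N2[measurable]: "N2 \<in> borel_measurable borel"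
  unfolding N2_def[abs_def] by measurable

lemma open_strip: "open strip"
  unfolding strip_def by (intro open_Collect_conj open_Collect_less continuous_intros)

lemma borel_strip[measurable]: "strip \<in> sets borel"
  using open_strip by simp

lemma body_N2: "x \<in> body \<longleftrightarrow> x \<in> strip \<and> N2 x < 1"
  using body_nth[of x] Q_pos[of "x $ k"] by (auto simp: strip_def body_def N2_def)

lemma rproj_nth: "rproj x $ k = x $ k"
  unfolding rproj_def by (rule nth_scale)

lemma normp_rproj: "0 < normp k x \<Longrightarrow> x \<in> strip \<Longrightarrow> normp k (rproj x) = sqrt (Q (x $ k))"
  using Q_pos[of "x $ k"] by (simp add: rproj_def normp_scale strip_def)

lemma rproj_surf: "0 < normp k x \<Longrightarrow> x \<in> strip \<Longrightarrow> rproj x \<in> surf"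
  using normp_rproj[of x] Q_pos[of "x $ k"] by (auto simp: surf_def rproj_nth strip_def)

lemma core_strip: "x \<in> core \<Longrightarrow> x \<in> strip \<and> 0 < normp k x"
  by (auto simp: core_def body_N2)

lemma hscale_simps: "hscale t x $ k = x $ k" "hp (hscale t x) = t *\<^sub>R hp x"
  "normp k (hscale t x) = \<bar>t\<bar> * normp k x"
  by (auto simp: hscale_nth vec_eq_iff hp_nth) (simp add: hscale_def normp_scale)

lemma rproj_hscale: "0 < t \<Longrightarrow> rproj (hscale t x) = rproj x"
  by (simp add: rproj_def hscale_simps)

lemma norm_normal: assumes "x \<in> surf" shows "norm (normal x) = 1"
proof -
  have "(norm (normal x))\<^sup>2 = (P (x $ k))\<^sup>2 * (normp k x)\<^sup>2 + (V (x $ k))\<^sup>2"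
    unfolding normal_def by (subst norm_decomp) (auto simp: hp_nth normp_eq power_mult_distrib)
  also have "\<dots> = 1"
  proof (cases "0 < x $ k \<and> x $ k < T")
    case True
    then show ?thesis using PQV assms by (simp add: surf_def)
  next
    case False
    then have "x $ k = 0 \<or> x $ k = T" using assms by (auto simp: surf_def)
    moreover have "V T = 1" using T_gt_1 R_pos by (simp add: V_upper T_def)
    moreover have "V 0 = -1" by (rule V_nonpos) simp
    ultimately show ?thesis using assms Q_0 Q_T by (auto simp: surf_def)
  qed
  finally show ?thesis using power2_eq_iff_nonneg[of "norm (normal x)" 1] by simp
qed

definition dN2 :: "real^'n \<Rightarrow> real^'n \<Rightarrow> real" where
  "dN2 v x = 2 / Q (x $ k) * (hp x \<bullet> v) + 2 * (normp k x)\<^sup>2 * V (x $ k) / (P (x $ k) * (Q (x $ k))\<^sup>2) * v $ k"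

text \<open>On the surface the gradient of the gauge \<open>N2\<close> is a multiple of the normal.
  The factor 2 / (Q P) is the part of \<open>dens\<close> that comes from the slope of the
  cutoff.\<close>

lemma dN2_rproj: assumes "0 < normp k x" "x \<in> strip"
  shows "dN2 v (rproj x) = 2 / (Q (x $ k) * P (x $ k)) * (normal (rproj x) \<bullet> v)"
proof -
  have p: "Q (x $ k) > 0" "P (x $ k) > 0" using assms Q_pos P_pos by (auto simp: strip_def)
  have "normal (rproj x) \<bullet> v = P (x $ k) * (hp (rproj x) \<bullet> v) + V (x $ k) * v $ k"
    by (simp add: normal_def rproj_nth inner_add_left inner_axis')
  moreover have "dN2 v (rproj x) = 2 / Q (x $ k) * (hp (rproj x) \<bullet> v) + 2 * V (x $ k) / (P (x $ k) * Q (x $ k)) * v $ k"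
    using p by (simp add: dN2_def rproj_nth normp_rproj[OF assms] power2_eq_square)
  ultimately show ?thesis using p by (simp add: field_simps)
qed

lemma N2_line: assumes x: "x \<in> strip"
  shows "((\<lambda>t. N2 (x + t *\<^sub>R v)) has_real_derivative dN2 v x) (at 0)"
proof -
  let ?y = "x $ k"
  have y: "0 < ?y" "?y < T" using x by (auto simp: strip_def)
  have p: "Q ?y > 0" "P ?y > 0" using y Q_pos P_pos by auto
  have hv: "hp (x + t *\<^sub>R v) = hp x + t *\<^sub>R hp v" for t
    by (simp add: linear_add[OF linear_hp] linear_cmul[OF linear_hp])
  have hpv: "hp x \<bullet> hp v = hp x \<bullet> v" by (simp add: hp_def[of v] inner_diff_right hp_inner_axis)
  have "(normp k (x + t *\<^sub>R v))\<^sup>2 = (normp k x)\<^sup>2 + 2 * t * (hp x \<bullet> v) + t\<^sup>2 * (normp k v)\<^sup>2" for t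
    unfolding normp_eq hv power2_norm_eq_inner
    by (simp add: inner_add_left inner_add_right inner_commute[of "hp v" "hp x"] hpv power2_eq_square distrib_left)
  then have e1: "(\<lambda>t. (normp k (x + t *\<^sub>R v))\<^sup>2) = (\<lambda>t. (normp k x)\<^sup>2 + 2 * t * (hp x \<bullet> v) + t\<^sup>2 * (normp k v)\<^sup>2)" by auto
  have d1: "((\<lambda>t. (normp k (x + t *\<^sub>R v))\<^sup>2) has_real_derivative 2 * (hp x \<bullet> v)) (at 0)"
    unfolding e1 by (auto intro!: derivative_eq_intros)
  have "((\<lambda>t. ?y + t * v $ k) has_real_derivative v $ k) (at 0)" by (auto intro!: derivative_eq_intros)
  moreover have "(Q has_real_derivative - 2 * V ?y / P ?y) (at (?y + 0 * v $ k))"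
    using DERIV_Q[OF y] by simp
  ultimately have "((\<lambda>t. Q (?y + t * v $ k)) has_real_derivative - 2 * V ?y / P ?y * v $ k) (at 0)"
    by (rule DERIV_chain2[rotated])
  then have d2: "((\<lambda>t. Q ((x + t *\<^sub>R v) $ k)) has_real_derivative - 2 * V ?y / P ?y * v $ k) (at 0)"
    by simp
  have "((\<lambda>t. N2 (x + t *\<^sub>R v)) has_real_derivative
     (2 * (hp x \<bullet> v) * Q ?y - (normp k x)\<^sup>2 * (- 2 * V ?y / P ?y * v $ k)) / (Q ?y * Q ?y)) (at 0)"
    using DERIV_divide[OF d1 d2] p unfolding N2_def by simp
  moreover have "(2 * (hp x \<bullet> v) * Q ?y - (normp k x)\<^sup>2 * (- 2 * V ?y / P ?y * v $ k)) / (Q ?y * Q ?y) = dN2 v x"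
    using p by (simp add: dN2_def field_simps power2_eq_square)
  ultimately show ?thesis by simp
qed

lemma continuous_on_dN2: "continuous_on strip (dN2 v)"
proof -
  have cP: "continuous_on {0<..<T} P" using isCont_P by (auto intro: continuous_at_imp_continuous_on)
  have c: "continuous_on strip (\<lambda>x. P (x $ k))" "continuous_on strip (\<lambda>x. V (x $ k))"
    by (auto intro!: continuous_on_compose2[OF cP] continuous_on_compose2[OF continuous_on_V[of UNIV]] continuous_intros
        simp: strip_def)
  have n0: "Q (x $ k) \<noteq> 0" "P (x $ k) \<noteq> 0" if "x \<in> strip" for x
    using that Q_pos[of "x $ k"] P_pos[of "x $ k"] by (auto simp: strip_def)
  show ?thesis unfolding dN2_def[abs_def]
    using n0 by (intro continuous_intros c continuous_Q_nth continuous_hp continuous_normp continuous_on_divide) auto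
qed

text \<open>The distance is w - |x'| = w (1 - sqrt (N2 x)) with w = sqrt Q \<le> R, and sqrt (1 -
  \<epsilon>) \<ge> 1 - \<epsilon>.\<close>

lemma dist_rproj: assumes "x \<in> strip" "1 - \<epsilon> \<le> N2 x" "N2 x < 1" "0 < \<epsilon>" "\<epsilon> < 1"
  shows "dist x (rproj x) \<le> R * \<epsilon>"
proof -
  have q: "Q (x $ k) > 0" using assms Q_pos by (auto simp: strip_def)
  have "normp k x \<noteq> 0" using assms by (auto simp: N2_def)
  then have r: "0 < normp k x" using normp_nonneg[of x] by simp
  let ?w = "sqrt (Q (x $ k))"
  have w: "0 < ?w" "?w \<le> R" using q Q_le_R2[of "x $ k"] R_pos by (auto intro: real_le_lsqrt)
  have eq: "N2 x = (normp k x / ?w)\<^sup>2" using q by (simp add: N2_def power_divide)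
  have lt: "normp k x / ?w < 1" using assms(3) unfolding eq
    by (intro power2_less_imp_less[of _ 1]) auto
  have "(1 - \<epsilon>)\<^sup>2 \<le> 1 - \<epsilon>" using assms by (simp add: power2_eq_square mult_left_le)
  then have "(1 - \<epsilon>)\<^sup>2 \<le> (normp k x / ?w)\<^sup>2" using assms(2) eq by linarith
  then have ge: "1 - \<epsilon> \<le> normp k x / ?w"
    by (rule power2_le_imp_le) (use r w in simp)
  have "x - rproj x = (1 - ?w / normp k x) *\<^sub>R hp x"
    unfolding rproj_def scaleR_left_diff_distrib using hp_decomp[of x] by (metis add_diff_cancel_right diff_diff_eq2 diff_add_eq diff_diff_add scaleR_one)
  then have "dist x (rproj x) = \<bar>1 - ?w / normp k x\<bar> * normp k x" by (simp add: dist_norm normp_eq)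
  also have "\<dots> = \<bar>normp k x - ?w\<bar>" proof -
    have "\<bar>1 - ?w / normp k x\<bar> * normp k x = \<bar>(1 - ?w / normp k x) * normp k x\<bar>"
      using r by (simp add: abs_mult)
    then show ?thesis using r by (simp add: left_diff_distrib)
  qed
  also have "\<dots> = ?w * (1 - normp k x / ?w)"
    using w lt by (simp add: right_diff_distrib)
  also have "\<dots> \<le> R * \<epsilon>" using w ge lt assms R_pos by (intro mult_mono) auto
  finally show ?thesis .
qed

lemma core_finite: "emeasure lborel core < \<infinity>"
proof -
  have "bounded core" using bounded_body by (rule bounded_subset) (auto simp: core_def)
  then show ?thesis using emeasure_bounded_finite by blast
qed

section \<open>Averages over thin shells\<close>

definition shell :: "real \<Rightarrow> (real^'n) set" where
  "shell \<epsilon> = {x \<in> strip. 1 - \<epsilon> \<le> N2 x \<and> N2 x < 1}"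

lemma borel_shell[measurable]: "shell \<epsilon> \<in> sets borel"
proof -
  have "shell \<epsilon> = strip \<inter> {x \<in> space borel. 1 - \<epsilon> \<le> N2 x} \<inter> {x \<in> space borel. N2 x < 1}"
    by (auto simp: shell_def)
  also have "\<dots> \<in> sets borel" by measurable
  finally show ?thesis .
qed

lemma shell_core: "\<epsilon> < 1 \<Longrightarrow> shell \<epsilon> \<subseteq> core"
  using normp_nonneg by (auto simp: shell_def core_def body_N2) (metis N2_def diff_gt_0_iff_gt div_0 less_eq_real_def linorder_not_le zero_eq_power2)

text \<open>Horizontal scaling by sqrt (1 - \<epsilon>) maps \<open>core\<close> onto
  \<open>core\<close> minus the shell and preserves \<open>F\<close>, so the part outside the shell
  contributes (1 - \<epsilon>)^((n - 1) / 2) times the full integral.\<close>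

lemma integral_shell:
  fixes F :: "real^'n \<Rightarrow> real"
  assumes [measurable]: "F \<in> borel_measurable borel" and B: "\<And>x. \<bar>F x\<bar> \<le> B"
    and inv: "\<And>x t. 0 < t \<Longrightarrow> F (hscale t x) = F x" and \<epsilon>: "0 < \<epsilon>" "\<epsilon> < 1"
  shows "(\<integral>x. indicator (shell \<epsilon>) x * F x \<partial>lborel)
    = (1 - (1 - \<epsilon>) powr (real (CARD('n) - 1) / 2)) * (\<integral>x. indicator core x * F x \<partial>lborel)"
proof -
  define t where "t = sqrt (1 - \<epsilon>)"
  have t: "0 < t" "t\<^sup>2 = 1 - \<epsilon>" using \<epsilon> by (auto simp: t_def)
  define A where "A = core - shell \<epsilon>"
  have [measurable]: "A \<in> sets borel" unfolding A_def by measurable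
  have AS: "hscale t x \<in> A \<longleftrightarrow> x \<in> core" for x
  proof -
    have q: "x \<in> strip \<Longrightarrow> 0 < Q (x $ k)" using Q_pos by (auto simp: strip_def)
    have n2: "N2 (hscale t x) = (1 - \<epsilon>) * N2 x"
      by (simp add: N2_def hscale_simps power_mult_distrib t)
    have "hscale t x \<in> A \<longleftrightarrow> x \<in> strip \<and> 0 < normp k x \<and> N2 (hscale t x) < 1 - \<epsilon>"
      using t \<epsilon> by (auto simp: A_def core_def shell_def body_N2 strip_def hscale_simps zero_less_mult_iff)
    also have "\<dots> \<longleftrightarrow> x \<in> core" unfolding n2 using \<epsilon> by (auto simp: core_def body_N2)
    finally show ?thesis .
  qed
  have bnd: "integrable lborel (\<lambda>x. indicator C x * F x)" if "C \<subseteq> core" "C \<in> sets borel" for C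
  proof (rule Bochner_Integration.integrable_bound)
    show "integrable lborel (\<lambda>x. B * indicator core x)"
      using core_finite by (intro integrable_mult_right integrable_real_indicator) auto
    show "AE x in lborel. norm (indicator C x * F x) \<le> norm (B * indicator core x)"
      using B that(1) by (auto simp: indicator_def intro!: AE_I2 order_trans[OF B abs_ge_self])
  qed (use that in measurable)
  have "(\<integral>x. indicator A x * F x \<partial>lborel) = t ^ (CARD('n) - 1) * (\<integral>x. indicator A (hscale t x) * F (hscale t x) \<partial>lborel)"
    by (rule integral_hscale) (use t in measurable)
  also have "(\<integral>x. indicator A (hscale t x) * F (hscale t x) \<partial>lborel) = (\<integral>x. indicator core x * F x \<partial>lborel)"
    by (intro Bochner_Integration.integral_cong) (use AS inv[OF t(1)] in \<open>auto simp: indicator_def\<close>)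
  also have "t ^ (CARD('n) - 1) = (1 - \<epsilon>) powr (real (CARD('n) - 1) / 2)"
    using \<epsilon> unfolding t_def by (simp add: powr_half_sqrt[symmetric] powr_power)
  finally have A: "(\<integral>x. indicator A x * F x \<partial>lborel) = (1 - \<epsilon>) powr (real (CARD('n) - 1) / 2) * (\<integral>x. indicator core x * F x \<partial>lborel)" .
  have "(\<integral>x. indicator core x * F x \<partial>lborel) = (\<integral>x. indicator (shell \<epsilon>) x * F x + indicator A x * F x \<partial>lborel)"
    using shell_core[of \<epsilon>] \<epsilon> by (intro Bochner_Integration.integral_cong) (auto simp: A_def indicator_def)
  also have "\<dots> = (\<integral>x. indicator (shell \<epsilon>) x * F x \<partial>lborel) + (\<integral>x. indicator A x * F x \<partial>lborel)"
    by (intro Bochner_Integration.integral_add bnd shell_core \<epsilon>) (auto simp: A_def)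
  finally show ?thesis unfolding A by (simp add: left_diff_distrib)
qed

lemma shell_quotient_limit:
  assumes "0 \<le> m"
  shows "((\<lambda>\<epsilon>. (1 - (1 - \<epsilon>) powr m) / \<epsilon>) \<longlongrightarrow> m) (at_right (0::real))"
proof -
  have "((\<lambda>\<epsilon>. 1 - (1 - \<epsilon>) powr m) has_real_derivative m) (at 0)"
    by (auto intro!: derivative_eq_intros)
  then have "((\<lambda>\<epsilon>. (1 - (1 - \<epsilon>) powr m) / \<epsilon>) \<longlongrightarrow> m) (at 0)"
    by (simp add: has_field_derivative_iff)
  then show ?thesis by (rule filterlim_mono[OF _ order_refl at_le]) simp
qed

text \<open>On the thin shell \<open>\<Psi>\<close> may be replaced by its radially constant extension, whose integral is
  known by scaling.\<close>

lemma shell_limit: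
  fixes \<Psi> :: "real^'n \<Rightarrow> real"
  assumes cont: "continuous_on UNIV \<Psi>" and K: "compact K" "\<And>x. x \<notin> K \<Longrightarrow> \<Psi> x = 0"
  shows "((\<lambda>\<epsilon>. (\<integral>x. indicator (shell \<epsilon>) x * \<Psi> x \<partial>lborel) / \<epsilon>) \<longlongrightarrow>
     real (CARD('n) - 1) / 2 * (\<integral>x. indicator core x * \<Psi> (rproj x) \<partial>lborel)) (at_right 0)"
proof -
  define m where "m = real (CARD('n) - 1) / 2"
  define J where "J = (\<integral>x. indicator core x * \<Psi> (rproj x) \<partial>lborel)"
  define q where "q \<epsilon> = (1 - (1 - \<epsilon>) powr m) / \<epsilon>" for \<epsilon> :: real
  have m0: "0 \<le> m" by (simp add: m_def)
  have [measurable]: "\<Psi> \<in> borel_measurable borel" using cont by (rule borel_measurable_continuous_onI)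
  have "bounded (\<Psi> ` K)"
    using K cont by (intro compact_imp_bounded compact_continuous_image) (auto intro: continuous_on_subset)
  then obtain B where "\<And>x. x \<in> K \<Longrightarrow> \<bar>\<Psi> x\<bar> \<le> B" by (auto simp: bounded_iff)
  then have B: "\<bar>\<Psi> x\<bar> \<le> max B 0" for x using K(2)[of x] by (cases "x \<in> K") force+
  have ql: "(q \<longlongrightarrow> m) (at_right 0)" unfolding q_def using shell_quotient_limit[OF m0] .
  have sm: "(\<integral>x. indicator (shell \<epsilon>) x * 1 \<partial>lborel) = q \<epsilon> * \<epsilon> * measure lborel core"
    and sp: "(\<integral>x. indicator (shell \<epsilon>) x * \<Psi> (rproj x) \<partial>lborel) = q \<epsilon> * \<epsilon> * J" if \<epsilon>: "0 < \<epsilon>" "\<epsilon> < 1" for \<epsilon>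
    using integral_shell[of "\<lambda>_. 1" 1 \<epsilon>] integral_shell[of "\<lambda>x. \<Psi> (rproj x)" "max B 0" \<epsilon>] \<epsilon> B
    by (auto simp: q_def m_def J_def rproj_hscale)
  have uc: "uniformly_continuous_on UNIV \<Psi>"
  proof -
    obtain r where r: "K \<subseteq> ball 0 r" using compact_imp_bounded[OF K(1)] bounded_subset_ballD by blast
    have "uniformly_continuous_on (cball 0 (r + 1)) \<Psi>"
      using cont by (intro compact_uniformly_continuous) (auto intro: continuous_on_subset)
    show ?thesis unfolding uniformly_continuous_on_def
    proof (intro allI impI)
      fix e :: real assume "e > 0"
      then obtain d where d: "d > 0" "\<And>x x'. x \<in> cball 0 (r + 1) \<Longrightarrow> x' \<in> cball 0 (r + 1) \<Longrightarrow> dist x' x < d \<Longrightarrow> dist (\<Psi> x') (\<Psi> x) < e"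
        using \<open>uniformly_continuous_on (cball 0 (r + 1)) \<Psi>\<close> unfolding uniformly_continuous_on_def by meson
      have "dist (\<Psi> x') (\<Psi> x) < e" if dx: "dist x' x < min d 1" for x x'
      proof (cases "x \<in> ball 0 r \<or> x' \<in> ball 0 r")
        case True
        have "norm x' \<le> norm x + dist x' x" "norm x \<le> norm x' + dist x' x"
          using dist_triangle[of x' 0 x] dist_triangle[of x 0 x'] by (auto simp: dist_commute)
        then show ?thesis using True dx d by auto
      next
        case False
        then have "\<Psi> x = 0" "\<Psi> x' = 0" using K(2) r by blast+
        then show ?thesis using \<open>e > 0\<close> by simp
      qed
      then show "\<exists>d>0. \<forall>x\<in>UNIV. \<forall>x'\<in>UNIV. dist x' x < d \<longrightarrow> dist (\<Psi> x') (\<Psi> x) < e"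
        using d(1) by (intro exI[of _ "min d 1"]) auto
    qed
  qed
  have err: "((\<lambda>\<epsilon>. (\<integral>x. indicator (shell \<epsilon>) x * \<Psi> x \<partial>lborel) / \<epsilon> - q \<epsilon> * J) \<longlongrightarrow> 0) (at_right 0)"
  proof (rule tendstoI)
    fix e :: real assume e: "e > 0"
    define M where "M = measure lborel core"
    \<comment> \<open>On the shell the replacement costs at most \<open>e'\<close> pointwise, and
      the measure of the shell divided by \<epsilon> is \<open>q \<epsilon> * M\<close>, eventually
      at most (m + 1) M.\<close>
    define e' where "e' = e / ((m + 1) * M + 1)"
    have M: "0 \<le> M" by (simp add: M_def)
    have den: "0 < (m + 1) * M + 1" using M m0 by (intro add_nonneg_pos mult_nonneg_nonneg) auto
    have e': "e' > 0" using e den by (simp add: e'_def)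
    obtain d where d: "d > 0" "\<And>x x'. dist x' x < d \<Longrightarrow> dist (\<Psi> x') (\<Psi> x) < e'"
      using uc e' unfolding uniformly_continuous_on_def by blast
    have ev1: "\<forall>\<^sub>F \<epsilon> in at_right 0. \<epsilon> \<in> {0<..<min 1 (d / R)}"
      by (rule eventually_at_right_real) (use d R_pos in auto)
    have ev2: "\<forall>\<^sub>F \<epsilon> in at_right 0. q \<epsilon> < m + 1" using order_tendstoD(2)[OF ql] by simp
    show "\<forall>\<^sub>F \<epsilon> in at_right 0. dist ((\<integral>x. indicator (shell \<epsilon>) x * \<Psi> x \<partial>lborel) / \<epsilon> - q \<epsilon> * J) 0 < e"
      using ev1 ev2
    proof eventually_elim
      case (elim \<epsilon>)
      then have \<epsilon>: "0 < \<epsilon>" "\<epsilon> < 1" "R * \<epsilon> < d" using R_pos by (auto simp: field_simps)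
      have fin: "integrable lborel (\<lambda>x. indicator (shell \<epsilon>) x * F x)"
        if [measurable]: "F \<in> borel_measurable borel" and "\<And>x. \<bar>F x\<bar> \<le> b" for F :: "real^'n \<Rightarrow> real" and b
      proof (rule Bochner_Integration.integrable_bound)
        show "integrable lborel (\<lambda>x. b * indicator core x)"
          using core_finite by (intro integrable_mult_right integrable_real_indicator) auto
        show "AE x in lborel. norm (indicator (shell \<epsilon>) x * F x) \<le> norm (b * indicator core x)"
          using that(2) shell_core[OF \<epsilon>(2)] by (auto simp: indicator_def intro!: AE_I2 order_trans[OF that(2) abs_ge_self])
      qed measurable
      have i1: "integrable lborel (\<lambda>x. indicator (shell \<epsilon>) x * \<Psi> x)" by (rule fin[OF _ B]) simp
      have i2: "integrable lborel (\<lambda>x. indicator (shell \<epsilon>) x * \<Psi> (rproj x))" by (rule fin[OF _ B]) measurable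
      have i3: "integrable lborel (\<lambda>x. indicator (shell \<epsilon>) x * 1 :: real)" by (rule fin[of _ 1]) auto
      have "\<bar>(\<integral>x. indicator (shell \<epsilon>) x * \<Psi> x \<partial>lborel) - (\<integral>x. indicator (shell \<epsilon>) x * \<Psi> (rproj x) \<partial>lborel)\<bar>
         = \<bar>\<integral>x. indicator (shell \<epsilon>) x * \<Psi> x - indicator (shell \<epsilon>) x * \<Psi> (rproj x) \<partial>lborel\<bar>"
        using i1 i2 by simp
      also have "\<dots> \<le> (\<integral>x. \<bar>indicator (shell \<epsilon>) x * \<Psi> x - indicator (shell \<epsilon>) x * \<Psi> (rproj x)\<bar> \<partial>lborel)"
        by (rule integral_abs_bound)
      also have "\<dots> \<le> (\<integral>x. e' * (indicator (shell \<epsilon>) x * 1) \<partial>lborel)"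
      proof (rule integral_mono)
        fix x show "\<bar>indicator (shell \<epsilon>) x * \<Psi> x - indicator (shell \<epsilon>) x * \<Psi> (rproj x)\<bar> \<le> e' * (indicator (shell \<epsilon>) x * 1)"
        proof (cases "x \<in> shell \<epsilon>")
          case True
          then have "dist x (rproj x) < d" using dist_rproj[of x \<epsilon>] \<epsilon> by (auto simp: shell_def)
          from d(2)[OF this] show ?thesis using True by (simp add: dist_norm)
        qed simp
      qed (use i1 i2 i3 in auto)
      also have "\<dots> = e' * (q \<epsilon> * \<epsilon> * M)" using sm[OF \<epsilon>(1,2)] by (simp add: M_def)
      finally have "\<bar>(\<integral>x. indicator (shell \<epsilon>) x * \<Psi> x \<partial>lborel) - q \<epsilon> * \<epsilon> * J\<bar> \<le> e' * (q \<epsilon> * \<epsilon> * M)"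
        unfolding sp[OF \<epsilon>(1,2)] .
      then have "\<bar>(\<integral>x. indicator (shell \<epsilon>) x * \<Psi> x \<partial>lborel) - q \<epsilon> * \<epsilon> * J\<bar> / \<epsilon> \<le> e' * (q \<epsilon> * \<epsilon> * M) / \<epsilon>"
        using \<epsilon> by (intro divide_right_mono) auto
      moreover have "\<bar>(\<integral>x. indicator (shell \<epsilon>) x * \<Psi> x \<partial>lborel) - q \<epsilon> * \<epsilon> * J\<bar> / \<epsilon>
         = \<bar>(\<integral>x. indicator (shell \<epsilon>) x * \<Psi> x \<partial>lborel) / \<epsilon> - q \<epsilon> * J\<bar>"

      proof -
        have "\<bar>A - q \<epsilon> * \<epsilon> * J\<bar> / \<epsilon> = \<bar>(A - q \<epsilon> * \<epsilon> * J) / \<epsilon>\<bar>" for A using \<epsilon> by simp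
        moreover have "(A - q \<epsilon> * \<epsilon> * J) / \<epsilon> = A / \<epsilon> - q \<epsilon> * J" for A
          using \<epsilon> by (simp add: diff_divide_distrib)
        ultimately show ?thesis by (simp only:)
      qed
      moreover have "e' * (q \<epsilon> * \<epsilon> * M) / \<epsilon> = e' * (q \<epsilon> * M)" using \<epsilon> by simp
      moreover have "e' * (q \<epsilon> * M) \<le> e' * ((m + 1) * M)"
        using elim e' M by (intro mult_left_mono mult_right_mono) auto
      moreover have "e' * ((m + 1) * M) < e"
        using e den by (simp add: e'_def pos_divide_less_eq field_simps)
      ultimately show ?case by (simp add: dist_norm)
    qed
  qed
  have "((\<lambda>\<epsilon>. ((\<integral>x. indicator (shell \<epsilon>) x * \<Psi> x \<partial>lborel) / \<epsilon> - q \<epsilon> * J) + q \<epsilon> * J) \<longlongrightarrow> 0 + m * J) (at_right 0)"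
    by (intro tendsto_add err tendsto_mult ql tendsto_const)
  then show ?thesis by (simp add: m_def J_def)
qed

end

lemma integrable_bounded_support:
  fixes F :: "'a::euclidean_space \<Rightarrow> real"
  assumes [measurable]: "F \<in> borel_measurable borel" and B: "\<And>x. \<bar>F x\<bar> \<le> B"
    and supp: "\<And>x. x \<notin> cball 0 \<rho> \<Longrightarrow> F x = 0"
  shows "integrable lborel F"
proof (rule Bochner_Integration.integrable_bound)
  show "integrable lborel (\<lambda>x::'a. B * indicator (cball 0 \<rho>) x)"
    using emeasure_lborel_cball_finite[of "0::'a" \<rho>]
    by (intro integrable_mult_right integrable_real_indicator) auto
  show "AE x in lborel. norm (F x) \<le> norm (B * indicator (cball 0 \<rho>) x)"
  proof (rule AE_I2)
    fix x show "norm (F x) \<le> norm (B * indicator (cball 0 \<rho>) x)"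
      using order_trans[OF B abs_ge_self] supp[of x] by (cases "x \<in> cball 0 \<rho>") auto
  qed
qed simp

context convex_drop
begin

section \<open>Divergence integrals with cutoffs, and their limits\<close>

text \<open>\<open>f\<close> times the derivative of the gauge. The latter is singular at the
  heights 0 and \<open>T\<close>; when \<open>f\<close> vanishes near these heights, the extension
  by 0 is continuous on the whole space.\<close>

definition sflux :: "(real^'n \<Rightarrow> real) \<Rightarrow> real^'n \<Rightarrow> real^'n \<Rightarrow> real" where
  "sflux f v x = (if x \<in> strip then dN2 v x * f x else 0)"

lemma sflux_continuous:
  assumes f: "C1_gradient f g" and \<delta>: "0 < \<delta>" "\<And>x. x $ k < \<delta> \<or> T - \<delta> < x $ k \<Longrightarrow> f x = 0"
  shows "continuous_on UNIV (sflux f v)"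
proof -
  let ?O = "{x. x $ k < \<delta>} \<union> {x. T - \<delta> < x $ k}"
  have O: "open ?O" by (intro open_Un open_Collect_less continuous_intros)
  have "continuous_on (strip \<union> ?O) (sflux f v)"
  proof (rule continuous_on_open_Un[OF open_strip O])
    have "continuous_on strip (\<lambda>x. dN2 v x * f x)"
      by (intro continuous_on_mult continuous_on_dN2 C1_gradient_continuous[OF f])
    then show "continuous_on strip (sflux f v)"
      by (rule continuous_on_eq) (simp add: sflux_def)
    show "continuous_on ?O (sflux f v)"
      by (rule continuous_on_eq[OF continuous_on_const[of _ 0]]) (use \<delta>(2) in \<open>auto simp: sflux_def\<close>)
  qed
  moreover have "strip \<union> ?O = UNIV" using \<delta>(1) by (auto simp: strip_def)
  ultimately show ?thesis by simp
qed

text \<open>The integrand is the derivative of \<eta> (N2) f in the direction \<open>v\<close>, and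
  \<open>f\<close> has compact support. Off the strip \<open>N2\<close> has no geometric meaning,
  but every point there has a neighbourhood in which \<open>f\<close> vanishes.\<close>

lemma cutoff_identity:
  fixes \<eta> \<eta>' :: "real \<Rightarrow> real"
  assumes f: "C1_gradient f g" and K: "compact K" "\<And>x. x \<notin> K \<Longrightarrow> f x = 0"
    and \<delta>: "0 < \<delta>" "\<And>x. x $ k < \<delta> \<or> T - \<delta> < x $ k \<Longrightarrow> f x = 0"
    and \<eta>: "\<And>t. (\<eta> has_real_derivative \<eta>' t) (at t)" and b: "\<And>t. \<bar>\<eta> t\<bar> \<le> A" "\<And>t. \<bar>\<eta>' t\<bar> \<le> A"
  shows "(\<integral>x. \<eta> (N2 x) * (g x \<bullet> v) + \<eta>' (N2 x) * sflux f v x \<partial>lborel) = 0"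
proof -
  obtain B where B: "B > 0" "\<And>x. \<bar>f x\<bar> \<le> B" "\<And>x. norm (g x) \<le> B" "\<And>x. x \<notin> K \<Longrightarrow> g x = 0"
    using C1_gradient_bounded_support[OF f K] by blast
  obtain \<rho> where \<rho>: "K \<subseteq> ball 0 \<rho>" using compact_imp_bounded[OF K(1)] bounded_subset_ballD by blast
  have sK: "sflux f v x = 0" if "x \<notin> K" for x using K(2)[OF that] by (simp add: sflux_def)
  have "bounded (sflux f v ` K)"
    by (intro compact_imp_bounded compact_continuous_image K(1)
        continuous_on_subset[OF sflux_continuous[OF f \<delta>]]) auto
  then obtain B' where "\<And>x. x \<in> K \<Longrightarrow> \<bar>sflux f v x\<bar> \<le> B'" by (auto simp: bounded_iff)
  then have B': "\<bar>sflux f v x\<bar> \<le> \<bar>B'\<bar>" for x using sK[of x] by (cases "x \<in> K") force+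
  have A0: "0 \<le> A" using b(1)[of 0] by linarith
  let ?O = "{x. x $ k < \<delta>} \<union> {x. T - \<delta> < x $ k}"
  have O: "open ?O" by (intro open_Un open_Collect_less continuous_intros)
  have [measurable]: "\<eta> \<in> borel_measurable borel"
    using \<eta> by (intro borel_measurable_continuous_onI) (meson DERIV_continuous continuous_at_imp_continuous_on)
  have [measurable]: "f \<in> borel_measurable borel"
    by (intro borel_measurable_continuous_onI C1_gradient_continuous[OF f])
  show ?thesis
  proof (rule integral_directional_derivative_zero(2)[where g = "\<lambda>x. \<eta> (N2 x) * f x" and v = v])
    fix x
    show "((\<lambda>t. \<eta> (N2 (x + t *\<^sub>R v)) * f (x + t *\<^sub>R v)) has_real_derivative
       \<eta> (N2 x) * (g x \<bullet> v) + \<eta>' (N2 x) * sflux f v x) (at 0)"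
    proof (cases "x \<in> strip")
      case True
      have e: "(\<eta> has_real_derivative \<eta>' (N2 x)) (at (N2 (x + 0 *\<^sub>R v)))" using \<eta> by simp
      have d: "((\<lambda>t. f (x + t *\<^sub>R v)) has_real_derivative g x \<bullet> v) (at 0)"
        using C1_gradient_line[OF f, of x v 0] by simp
      from DERIV_mult[OF DERIV_chain2[OF e N2_line[OF True]] d]
      show ?thesis by (rule DERIV_cong) (use True in \<open>simp add: sflux_def\<close>)
    next
      case False
      then have xO: "x \<in> ?O" using \<delta>(1) by (auto simp: strip_def)
      have z: "g x = 0" by (rule C1_gradient_eq_0[OF f O xO]) (use \<delta>(2) in auto)
      have "open ((\<lambda>t. x + t *\<^sub>R v) -` ?O)"
        by (intro open_vimage O continuous_intros)
      then have "((\<lambda>t. \<eta> (N2 (x + t *\<^sub>R v)) * f (x + t *\<^sub>R v)) has_real_derivative 0) (at 0)"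
        by (rule DERIV_cong_open[OF DERIV_const[of 0]]) (use xO \<delta>(2) in auto)
      then show ?thesis using z False by (simp add: sflux_def)
    qed
    have "\<bar>g x \<bullet> v\<bar> \<le> B * norm v"
      using Cauchy_Schwarz_ineq2[of "g x" v] mult_right_mono[OF B(3)[of x] norm_ge_zero[of v]] by linarith
    then have "\<bar>\<eta> (N2 x)\<bar> * \<bar>g x \<bullet> v\<bar> \<le> A * (B * norm v)"
      using b A0 by (intro mult_mono) auto
    moreover have "\<bar>\<eta>' (N2 x)\<bar> * \<bar>sflux f v x\<bar> \<le> A * \<bar>B'\<bar>"
      using b B' A0 by (intro mult_mono) auto
    ultimately show "\<bar>\<eta> (N2 x) * (g x \<bullet> v) + \<eta>' (N2 x) * sflux f v x\<bar> \<le> A * (B * norm v) + A * \<bar>B'\<bar>"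
      by (intro order_trans[OF abs_triangle_ineq]) (simp add: abs_mult)
    show "\<bar>\<eta> (N2 x) * f x\<bar> \<le> A * B"
      unfolding abs_mult using b B A0 by (intro mult_mono) auto
    show "\<eta> (N2 x) * f x = 0" if "x \<notin> cball 0 \<rho>"
      using that \<rho> K(2)[of x] by fastforce
  qed measurable
qed

text \<open>The cutoff is piecewise linear in the gauge and falls from 1 to 0 across the shell. As
  it is not C1, \<open>cutoff_identity\<close> is applied to its forward averages, whose derivatives
  are bounded by 1 / \<epsilon> uniformly.\<close>

lemma clamp_shell_identity:
  assumes f: "C1_gradient f g" and K: "compact K" "\<And>x. x \<notin> K \<Longrightarrow> f x = 0"
    and \<delta>: "0 < \<delta>" "\<And>x. x $ k < \<delta> \<or> T - \<delta> < x $ k \<Longrightarrow> f x = 0"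
    and \<epsilon>: "0 < \<epsilon>"
  shows "(\<integral>x. clamp01 ((1 - N2 x) / \<epsilon>) * (g x \<bullet> v) \<partial>lborel)
    = (\<integral>x. indicator (shell \<epsilon>) x * sflux f v x \<partial>lborel) / \<epsilon>"
proof -
  obtain B where B: "B > 0" "\<And>x. \<bar>f x\<bar> \<le> B" "\<And>x. norm (g x) \<le> B" "\<And>x. x \<notin> K \<Longrightarrow> g x = 0"
    using C1_gradient_bounded_support[OF f K] by blast
  obtain \<rho> where \<rho>: "K \<subseteq> ball 0 \<rho>" using compact_imp_bounded[OF K(1)] bounded_subset_ballD by blast
  have sK: "sflux f v x = 0" if "x \<notin> K" for x using K(2)[OF that] by (simp add: sflux_def)
  note sc = sflux_continuous[OF f \<delta>, of v]
  have "bounded (sflux f v ` K)"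
    by (intro compact_imp_bounded compact_continuous_image K(1) continuous_on_subset[OF sc]) auto
  then obtain B' where "\<And>x. x \<in> K \<Longrightarrow> \<bar>sflux f v x\<bar> \<le> B'" by (auto simp: bounded_iff)
  then have B': "\<bar>sflux f v x\<bar> \<le> \<bar>B'\<bar>" for x using sK[of x] by (cases "x \<in> K") force+
  have [measurable]: "g \<in> borel_measurable borel" "sflux f v \<in> borel_measurable borel"
    using f sc by (auto intro: borel_measurable_continuous_onI simp: C1_gradient_def)
  have [measurable]: "clamp01 \<in> borel_measurable borel"
    by (intro borel_measurable_continuous_onI continuous_clamp01)
  have gv: "\<bar>g x \<bullet> v\<bar> \<le> B * norm v" for x
    using Cauchy_Schwarz_ineq2[of "g x" v] mult_right_mono[OF B(3)[of x] norm_ge_zero[of v]] by linarith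
  define c' where "c' t = clamp01 ((1 - t) / \<epsilon>)" for t
  \<comment> \<open>The right derivative of the cutoff: forward difference quotients converge to it
    at every point, kinks included. Accordingly the interval, like \<open>shell\<close>, is closed
    on the left and open on the right.\<close>
  define d' where "d' t = (if 1 - \<epsilon> \<le> t \<and> t < 1 then - (1 / \<epsilon>) else 0)" for t
  have cc: "continuous_on UNIV c'" unfolding c'_def clamp01_def using \<epsilon> by (intro continuous_intros) auto
  have c01: "0 \<le> c' t" "c' t \<le> 1" for t by (auto simp: c'_def clamp01_def)
  define h where "h j = 1 / real (Suc j)" for j
  have h0: "0 < h j" for j by (simp add: h_def)
  have hlim: "h \<longlonglongrightarrow> 0" unfolding h_def using LIMSEQ_inverse_real_of_nat by (simp add: inverse_eq_divide)
  have "\<exists>F. (\<forall>y. (F has_real_derivative (c' (y + h j) - c' y) / h j) (at y)) \<and> (\<forall>y. \<exists>\<xi>\<in>{y..y + h j}. F y = c' \<xi>)" for j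
    by (rule forward_average[OF cc h0[of j]]) blast
  then obtain \<eta> where "\<And>j. (\<forall>y. (\<eta> j has_real_derivative (c' (y + h j) - c' y) / h j) (at y)) \<and> (\<forall>y. \<exists>\<xi>\<in>{y..y + h j}. \<eta> j y = c' \<xi>)"
    using choice[of "\<lambda>j F. (\<forall>y. (F has_real_derivative (c' (y + h j) - c' y) / h j) (at y)) \<and> (\<forall>y. \<exists>\<xi>\<in>{y..y + h j}. F y = c' \<xi>)"]
    by blast
  then have \<eta>: "\<And>j y. (\<eta> j has_real_derivative (c' (y + h j) - c' y) / h j) (at y)"
    and \<eta>2: "\<And>j y. \<exists>\<xi>\<in>{y..y + h j}. \<eta> j y = c' \<xi>" by simp_all
  define \<eta>' where "\<eta>' j y = (c' (y + h j) - c' y) / h j" for j y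
  have clip: "\<bar>c' a - c' b\<bar> \<le> \<bar>a - b\<bar> / \<epsilon>" for a b
  proof -
    have "\<bar>c' a - c' b\<bar> \<le> \<bar>(1 - a) / \<epsilon> - (1 - b) / \<epsilon>\<bar>" unfolding c'_def by (rule clamp01_lipschitz)
    also have "\<dots> = \<bar>a - b\<bar> / \<epsilon>" using \<epsilon> by (simp add: diff_divide_distrib[symmetric] abs_minus_commute)
    finally show ?thesis .
  qed
  have \<eta>'b: "\<bar>\<eta>' j y\<bar> \<le> 1 / \<epsilon>" for j y
  proof -
    have "\<bar>c' (y + h j) - c' y\<bar> \<le> h j * (1 / \<epsilon>)" using clip[of "y + h j" y] h0[of j] by simp
    then show ?thesis using h0[of j] by (simp add: \<eta>'_def pos_divide_le_eq mult.commute)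
  qed
  have \<eta>b: "\<bar>\<eta> j y\<bar> \<le> 1" for j y using \<eta>2[of y j] c01 by auto
  have \<eta>lim: "(\<lambda>j. \<eta> j t) \<longlonglongrightarrow> c' t" for t
  proof (rule LIM_zero_cancel, rule Lim_null_comparison)
    show "\<forall>\<^sub>F j in sequentially. norm (\<eta> j t - c' t) \<le> h j / \<epsilon>"
    proof (rule always_eventually, rule allI)
      fix j obtain \<xi> where "\<xi> \<in> {t..t + h j}" "\<eta> j t = c' \<xi>" using \<eta>2 by blast
      then show "norm (\<eta> j t - c' t) \<le> h j / \<epsilon>"
        using order_trans[OF clip[of \<xi> t], of "h j / \<epsilon>"] h0[of j] \<epsilon> by (simp add: divide_right_mono)
    qed
    show "(\<lambda>j. h j / \<epsilon>) \<longlonglongrightarrow> 0" using tendsto_divide[OF hlim tendsto_const[of \<epsilon>]] \<epsilon> by simp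
  qed
  have \<eta>'lim: "(\<lambda>j. \<eta>' j t) \<longlonglongrightarrow> d' t" for t
  proof -
    \<comment> \<open>The distance from t to the next kink on its right, or 1 beyond the last one;
      shorter steps give the exact slope.\<close>
    define m where "m = (if t < 1 - \<epsilon> then 1 - \<epsilon> - t else if t < 1 then 1 - t else 1)"
    have m: "m > 0" by (auto simp: m_def)
    have "\<forall>\<^sub>F j in sequentially. h j < m" using order_tendstoD(2)[OF hlim m] .
    then have "\<forall>\<^sub>F j in sequentially. \<eta>' j t = d' t"
    proof eventually_elim
      case (elim j)
      consider "t < 1 - \<epsilon>" | "1 - \<epsilon> \<le> t" "t < 1" | "1 \<le> t" by linarith
      then show ?case
      proof cases
        case 1
        then have "c' t = 1" "c' (t + h j) = 1" using elim \<epsilon> h0[of j]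
          by (auto simp: c'_def clamp01_def m_def min_def max_def field_simps)
        then show ?thesis using 1 by (simp add: \<eta>'_def d'_def)
      next
        case 2
        then have e: "c' t = (1 - t) / \<epsilon>" "c' (t + h j) = (1 - (t + h j)) / \<epsilon>" using elim \<epsilon> h0[of j]
          by (auto simp: c'_def clamp01_def m_def min_def max_def field_simps)
        have "(c' (t + h j) - c' t) = - (h j / \<epsilon>)" unfolding e by (simp add: diff_divide_distrib add_divide_distrib)
        then show ?thesis using 2 h0[of j] by (simp add: \<eta>'_def d'_def)
      next
        case 3
        then have "c' t = 0" "c' (t + h j) = 0" using \<epsilon> h0[of j]
          by (auto simp: c'_def clamp01_def min_def max_def field_simps)
        then show ?thesis using 3 by (simp add: \<eta>'_def d'_def)
      qed
    qed
    then show ?thesis by (rule tendsto_eventually)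
  qed
  have [measurable]: "c' \<in> borel_measurable borel" using cc by (rule borel_measurable_continuous_onI)
  have [measurable]: "\<eta> j \<in> borel_measurable borel" for j
    using \<eta> by (intro borel_measurable_continuous_onI) (meson DERIV_continuous continuous_at_imp_continuous_on)
  have [measurable]: "\<eta>' j \<in> borel_measurable borel" for j unfolding \<eta>'_def[abs_def] by measurable
  have [measurable]: "d' \<in> borel_measurable borel" unfolding d'_def[abs_def] by measurable
  have zero: "(\<integral>x. \<eta> j (N2 x) * (g x \<bullet> v) + \<eta>' j (N2 x) * sflux f v x \<partial>lborel) = 0" for j
  proof (rule cutoff_identity[OF f K \<delta>, where A = "max 1 (1 / \<epsilon>)"])
    show "(\<eta> j has_real_derivative \<eta>' j t) (at t)" for t using \<eta> by (simp add: \<eta>'_def)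
    show "\<bar>\<eta> j t\<bar> \<le> max 1 (1 / \<epsilon>)" "\<bar>\<eta>' j t\<bar> \<le> max 1 (1 / \<epsilon>)" for t
      using \<eta>b[of j t] \<eta>'b[of j t] by linarith+
  qed
  have dom: "\<bar>a * (g x \<bullet> v) + b * sflux f v x\<bar> \<le> (B * norm v + 1 / \<epsilon> * \<bar>B'\<bar>) * indicator (cball 0 \<rho>) x"
    if "\<bar>a\<bar> \<le> 1" "\<bar>b\<bar> \<le> 1 / \<epsilon>" for a b x
  proof (cases "x \<in> K")
    case True
    have "\<bar>a\<bar> * \<bar>g x \<bullet> v\<bar> \<le> 1 * (B * norm v)" using that gv by (intro mult_mono) auto
    moreover have "\<bar>b\<bar> * \<bar>sflux f v x\<bar> \<le> 1 / \<epsilon> * \<bar>B'\<bar>" using that B' \<epsilon> by (intro mult_mono) auto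
    moreover have "x \<in> cball 0 \<rho>" using True \<rho> ball_subset_cball by blast
    ultimately show ?thesis
      by (intro order_trans[OF abs_triangle_ineq]) (simp add: abs_mult)
  next
    case False
    then show ?thesis using B sK \<epsilon> by simp
  qed
  have w: "integrable lborel (\<lambda>x::real^'n. (B * norm v + 1 / \<epsilon> * \<bar>B'\<bar>) * indicator (cball 0 \<rho>) x)"
    using emeasure_lborel_cball_finite[of "0::real^'n" \<rho>]
    by (intro integrable_mult_right integrable_real_indicator) auto
  have "(\<lambda>j. (\<integral>x. \<eta> j (N2 x) * (g x \<bullet> v) + \<eta>' j (N2 x) * sflux f v x \<partial>lborel))
     \<longlonglongrightarrow> (\<integral>x. c' (N2 x) * (g x \<bullet> v) + d' (N2 x) * sflux f v x \<partial>lborel)"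
    by (rule integral_dominated_convergence[OF _ _ w])
       (use \<eta>lim \<eta>'lim dom[OF \<eta>b \<eta>'b] in \<open>auto intro!: tendsto_intros\<close>)
  then have z: "(\<integral>x. c' (N2 x) * (g x \<bullet> v) + d' (N2 x) * sflux f v x \<partial>lborel) = 0"
    unfolding zero by (simp add: LIMSEQ_const_iff)
  have db: "\<bar>d' t\<bar> \<le> 1 / \<epsilon>" for t using \<epsilon> by (simp add: d'_def)
  have i1: "integrable lborel (\<lambda>x. c' (N2 x) * (g x \<bullet> v))"
    using dom[of "c' (N2 _)" 0] c01 \<epsilon>
    by (intro Bochner_Integration.integrable_bound[OF w]) (auto intro!: AE_I2 order_trans[OF dom[of "c' (N2 _)" 0, simplified] abs_ge_self])
  have i2: "integrable lborel (\<lambda>x. d' (N2 x) * sflux f v x)"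
    using db \<epsilon>
    by (intro Bochner_Integration.integrable_bound[OF w]) (auto intro!: AE_I2 order_trans[OF dom[of 0 "d' (N2 _)", simplified] abs_ge_self])
  have "(\<integral>x. c' (N2 x) * (g x \<bullet> v) \<partial>lborel) = - (\<integral>x. d' (N2 x) * sflux f v x \<partial>lborel)"
    using z i1 i2 by simp
  also have "\<dots> = (\<integral>x. - (d' (N2 x) * sflux f v x) \<partial>lborel)" by simp
  also have "\<dots> = (\<integral>x. indicator (shell \<epsilon>) x * sflux f v x / \<epsilon> \<partial>lborel)"
    by (intro Bochner_Integration.integral_cong) (auto simp: d'_def shell_def indicator_def sflux_def)
  finally show ?thesis by (simp add: c'_def)
qed

text \<open>As \<epsilon> tends to 0 the cutoff tends to the indicator of the open body. On the
  other side (n - 1) / 2 from \<open>shell_limit\<close> times 2 / (Q P) from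
  \<open>dN2_rproj\<close> is the weight \<open>dens\<close>.\<close>

lemma strip_gauss_green:
  assumes f: "C1_gradient f g" and K: "compact K" "\<And>x. x \<notin> K \<Longrightarrow> f x = 0"
    and \<delta>: "0 < \<delta>" "\<And>x. x $ k < \<delta> \<or> T - \<delta> < x $ k \<Longrightarrow> f x = 0"
  shows "(\<integral>x. indicator body x * (g x \<bullet> v) \<partial>lborel)
    = (\<integral>x. dens x * (f (rproj x) * (normal (rproj x) \<bullet> v)) \<partial>lborel)"
proof -
  define e where "e j = 1 / real (Suc j)" for j
  have e0: "0 < e j" for j by (simp add: e_def)
  have elim: "e \<longlonglongrightarrow> 0" unfolding e_def using LIMSEQ_inverse_real_of_nat by (simp add: inverse_eq_divide)
  have er: "filterlim e (at_right 0) sequentially"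
  proof -
    have "e j \<noteq> 0" for j using e0[of j] by simp
    then show ?thesis unfolding filterlim_at using elim e0 by auto
  qed
  obtain B where B: "B > 0" "\<And>x. \<bar>f x\<bar> \<le> B" "\<And>x. norm (g x) \<le> B" "\<And>x. x \<notin> K \<Longrightarrow> g x = 0"
    using C1_gradient_bounded_support[OF f K] by blast
  obtain \<rho> where \<rho>: "K \<subseteq> ball 0 \<rho>" using compact_imp_bounded[OF K(1)] bounded_subset_ballD by blast
  have [measurable]: "g \<in> borel_measurable borel"
    using f by (auto intro: borel_measurable_continuous_onI simp: C1_gradient_def)
  have [measurable]: "clamp01 \<in> borel_measurable borel"
    by (intro borel_measurable_continuous_onI continuous_clamp01)
  have gv: "\<bar>g x \<bullet> v\<bar> \<le> B * norm v" for x
    using Cauchy_Schwarz_ineq2[of "g x" v] mult_right_mono[OF B(3)[of x] norm_ge_zero[of v]] by linarith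
  have gK: "g x = 0" if "x \<notin> cball 0 \<rho>" for x
  proof -
    have "x \<notin> K" using that \<rho> ball_subset_cball by blast
    then show ?thesis by (rule B(4))
  qed
  have iD: "integrable lborel (\<lambda>x. \<bar>g x \<bullet> v\<bar>)"
    by (rule integrable_bounded_support[where B = "B * norm v" and \<rho> = \<rho>]) (use gv gK in \<open>auto\<close>)
  let ?O = "{x. x $ k < \<delta>} \<union> {x. T - \<delta> < x $ k}"
  have O: "open ?O" by (intro open_Un open_Collect_less continuous_intros)
  have g0: "g x = 0" if "x \<notin> strip" for x
  proof -
    have "x \<in> ?O" using that \<delta>(1) by (auto simp: strip_def)
    then show ?thesis by (rule C1_gradient_eq_0[OF f O]) (use \<delta>(2) in auto)
  qed
  have L: "(\<lambda>j. \<integral>x. clamp01 ((1 - N2 x) / e j) * (g x \<bullet> v) \<partial>lborel) \<longlonglongrightarrow> (\<integral>x. indicator body x * (g x \<bullet> v) \<partial>lborel)"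
  proof (rule integral_dominated_convergence[OF _ _ iD])
    show "AE x in lborel. (\<lambda>j. clamp01 ((1 - N2 x) / e j) * (g x \<bullet> v)) \<longlonglongrightarrow> indicator body x * (g x \<bullet> v)"
    proof (rule AE_I2)
      fix x
      show "(\<lambda>j. clamp01 ((1 - N2 x) / e j) * (g x \<bullet> v)) \<longlonglongrightarrow> indicator body x * (g x \<bullet> v)"
      proof (cases "x \<in> strip")
        case True
        have "(\<lambda>j. clamp01 ((1 - N2 x) / e j)) \<longlonglongrightarrow> indicator body x"
        proof (cases "N2 x < 1")
          case lt: True
          have "\<forall>\<^sub>F j in sequentially. e j < 1 - N2 x" using order_tendstoD(2)[OF elim, of "1 - N2 x"] lt by simp
          then have "\<forall>\<^sub>F j in sequentially. clamp01 ((1 - N2 x) / e j) = 1"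
          proof eventually_elim
            case (elim j)
            then have "1 \<le> (1 - N2 x) / e j" using e0[of j] by simp
            then show ?case by (simp add: clamp01_def)
          qed
          then show ?thesis using True lt by (simp add: body_N2 tendsto_eventually)
        next
          case False
          then have "(1 - N2 x) / e j \<le> 0" for j using e0[of j] by (simp add: divide_nonpos_pos)
          moreover have "clamp01 t = 0" if "t \<le> 0" for t using that by (simp add: clamp01_def)
          ultimately have "clamp01 ((1 - N2 x) / e j) = 0" for j by blast
          then show ?thesis using False by (simp add: body_N2)
        qed
        then show ?thesis by (intro tendsto_mult tendsto_const)
      next
        case False
        then show ?thesis using g0 by simp
      qed
    qed
    show "AE x in lborel. norm (clamp01 ((1 - N2 x) / e j) * (g x \<bullet> v)) \<le> \<bar>g x \<bullet> v\<bar>" for j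
      by (intro AE_I2) (auto simp: abs_mult clamp01_def intro!: mult_left_le_one_le)
  qed measurable
  have sK: "sflux f v x = 0" if "x \<notin> K" for x using K(2)[OF that] by (simp add: sflux_def)
  have Rr: "(\<lambda>j. (\<integral>x. indicator (shell (e j)) x * sflux f v x \<partial>lborel) / e j) \<longlonglongrightarrow>
     real (CARD('n) - 1) / 2 * (\<integral>x. indicator core x * sflux f v (rproj x) \<partial>lborel)"
    by (rule filterlim_compose[OF shell_limit[OF sflux_continuous[OF f \<delta>] K(1) sK] er])
  have "(\<integral>x. indicator body x * (g x \<bullet> v) \<partial>lborel) = real (CARD('n) - 1) / 2 * (\<integral>x. indicator core x * sflux f v (rproj x) \<partial>lborel)"
  proof (rule LIMSEQ_unique[OF L])
    have "(\<integral>x. clamp01 ((1 - N2 x) / e j) * (g x \<bullet> v) \<partial>lborel)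
        = (\<integral>x. indicator (shell (e j)) x * sflux f v x \<partial>lborel) / e j" for j
      by (rule clamp_shell_identity[OF f K \<delta> e0])
    then show "(\<lambda>j. \<integral>x. clamp01 ((1 - N2 x) / e j) * (g x \<bullet> v) \<partial>lborel) \<longlonglongrightarrow>
        real (CARD('n) - 1) / 2 * (\<integral>x. indicator core x * sflux f v (rproj x) \<partial>lborel)"
      using Rr by (simp only:)
  qed
  also have "\<dots> = (\<integral>x. real (CARD('n) - 1) / 2 * (indicator core x * sflux f v (rproj x)) \<partial>lborel)" by simp
  also have "\<dots> = (\<integral>x. dens x * (f (rproj x) * (normal (rproj x) \<bullet> v)) \<partial>lborel)"
  proof (intro Bochner_Integration.integral_cong refl)
    fix x
    show "real (CARD('n) - 1) / 2 * (indicator core x * sflux f v (rproj x)) = dens x * (f (rproj x) * (normal (rproj x) \<bullet> v))"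
    proof (cases "x \<in> core")
      case True
      then have "0 < normp k x" "x \<in> strip" using core_strip by auto
      from dN2_rproj[OF this, of v] this True show ?thesis
        by (simp add: dens_def sflux_def strip_def rproj_nth)
    qed (simp add: dens_def)
  qed
  finally show ?thesis .
qed

text \<open>A cutoff in the height near the tip or the top has a derivative of order 1 / y or 1 / (T
  - y); the linear bounds dominate it by a multiple of 1 / Q, which is integrable over the
  body.\<close>

lemma Q_le_linear: assumes "0 < y" "y < T"
  shows "Q y \<le> R\<^sup>2 * y" "Q y \<le> 2 * R * (T - y)"
proof -
  have T2: "2 \<le> T" using R_gt_1 s_gt_half by (simp add: T_def c_def)
  show "Q y \<le> R\<^sup>2 * y"
  proof (cases "y < 1")
    case True
    have "Q y = y powr (2 * s)" using True assms by (simp add: Q_lower)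
    also have "\<dots> \<le> y powr 1" using True assms s_gt_half by (intro powr_mono') auto
    also have "\<dots> \<le> R\<^sup>2 * y" using assms by (simp add: R_sq algebra_simps)
    finally show ?thesis .
  next
    case False
    then have "R\<^sup>2 * 1 \<le> R\<^sup>2 * y" by (intro mult_left_mono) auto
    then show ?thesis using Q_le_R2[of y] by simp
  qed
  show "Q y \<le> 2 * R * (T - y)"
  proof (cases "y < 1")
    case True
    have "Q y = y powr (2 * s)" using True assms by (simp add: Q_lower)
    also have "\<dots> \<le> 1 powr (2 * s)" using True assms s_pos by (intro powr_mono2) auto
    also have "\<dots> \<le> 1 * (T - y)" using True T2 by simp
    also have "\<dots> \<le> 2 * R * (T - y)" using R_gt_1 assms by (intro mult_right_mono) auto
    finally show ?thesis .
  next
    case False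
    have "Q y = (T - y) * (y - (c - R))" using False by (simp add: Q_upper)
    also have "\<dots> \<le> (T - y) * (2 * R)" using assms by (intro mult_left_mono) (auto simp: T_def)
    finally show ?thesis by (simp add: mult.commute)
  qed
qed

lemma integrable_inverse_Q: "integrable lborel (\<lambda>x. indicator body x * (1 / Q (x $ k)) :: real)"
proof (rule integrableI_nonneg)
  show "AE x in lborel. 0 \<le> indicator body x * (1 / Q (x $ k))"
    using body_nth Q_pos by (auto simp: indicator_def less_imp_le)
  have "(\<integral>\<^sup>+x. ennreal (indicator body x * (1 / Q (x $ k))) \<partial>lborel) = (\<integral>\<^sup>+x. indicator body x * ennreal (1 / Q (x $ k)) \<partial>lborel)"
    by (intro nn_integral_cong) (auto simp: indicator_def)
  then show "(\<integral>\<^sup>+x. ennreal (indicator body x * (1 / Q (x $ k))) \<partial>lborel) < \<infinity>"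
    using nn_integral_inverse_Q_finite by simp
qed measurable

lemma dens_nonneg: "0 \<le> dens x"
  using body_nth[of x] Q_pos[of "x $ k"] P_pos[of "x $ k"] by (auto simp: dens_def indicator_def core_def)

lemma dens_le: "dens x \<le> real (CARD('n) - 1) * R * (indicator body x * (1 / Q (x $ k)))"
proof (cases "x \<in> core")
  case True
  then have b: "x \<in> body" by (simp add: core_def)
  have q: "0 < Q (x $ k)" and p: "1 / R \<le> P (x $ k)" using body_nth[OF b] Q_pos P_ge by auto
  have "1 / P (x $ k) \<le> R" using p R_pos P_pos[of "x $ k"] body_nth[OF b] by (simp add: field_simps)
  then have "real (CARD('n) - 1) / Q (x $ k) * (1 / P (x $ k)) \<le> real (CARD('n) - 1) / Q (x $ k) * R"
    using q by (intro mult_left_mono) auto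
  then show ?thesis using True b by (simp add: dens_def mult_ac)
next
  case False
  then show ?thesis using body_nth[of x] Q_pos[of "x $ k"] R_pos by (auto simp: dens_def indicator_def)
qed

lemma integrable_dens_times:
  fixes F :: "real^'n \<Rightarrow> real"
  assumes [measurable]: "F \<in> borel_measurable borel" and B: "\<And>x. x \<in> core \<Longrightarrow> \<bar>F x\<bar> \<le> B"
  shows "integrable lborel (\<lambda>x. dens x * F x)"
proof (rule Bochner_Integration.integrable_bound)
  show "integrable lborel (\<lambda>x. B * (real (CARD('n) - 1) * R * (indicator body x * (1 / Q (x $ k)))))"
    by (intro integrable_mult_right integrable_inverse_Q)
  show "AE x in lborel. norm (dens x * F x) \<le> norm (B * (real (CARD('n) - 1) * R * (indicator body x * (1 / Q (x $ k)))))"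
  proof (rule AE_I2)
    fix x
    show "norm (dens x * F x) \<le> norm (B * (real (CARD('n) - 1) * R * (indicator body x * (1 / Q (x $ k)))))"
    proof (cases "x \<in> core")
      case True
      have "norm (dens x * F x) = dens x * \<bar>F x\<bar>" using dens_nonneg[of x] by (simp add: abs_mult)
      also have "\<dots> \<le> (real (CARD('n) - 1) * R * (indicator body x * (1 / Q (x $ k)))) * B"
        using B[OF True] dens_le[of x] dens_nonneg[of x] by (intro mult_mono) auto
      also have "\<dots> \<le> norm (B * (real (CARD('n) - 1) * R * (indicator body x * (1 / Q (x $ k)))))"
        by (metis abs_ge_self mult.commute real_norm_def)
      finally show ?thesis .
    qed (simp add: dens_def)
  qed
qed measurable

text \<open>Removes the condition that \<open>f\<close> vanish near the heights 0 and
  \<open>T\<close>. The height cutoff is 1 beyond distance 3 d_j from both; its derivative has size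
  1 / d_j and lives where such a distance is below 3 d_j, so it is at most a constant over
  \<open>Q\<close>, uniformly in j. Dominated convergence then eliminates the extra term.\<close>

lemma scalar_gauss_green:
  assumes f: "C1_gradient f g" and K: "compact K" "\<And>x. x \<notin> K \<Longrightarrow> f x = 0"
  shows "(\<integral>x. indicator body x * (g x \<bullet> v) \<partial>lborel)
    = (\<integral>x. dens x * (f (rproj x) * (normal (rproj x) \<bullet> v)) \<partial>lborel)"
proof -
  obtain \<xi> \<xi>' :: "real \<Rightarrow> real" where \<xi>:
    "\<And>y. (\<xi> has_real_derivative \<xi>' y) (at y)" "continuous_on UNIV \<xi>'"
    "\<And>y. 0 \<le> \<xi> y" "\<And>y. \<xi> y \<le> 1" "\<And>y. y \<le> 1 \<Longrightarrow> \<xi> y = 0" "\<And>y. y \<ge> 3 \<Longrightarrow> \<xi> y = 1"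
    "\<And>y. \<bar>\<xi>' y\<bar> \<le> 1" "\<And>y. y \<ge> 3 \<Longrightarrow> \<xi>' y = 0"
    using smooth_step by blast
  have c\<xi>: "continuous_on UNIV \<xi>"
    using \<xi>(1) by (meson DERIV_continuous continuous_at_imp_continuous_on)
  obtain B where B: "B > 0" "\<And>x. \<bar>f x\<bar> \<le> B" "\<And>x. norm (g x) \<le> B" "\<And>x. x \<notin> K \<Longrightarrow> g x = 0"
    using C1_gradient_bounded_support[OF f K] by blast
  have [measurable]: "g \<in> borel_measurable borel" "f \<in> borel_measurable borel"
    using f C1_gradient_continuous[OF f] by (auto intro: borel_measurable_continuous_onI simp: C1_gradient_def)
  have gv: "\<bar>g x \<bullet> v\<bar> \<le> B * norm v" for x
    using Cauchy_Schwarz_ineq2[of "g x" v] mult_right_mono[OF B(3)[of x] norm_ge_zero[of v]] by linarith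
  have vk: "\<bar>v $ k\<bar> \<le> norm v" by (rule component_le_norm_cart)
  define d where "d j = 1 / real (Suc j)" for j
  have d0: "0 < d j" for j by (simp add: d_def)
  have dlim: "d \<longlonglongrightarrow> 0" unfolding d_def using LIMSEQ_inverse_real_of_nat by (simp add: inverse_eq_divide)
  define \<psi> where "\<psi> j y = \<xi> (y / d j) * \<xi> ((T - y) / d j)" for j y
  define \<psi>' where "\<psi>' j y = \<xi>' (y / d j) / d j * \<xi> ((T - y) / d j) - \<xi> (y / d j) * (\<xi>' ((T - y) / d j) / d j)" for j y
  have D\<psi>: "(\<psi> j has_real_derivative \<psi>' j y) (at y)" for j y
  proof -
    have a: "((\<lambda>y. y / d j) has_real_derivative 1 / d j) (at y)"
      using d0[of j] by (auto intro!: derivative_eq_intros)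
    have b: "((\<lambda>y. (T - y) / d j) has_real_derivative - 1 / d j) (at y)"
      using d0[of j] by (auto intro!: derivative_eq_intros)
    show ?thesis unfolding \<psi>_def[abs_def]
      by (rule DERIV_cong[OF DERIV_mult[OF DERIV_chain2[OF \<xi>(1) a] DERIV_chain2[OF \<xi>(1) b]]])
        (simp add: \<psi>'_def)
  qed
  have c\<psi>': "continuous_on UNIV (\<psi>' j)" for j
    unfolding \<psi>'_def[abs_def] using d0[of j]
    by (intro continuous_intros continuous_on_compose2[OF \<xi>(2)] continuous_on_compose2[OF c\<xi>]) auto
  have c\<psi>: "continuous_on UNIV (\<psi> j)" for j
    using D\<psi> by (meson DERIV_continuous continuous_at_imp_continuous_on)
  have [measurable]: "\<psi> j \<in> borel_measurable borel" "\<psi>' j \<in> borel_measurable borel" for j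
    by (rule borel_measurable_continuous_onI, rule c\<psi> c\<psi>')+
  have \<psi>01: "0 \<le> \<psi> j y" "\<psi> j y \<le> 1" for j y using \<xi>(3,4) by (auto simp: \<psi>_def intro: mult_le_one)
  define F where "F j x = f x * \<psi> j (x $ k)" for j x
  define G where "G j x = f x *\<^sub>R (\<psi>' j (x $ k) *\<^sub>R axis k 1) + \<psi> j (x $ k) *\<^sub>R g x" for j x
  have FG: "C1_gradient (F j) (G j)" for j
    unfolding F_def[abs_def] G_def[abs_def]
    by (intro C1_gradient_mult f C1_gradient_compose'[OF C1_gradient_coord D\<psi> c\<psi>'])
  have id: "(\<integral>x. indicator body x * (G j x \<bullet> v) \<partial>lborel)
    = (\<integral>x. dens x * (F j (rproj x) * (normal (rproj x) \<bullet> v)) \<partial>lborel)" for j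
  proof (rule strip_gauss_green[OF FG K(1) _ d0[of j]])
    show "F j x = 0" if "x \<notin> K" for x using K(2)[OF that] by (simp add: F_def)
    show "F j x = 0" if "x $ k < d j \<or> T - d j < x $ k" for x
    proof -
      have "x $ k / d j \<le> 1 \<or> (T - x $ k) / d j \<le> 1" using that d0[of j] by (auto simp: divide_le_eq)
      then show ?thesis using \<xi>(5) by (auto simp: F_def \<psi>_def)
    qed
  qed
  have ev: "\<forall>\<^sub>F j in sequentially. \<psi> j y = 1 \<and> \<psi>' j y = 0" if y: "0 < y" "y < T" for y
  proof -
    have "\<forall>\<^sub>F j in sequentially. d j < min (y / 3) ((T - y) / 3)"
      using y by (intro order_tendstoD(2)[OF dlim]) auto
    then show ?thesis
    proof eventually_elim
      case (elim j)
      then have "3 \<le> y / d j" "3 \<le> (T - y) / d j" using d0[of j] by (auto simp: le_divide_eq)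
      then show ?case using \<xi>(6,8) by (simp add: \<psi>_def \<psi>'_def)
    qed
  qed
  have \<psi>'b: "\<bar>\<psi>' j y\<bar> \<le> (3 * R\<^sup>2 + 6 * R) / Q y" if y: "0 < y" "y < T" for j y
  proof -
    have q: "0 < Q y" using Q_pos y by blast
    have *: "\<bar>\<xi>' (t / d j)\<bar> / d j \<le> 3 / t" if "0 < t" for t
    proof (cases "3 \<le> t / d j")
      case True
      then show ?thesis using \<xi>(8) that by simp
    next
      case False
      then have "1 / d j \<le> 3 / t" using d0[of j] that by (simp add: field_simps)
      moreover have "\<bar>\<xi>' (t / d j)\<bar> / d j \<le> 1 / d j" using \<xi>(7) d0[of j] by (intro divide_right_mono) auto
      ultimately show ?thesis by linarith
    qed
    have "\<bar>\<psi>' j y\<bar> \<le> \<bar>\<xi>' (y / d j) / d j * \<xi> ((T - y) / d j)\<bar> + \<bar>\<xi> (y / d j) * (\<xi>' ((T - y) / d j) / d j)\<bar>"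
      unfolding \<psi>'_def by (rule abs_triangle_ineq4)
    also have "\<dots> \<le> \<bar>\<xi>' (y / d j)\<bar> / d j * 1 + 1 * (\<bar>\<xi>' ((T - y) / d j)\<bar> / d j)"
      unfolding abs_mult using \<xi>(3,4) d0[of j] by (intro add_mono mult_mono) auto
    also have "\<dots> \<le> 3 / y + 3 / (T - y)" using *[of y] *[of "T - y"] y by simp
    also have "\<dots> \<le> 3 * R\<^sup>2 / Q y + 3 * (2 * R) / Q y"
    proof (intro add_mono)
      show "3 / y \<le> 3 * R\<^sup>2 / Q y" using Q_le_linear(1)[OF y] y q by (simp add: field_simps)
      show "3 / (T - y) \<le> 3 * (2 * R) / Q y" using Q_le_linear(2)[OF y] y q by (simp add: field_simps)
    qed
    finally show ?thesis by (simp add: add_divide_distrib)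
  qed
  define C where "C = B * norm v * (3 * R\<^sup>2 + 6 * R) + B * norm v * R\<^sup>2"
  have w: "integrable lborel (\<lambda>x. C * (indicator body x * (1 / Q (x $ k))))"
    by (intro integrable_mult_right integrable_inverse_Q)
  have L: "(\<lambda>j. \<integral>x. indicator body x * (G j x \<bullet> v) \<partial>lborel) \<longlonglongrightarrow> (\<integral>x. indicator body x * (g x \<bullet> v) \<partial>lborel)"
  proof (rule integral_dominated_convergence[OF _ _ w])
    show "AE x in lborel. (\<lambda>j. indicator body x * (G j x \<bullet> v)) \<longlonglongrightarrow> indicator body x * (g x \<bullet> v)"
    proof (rule AE_I2)
      fix x show "(\<lambda>j. indicator body x * (G j x \<bullet> v)) \<longlonglongrightarrow> indicator body x * (g x \<bullet> v)"
      proof (cases "x \<in> body")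
        case True
        have "\<forall>\<^sub>F j in sequentially. \<psi> j (x $ k) = 1 \<and> \<psi>' j (x $ k) = 0"
          using ev body_nth[OF True] by blast
        then have "\<forall>\<^sub>F j in sequentially. indicator body x * (G j x \<bullet> v) = indicator body x * (g x \<bullet> v)"
          by eventually_elim (simp add: G_def)
        then show ?thesis by (rule tendsto_eventually)
      qed simp
    qed
    show "AE x in lborel. norm (indicator body x * (G j x \<bullet> v)) \<le> C * (indicator body x * (1 / Q (x $ k)))" for j
    proof (rule AE_I2)
      fix x show "norm (indicator body x * (G j x \<bullet> v)) \<le> C * (indicator body x * (1 / Q (x $ k)))"
      proof (cases "x \<in> body")
        case True
        have y: "0 < x $ k" "x $ k < T" using body_nth[OF True] by auto
        have q: "0 < Q (x $ k)" using Q_pos y by blast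
        have "G j x \<bullet> v = f x * \<psi>' j (x $ k) * v $ k + \<psi> j (x $ k) * (g x \<bullet> v)"
          by (simp add: G_def inner_add_left inner_axis')
        then have "\<bar>G j x \<bullet> v\<bar> \<le> \<bar>f x\<bar> * \<bar>\<psi>' j (x $ k)\<bar> * \<bar>v $ k\<bar> + \<bar>\<psi> j (x $ k)\<bar> * \<bar>g x \<bullet> v\<bar>"
          using abs_triangle_ineq[of "f x * \<psi>' j (x $ k) * v $ k" "\<psi> j (x $ k) * (g x \<bullet> v)"]
          by (simp add: abs_mult)
        also have "\<dots> \<le> B * ((3 * R\<^sup>2 + 6 * R) / Q (x $ k)) * norm v + 1 * (B * norm v)"
          using B(1,2) \<psi>'b[OF y] vk \<psi>01 gv q R_pos by (intro add_mono mult_mono) auto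
        also have "\<dots> \<le> B * ((3 * R\<^sup>2 + 6 * R) / Q (x $ k)) * norm v + (B * norm v) * (R\<^sup>2 / Q (x $ k))"
        proof -
          have "1 \<le> R\<^sup>2 / Q (x $ k)" using q Q_le_R2[of "x $ k"] by simp
          then have "(B * norm v) * 1 \<le> (B * norm v) * (R\<^sup>2 / Q (x $ k))" using B(1) by (intro mult_left_mono) auto
          then show ?thesis by simp
        qed
        also have "\<dots> = C / Q (x $ k)" using q by (simp add: C_def field_simps)
        finally show ?thesis using True by simp
      qed simp
    qed
  qed (unfold G_def, measurable)
  have ndb: "\<bar>f (rproj x) * (normal (rproj x) \<bullet> v)\<bar> \<le> B * norm v" if "x \<in> core" for x
  proof -
    have "norm (normal (rproj x)) = 1" using core_strip[OF that] by (intro norm_normal rproj_surf) auto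
    then have "\<bar>normal (rproj x) \<bullet> v\<bar> \<le> norm v" using Cauchy_Schwarz_ineq2[of "normal (rproj x)" v] by simp
    then show ?thesis unfolding abs_mult using B(1,2) by (intro mult_mono) auto
  qed
  have w2: "integrable lborel (\<lambda>x. dens x * (B * norm v))" by (rule integrable_dens_times) auto
  have Rr: "(\<lambda>j. \<integral>x. dens x * (F j (rproj x) * (normal (rproj x) \<bullet> v)) \<partial>lborel)
     \<longlonglongrightarrow> (\<integral>x. dens x * (f (rproj x) * (normal (rproj x) \<bullet> v)) \<partial>lborel)"
  proof (rule integral_dominated_convergence[OF _ _ w2])
    show "AE x in lborel. (\<lambda>j. dens x * (F j (rproj x) * (normal (rproj x) \<bullet> v)))
        \<longlonglongrightarrow> dens x * (f (rproj x) * (normal (rproj x) \<bullet> v))"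
    proof (rule AE_I2)
      fix x show "(\<lambda>j. dens x * (F j (rproj x) * (normal (rproj x) \<bullet> v)))
        \<longlonglongrightarrow> dens x * (f (rproj x) * (normal (rproj x) \<bullet> v))"
      proof (cases "x \<in> core")
        case True
        have "\<forall>\<^sub>F j in sequentially. \<psi> j (x $ k) = 1 \<and> \<psi>' j (x $ k) = 0"
          using ev core_strip[OF True] unfolding strip_def by blast
        then have "\<forall>\<^sub>F j in sequentially. dens x * (F j (rproj x) * (normal (rproj x) \<bullet> v)) = dens x * (f (rproj x) * (normal (rproj x) \<bullet> v))"
          by eventually_elim (simp add: F_def rproj_nth)
        then show ?thesis by (rule tendsto_eventually)
      qed (simp add: dens_def)
    qed
    show "AE x in lborel. norm (dens x * (F j (rproj x) * (normal (rproj x) \<bullet> v))) \<le> dens x * (B * norm v)" for j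
    proof (rule AE_I2)
      fix x show "norm (dens x * (F j (rproj x) * (normal (rproj x) \<bullet> v))) \<le> dens x * (B * norm v)"
      proof (cases "x \<in> core")
        case True
        have "\<bar>F j (rproj x) * (normal (rproj x) \<bullet> v)\<bar> = \<psi> j (x $ k) * \<bar>f (rproj x) * (normal (rproj x) \<bullet> v)\<bar>"
          using \<psi>01[of j "x $ k"] by (simp add: F_def rproj_nth abs_mult)
        also have "\<dots> \<le> 1 * (B * norm v)" using \<psi>01 ndb[OF True] by (intro mult_mono) auto
        finally show ?thesis using dens_nonneg[of x] by (simp add: abs_mult mult_left_mono)
      qed (simp add: dens_def)
    qed
  qed (unfold F_def, measurable)
  show ?thesis using LIMSEQ_unique[OF L Rr[folded id]] .
qed

section \<open>The surface measure and the vector formula\<close>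

definition surface_measure :: "(real^'n) measure" where
  "surface_measure = distr (density lborel (\<lambda>x. ennreal (dens x))) borel rproj"

text \<open>\<open>gauss_green\<close> asks for a density of norm 1 at every point; off the surface,
  which carries the whole measure, a fixed unit vector is chosen.\<close>

definition nu :: "real^'n \<Rightarrow> real^'n" where
  "nu x = (if x \<in> surf then normal x else axis k 1)"

lemma borel_surf[measurable]: "surf \<in> sets borel"
  using closed_surf by simp

lemma borel_nu[measurable]: "nu \<in> borel_measurable borel"
  unfolding nu_def[abs_def] by measurable

lemma norm_nu: "norm (nu x) = 1"
  by (simp add: nu_def norm_normal)

lemma nu_rproj: "x \<in> core \<Longrightarrow> nu (rproj x) = normal (rproj x)"
  using core_strip[of x] rproj_surf[of x] by (simp add: nu_def)

lemma sets_surface_measure[measurable_cong]: "sets surface_measure = sets borel"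
  by (simp add: surface_measure_def)

lemma space_surface_measure[simp]: "space surface_measure = UNIV"
  by (simp add: surface_measure_def)

lemma integrable_surface_measure:
  fixes F :: "real^'n \<Rightarrow> real"
  assumes [measurable]: "F \<in> borel_measurable borel"
  shows "integrable surface_measure F \<longleftrightarrow> integrable lborel (\<lambda>x. dens x * F (rproj x))"
  unfolding surface_measure_def
  by (subst integrable_distr_eq) (auto simp: integrable_density dens_nonneg)

lemma integral_surface_measure:
  fixes F :: "real^'n \<Rightarrow> real"
  assumes [measurable]: "F \<in> borel_measurable borel"
  shows "(\<integral>x. F x \<partial>surface_measure) = (\<integral>x. dens x * F (rproj x) \<partial>lborel)"
  unfolding surface_measure_def
  by (subst integral_distr) (auto simp: integral_density dens_nonneg)

lemma finite_surface_measure: "finite_measure surface_measure"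
proof
  have "integrable lborel (\<lambda>x. dens x * 1)" by (rule integrable_dens_times) auto
  then have "(\<integral>\<^sup>+x. ennreal (dens x) \<partial>lborel) < \<infinity>"
    using dens_nonneg by (simp add: integrable_iff_bounded)
  then show "emeasure surface_measure (space surface_measure) \<noteq> \<infinity>"
    by (simp add: surface_measure_def emeasure_distr emeasure_density)
qed

sublocale surf: finite_measure surface_measure by (rule finite_surface_measure)

lemma AE_surface_measure: "AE x in surface_measure. x \<in> surf"
proof -
  have "AE x in lborel. 0 < ennreal (dens x) \<longrightarrow> rproj x \<in> surf"
    by (rule AE_I2) (use core_strip rproj_surf in \<open>auto simp: dens_def indicator_def split: if_splits\<close>)
  then have "AE x in density lborel (\<lambda>x. ennreal (dens x)). rproj x \<in> surf"
    by (subst AE_density) auto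
  then show ?thesis unfolding surface_measure_def
    by (subst AE_distr_iff) (auto simp: measurable_distr_eq1)
qed

lemma set_lebesgue_integral_lborel:
  fixes F :: "real^'n \<Rightarrow> real"
  assumes [measurable]: "F \<in> borel_measurable borel" "A \<in> sets borel"
  shows "set_lebesgue_integral lebesgue A F = (\<integral>x. indicator A x * F x \<partial>lborel)"
  unfolding set_lebesgue_integral_def by (subst integral_completion) auto

text \<open>The scalar formula for the i-th component in the i-th coordinate direction, summed over
  i.\<close>

lemma vector_gauss_green:
  assumes \<phi>: "c1c UNIV \<phi>"
  shows "integrable surface_measure (\<lambda>x. \<phi> x \<bullet> nu x)"
    and "set_lebesgue_integral lebesgue body (divg \<phi>) = (\<integral>x. \<phi> x \<bullet> nu x \<partial>surface_measure)"
proof -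
  obtain g K where g: "\<And>i. C1_gradient (\<lambda>x. \<phi> x $ i) (g i)" and K: "compact K" "\<And>x. x \<notin> K \<Longrightarrow> \<phi> x = 0"
    using c1cD[OF \<phi>] by metis
  have cg: "continuous_on UNIV (g i)" for i using g[of i] by (simp add: C1_gradient_def)
  have [measurable]: "g i \<in> borel_measurable borel" for i
    by (intro borel_measurable_continuous_onI cg)
  have \<phi>c: "continuous_on UNIV \<phi>"
    using C1_gradient_continuous[OF g] by (subst continuous_on_componentwise) (auto simp: Basis_vec_def inner_axis)
  then have [measurable]: "\<phi> \<in> borel_measurable borel" by (rule borel_measurable_continuous_onI)
  have "bounded (\<phi> ` K)"
    using \<phi>c K by (intro compact_imp_bounded compact_continuous_image) (auto intro: continuous_on_subset)
  then obtain B where "\<And>x. x \<in> K \<Longrightarrow> norm (\<phi> x) \<le> B" by (auto simp: bounded_iff)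
  then have B: "norm (\<phi> x) \<le> \<bar>B\<bar>" for x using K(2)[of x] by (cases "x \<in> K") force+
  have Bn: "\<bar>\<phi> x \<bullet> nu x\<bar> \<le> \<bar>B\<bar>" for x
    using Cauchy_Schwarz_ineq2[of "\<phi> x" "nu x"] B[of x] by (simp add: norm_nu)
  show "integrable surface_measure (\<lambda>x. \<phi> x \<bullet> nu x)"
  proof (subst integrable_surface_measure)
    show "integrable lborel (\<lambda>x. dens x * (\<phi> (rproj x) \<bullet> nu (rproj x)))"
      by (rule integrable_dens_times[where B = "\<bar>B\<bar>"]) (use Bn in measurable)
  qed measurable
  have d: "divg \<phi> = (\<lambda>x. \<Sum>i\<in>UNIV. g i x $ i)"
    using C1_gradient_components(3)[of \<phi> g, OF g] by auto
  have sup: "\<phi> x $ i = 0" if "x \<notin> K" for x i using K(2)[OF that] by simp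
  obtain \<rho> where \<rho>: "K \<subseteq> ball 0 \<rho>" using compact_imp_bounded[OF K(1)] bounded_subset_ballD by blast
  have ii: "integrable lborel (\<lambda>x. indicator body x * (g i x \<bullet> axis i 1))" for i
  proof -
    obtain B' where B': "\<And>x. norm (g i x) \<le> B'" "\<And>x. x \<notin> K \<Longrightarrow> g i x = 0"
      using C1_gradient_bounded_support[OF g[of i] K(1) sup] by metis
    show ?thesis
    proof (rule integrable_bounded_support[where B = B' and \<rho> = \<rho>])
      fix x
      have "\<bar>g i x \<bullet> axis i 1\<bar> \<le> B'" using component_le_norm_cart[of "g i x" i] B'(1)[of x] by (simp add: inner_axis)
      then show "\<bar>indicator body x * (g i x \<bullet> axis i 1)\<bar> \<le> B'" by (auto simp: indicator_def)
      show "indicator body x * (g i x \<bullet> axis i 1) = 0" if "x \<notin> cball 0 \<rho>"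
      proof -
        have "x \<notin> K" using that \<rho> ball_subset_cball by blast
        then show ?thesis by (simp add: B'(2))
      qed
    qed measurable
  qed
  have jj: "integrable lborel (\<lambda>x. dens x * (\<phi> (rproj x) $ i * (normal (rproj x) \<bullet> axis i 1)))" for i
  proof (rule integrable_dens_times)
    show "\<bar>\<phi> (rproj x) $ i * (normal (rproj x) \<bullet> axis i 1)\<bar> \<le> \<bar>B\<bar> * 1" if "x \<in> core" for x
    proof -
      have "\<bar>\<phi> (rproj x) $ i\<bar> \<le> \<bar>B\<bar>" using component_le_norm_cart[of "\<phi> (rproj x)" i] B[of "rproj x"] by linarith
      moreover have "\<bar>nu (rproj x) $ i\<bar> \<le> 1" using component_le_norm_cart[of "nu (rproj x)" i] by (simp add: norm_nu)
      ultimately show ?thesis unfolding abs_mult by (intro mult_mono) (auto simp: nu_rproj[OF that] inner_axis)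
    qed
  qed measurable
  have "set_lebesgue_integral lebesgue body (divg \<phi>) = (\<integral>x. indicator body x * (\<Sum>i\<in>UNIV. g i x $ i) \<partial>lborel)"
    unfolding d by (rule set_lebesgue_integral_lborel) measurable
  also have "\<dots> = (\<integral>x. (\<Sum>i\<in>UNIV. indicator body x * (g i x \<bullet> axis i 1)) \<partial>lborel)"
    by (simp add: sum_distrib_left inner_axis)
  also have "\<dots> = (\<Sum>i\<in>UNIV. \<integral>x. indicator body x * (g i x \<bullet> axis i 1) \<partial>lborel)"
    by (rule Bochner_Integration.integral_sum) (rule ii)
  also have "\<dots> = (\<Sum>i\<in>UNIV. \<integral>x. dens x * (\<phi> (rproj x) $ i * (normal (rproj x) \<bullet> axis i 1)) \<partial>lborel)"
    by (intro sum.cong refl scalar_gauss_green[OF g K(1) sup])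
  also have "\<dots> = (\<integral>x. (\<Sum>i\<in>UNIV. dens x * (\<phi> (rproj x) $ i * (normal (rproj x) \<bullet> axis i 1))) \<partial>lborel)"
    by (rule Bochner_Integration.integral_sum[symmetric]) (rule jj)
  also have "\<dots> = (\<integral>x. dens x * (\<phi> (rproj x) \<bullet> nu (rproj x)) \<partial>lborel)"
  proof (intro Bochner_Integration.integral_cong refl)
    fix x show "(\<Sum>i\<in>UNIV. dens x * (\<phi> (rproj x) $ i * (normal (rproj x) \<bullet> axis i 1))) = dens x * (\<phi> (rproj x) \<bullet> nu (rproj x))"
    proof (cases "x \<in> core")
      case True
      show ?thesis unfolding nu_rproj[OF True] by (simp add: inner_vec_def[of "\<phi> _"] inner_axis sum_distrib_left)
    qed (simp add: dens_def)
  qed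
  also have "\<dots> = (\<integral>x. \<phi> x \<bullet> nu x \<partial>surface_measure)"
    by (rule integral_surface_measure[symmetric]) measurable
  finally show "set_lebesgue_integral lebesgue body (divg \<phi>) = (\<integral>x. \<phi> x \<bullet> nu x \<partial>surface_measure)" .
qed

lemma gauss_green_body: "gauss_green body surface_measure nu"
  unfolding gauss_green_def
  using vector_gauss_green norm_nu borel_nu sets_surface_measure surf.emeasure_finite
  by (auto simp: less_top[symmetric])

end

section \<open>The reduced boundary\<close>

lemma borel_measurable_C1: "C1_gradient f g \<Longrightarrow> f \<in> borel_measurable borel"
  by (intro borel_measurable_continuous_onI C1_gradient_continuous)

context convex_drop
begin

text \<open>\<open>reduced_boundary\<close> allows an arbitrary pair \<open>\<mu>\<close>,
  \<open>\<nu>\<close>. It represents the same divergence integrals as the pair constructed above,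
  and the latter is carried by the surface; so fields that are 0 on the surface have integral 0
  against both.\<close>

lemma test_field_vanishing_on_surf:
  assumes gg: "gauss_green body \<mu> \<nu>" and \<phi>: "c1c UNIV \<phi>" and z: "\<And>x. x \<in> surf \<Longrightarrow> \<phi> x = 0"
  shows "(\<integral>x. \<phi> x \<bullet> \<nu> x \<partial>\<mu>) = 0"
proof -
  have "(\<integral>x. \<phi> x \<bullet> nu x \<partial>surface_measure) = (\<integral>x. 0 \<partial>surface_measure)"
  proof (rule integral_cong_AE)
    show "(\<lambda>x. \<phi> x \<bullet> nu x) \<in> borel_measurable surface_measure"
      using vector_gauss_green(1)[OF \<phi>] by auto
    show "AE x in surface_measure. \<phi> x \<bullet> nu x = 0"
      using AE_surface_measure by eventually_elim (simp add: z)
  qed simp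
  then show ?thesis using gg \<phi> vector_gauss_green(2)[OF \<phi>] by (simp add: gauss_green_def)
qed

text \<open>The fields \<open>\<xi> (\<theta> j y) *\<^sub>R v\<close> vanish outside the open ball,
  hence on the surface, and converge to \<open>v\<close> inside it. Dominated convergence, with the
  finite mass of the closed ball, gives the vector mass of the open ball.\<close>

lemma gauss_green_ball_zero:
  assumes gg: "gauss_green body \<mu> \<nu>" and r: "0 < r" "cball x r \<inter> surf = {}"
  shows "v \<bullet> set_lebesgue_integral \<mu> (ball x r) \<nu> = 0"
proof -
  have sets: "sets \<mu> = sets borel" and fin: "\<And>K. compact K \<Longrightarrow> emeasure \<mu> K < \<infinity>"
    and \<nu>: "\<nu> \<in> borel_measurable borel" and n1: "\<And>x. norm (\<nu> x) = 1"
    using gg by (auto simp: gauss_green_def)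
  have borel_\<mu>: "F \<in> borel_measurable \<mu>" if "F \<in> borel_measurable borel" for F :: "real^'n \<Rightarrow> 'c::real_normed_vector"
    using that by (simp add: measurable_cong_sets[OF sets refl])
  have [measurable]: "\<nu> \<in> borel_measurable \<mu>" by (rule borel_\<mu>[OF \<nu>])
  have [measurable]: "ball x r \<in> sets \<mu>" "cball x r \<in> sets \<mu>" by (simp_all add: sets)
  obtain \<xi> \<xi>' :: "real \<Rightarrow> real" where \<xi>:
    "\<And>y. (\<xi> has_real_derivative \<xi>' y) (at y)" "continuous_on UNIV \<xi>'"
    "\<And>y. 0 \<le> \<xi> y" "\<And>y. \<xi> y \<le> 1" "\<And>y. y \<le> 1 \<Longrightarrow> \<xi> y = 0" "\<And>y. y \<ge> 3 \<Longrightarrow> \<xi> y = 1"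
    using smooth_step by metis
  \<comment> \<open>At most 0 outside the ball and, thanks to the square, C1 everywhere; the factor
    j eventually lifts it above the threshold 3 at each point of the ball.\<close>
  define \<theta> where "\<theta> j y = real j * (r\<^sup>2 + (-1) * (norm (y - x))\<^sup>2)" for j and y :: "real^'n"
  have C: "\<exists>g. C1_gradient (\<lambda>y. \<xi> (\<theta> j y)) g" for j
    unfolding \<theta>_def
    using C1_gradient_compose'[OF C1_gradient_mult[OF C1_gradient_const C1_gradient_add[OF C1_gradient_const
        C1_gradient_mult[OF C1_gradient_const C1_gradient_power2_norm]]] \<xi>(1,2)] by blast
  have \<theta>0: "\<xi> (\<theta> j y) = 0" if "y \<notin> ball x r" for j y
  proof -
    have "r\<^sup>2 \<le> (norm (y - x))\<^sup>2" using that r by (intro power_mono) (auto simp: dist_norm norm_minus_commute)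
    then have "\<theta> j y \<le> 0" by (simp add: \<theta>_def mult_nonneg_nonpos)
    then show ?thesis using \<xi>(5) by simp
  qed
  have zero: "(\<integral>y. (\<xi> (\<theta> j y) *\<^sub>R v) \<bullet> \<nu> y \<partial>\<mu>) = 0" for j
  proof (rule test_field_vanishing_on_surf[OF gg])
    obtain g where g: "C1_gradient (\<lambda>y. \<xi> (\<theta> j y)) g" using C by blast
    show "c1c UNIV (\<lambda>y. \<xi> (\<theta> j y) *\<^sub>R v)"
    proof (rule c1cI[where K = "cball x r"])
      show "C1_gradient (\<lambda>y. (\<xi> (\<theta> j y) *\<^sub>R v) $ i) (\<lambda>y. \<xi> (\<theta> j y) *\<^sub>R 0 + v $ i *\<^sub>R g y)" for i
        using C1_gradient_mult[OF g C1_gradient_const[of "v $ i"]] by simp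
      show "\<xi> (\<theta> j y) *\<^sub>R v = 0" if "y \<notin> cball x r" for y using that \<theta>0[of y j] by simp
    qed auto
    show "\<xi> (\<theta> j y) *\<^sub>R v = 0" if "y \<in> surf" for y
    proof -
      have "y \<notin> ball x r" using that r(2) ball_subset_cball by blast
      then show ?thesis using \<theta>0 by simp
    qed
  qed
  have w: "integrable \<mu> (\<lambda>y. norm v * indicator (cball x r) y)"
    using fin[of "cball x r"] by (intro integrable_mult_right integrable_real_indicator) auto
  have vn: "\<bar>v \<bullet> \<nu> y\<bar> \<le> norm v" for y using Cauchy_Schwarz_ineq2[of v "\<nu> y"] n1 by simp
  have [measurable]: "(\<lambda>y. \<xi> (\<theta> j y)) \<in> borel_measurable \<mu>" for j
    using C borel_measurable_C1 borel_\<mu> by blast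
  have "(\<lambda>j. \<integral>y. (\<xi> (\<theta> j y) *\<^sub>R v) \<bullet> \<nu> y \<partial>\<mu>) \<longlonglongrightarrow> (\<integral>y. indicator (ball x r) y * (v \<bullet> \<nu> y) \<partial>\<mu>)"
  proof (rule integral_dominated_convergence[OF _ _ w])
    show "AE y in \<mu>. (\<lambda>j. (\<xi> (\<theta> j y) *\<^sub>R v) \<bullet> \<nu> y) \<longlonglongrightarrow> indicator (ball x r) y * (v \<bullet> \<nu> y)"
    proof (rule AE_I2)
      fix y show "(\<lambda>j. (\<xi> (\<theta> j y) *\<^sub>R v) \<bullet> \<nu> y) \<longlonglongrightarrow> indicator (ball x r) y * (v \<bullet> \<nu> y)"
      proof (cases "y \<in> ball x r")
        case True
        then have "(norm (y - x))\<^sup>2 < r\<^sup>2" by (intro power_strict_mono) (auto simp: dist_norm norm_minus_commute)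
        then have p: "0 < r\<^sup>2 + (-1) * (norm (y - x))\<^sup>2" by simp
        have "\<forall>\<^sub>F j in sequentially. 3 / (r\<^sup>2 + (-1) * (norm (y - x))\<^sup>2) \<le> real j"
          using filterlim_real_sequentially by (simp add: filterlim_at_top)
        then have "\<forall>\<^sub>F j in sequentially. (\<xi> (\<theta> j y) *\<^sub>R v) \<bullet> \<nu> y = indicator (ball x r) y * (v \<bullet> \<nu> y)"
        proof eventually_elim
          case (elim j)
          then have "3 \<le> \<theta> j y" unfolding \<theta>_def using p by (simp only: pos_divide_le_eq)
          then show ?case using \<xi>(6) True by simp
        qed
        then show ?thesis by (rule tendsto_eventually)
      next
        case False
        then show ?thesis using \<theta>0 by simp
      qed
    qed
    show "AE y in \<mu>. norm ((\<xi> (\<theta> j y) *\<^sub>R v) \<bullet> \<nu> y) \<le> norm v * indicator (cball x r) y" for j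
    proof (rule AE_I2)
      fix y show "norm ((\<xi> (\<theta> j y) *\<^sub>R v) \<bullet> \<nu> y) \<le> norm v * indicator (cball x r) y"
      proof (cases "y \<in> cball x r")
        case True
        have "norm ((\<xi> (\<theta> j y) *\<^sub>R v) \<bullet> \<nu> y) = \<xi> (\<theta> j y) * \<bar>v \<bullet> \<nu> y\<bar>" using \<xi>(3) by (simp add: abs_mult)
        also have "\<dots> \<le> 1 * norm v" using \<xi>(3,4) vn by (intro mult_mono) auto
        finally show ?thesis using True by simp
      qed (use \<theta>0[of y j] in simp)
    qed
  qed measurable
  then have "(\<integral>y. indicator (ball x r) y * (v \<bullet> \<nu> y) \<partial>\<mu>) = 0"
    unfolding zero by (simp add: LIMSEQ_const_iff)
  moreover have "integrable \<mu> (\<lambda>y. indicator (ball x r) y *\<^sub>R \<nu> y)"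
  proof (rule Bochner_Integration.integrable_bound)
    show "integrable \<mu> (\<lambda>y. indicator (cball x r) y :: real)"
      using fin[of "cball x r"] by (intro integrable_real_indicator) auto
    show "AE y in \<mu>. norm (indicator (ball x r) y *\<^sub>R \<nu> y) \<le> norm (indicator (cball x r) y :: real)"
      by (rule AE_I2) (auto simp: indicator_def n1)
  qed measurable
  then have "v \<bullet> set_lebesgue_integral \<mu> (ball x r) \<nu> = (\<integral>y. v \<bullet> (indicator (ball x r) y *\<^sub>R \<nu> y) \<partial>\<mu>)"
    unfolding set_lebesgue_integral_def by (rule integral_inner_right[symmetric])
  ultimately show ?thesis by simp
qed

text \<open>Off the surface small balls have zero vector mass, so the averages are eventually
  orthogonal to \<open>v\<close> and cannot tend to it.\<close>

lemma reduced_boundary_subset: "reduced_boundary body \<subseteq> surf"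
proof
  fix x assume "x \<in> reduced_boundary body"
  then obtain \<mu> \<nu> v where gg: "gauss_green body \<mu> \<nu>" and v: "norm v = 1"
    and lim: "((\<lambda>r. (1 / measure \<mu> (ball x r)) *\<^sub>R set_lebesgue_integral \<mu> (ball x r) \<nu>) \<longlongrightarrow> v) (at_right 0)"
    unfolding reduced_boundary_def by blast
  show "x \<in> surf"
  proof (rule ccontr)
    assume "x \<notin> surf"
    then have "x \<in> - surf" "open (- surf)" using closed_surf by auto
    then obtain r0 where r0: "0 < r0" "cball x r0 \<subseteq> - surf" using open_contains_cball by blast
    have "((\<lambda>r. v \<bullet> ((1 / measure \<mu> (ball x r)) *\<^sub>R set_lebesgue_integral \<mu> (ball x r) \<nu>)) \<longlongrightarrow> v \<bullet> v) (at_right 0)"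
      by (intro tendsto_inner tendsto_const lim)
    moreover have "\<forall>\<^sub>F r in at_right 0. v \<bullet> ((1 / measure \<mu> (ball x r)) *\<^sub>R set_lebesgue_integral \<mu> (ball x r) \<nu>) = 0"
    proof -
      have "eventually (\<lambda>r. r \<in> {0<..<r0}) (at_right 0)"
        by (rule eventually_at_right_real) (use r0 in simp)
      then show ?thesis
      proof eventually_elim
        case (elim r)
        then have "cball x r \<subseteq> cball x r0" by (intro subset_cball) auto
        then have "cball x r \<inter> surf = {}" using r0(2) by blast
        then show ?case using gauss_green_ball_zero[OF gg, of r x v] elim by simp
      qed
    qed
    ultimately have "((\<lambda>r::real. 0) \<longlongrightarrow> v \<bullet> v) (at_right 0)"
      by (rule Lim_transform_eventually)
    from tendsto_unique[OF trivial_limit_at_right_real this tendsto_const] have "v \<bullet> v = 0" .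
    then show False using v by (simp add: norm_eq_1)
  qed
qed

text \<open>At the tip \<open>P\<close> is unbounded, so continuity is claimed along the surface
  only. There both normals have norm 1 and |normal z - normal x|^2 = 2 + 2 V, which tends to 0
  because \<open>V\<close> tends to -1.\<close>

lemma normal_continuous_within_surf:
  assumes x: "x \<in> surf"
  shows "continuous (at x within surf) normal"
proof (cases "0 < x $ k")
  case True
  have "isCont (\<lambda>x. x $ k) x" by (intro continuous_intros)
  then have "isCont (\<lambda>x. P (x $ k)) x" "isCont (\<lambda>x. V (x $ k)) x"
    using isCont_o2[of x "\<lambda>x. x $ k" P] isCont_P[OF True] isCont_o2[of x "\<lambda>x. x $ k" V] isCont_V by auto
  moreover have "isCont hp x" using continuous_hp[of UNIV] by (simp add: continuous_on_eq_continuous_at)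
  ultimately have "isCont normal x" unfolding normal_def[abs_def] by (intro continuous_intros)
  then show ?thesis by (rule continuous_at_imp_continuous_at_within)
next
  case False
  then have y0: "x $ k = 0" using x by (auto simp: surf_def)
  then have "normp k x = 0" using x Q_0 by (simp add: surf_def)
  then have nx: "normal x = - axis k 1" using y0 V_nonpos[of 0] by (simp add: normal_def normp_eq)
  have n: "norm (normal z - normal x) = sqrt (2 + 2 * V (z $ k))" if "z \<in> surf" for z
  proof -
    have "normal z \<bullet> normal z = 1" "normal z \<bullet> normal x = - V (z $ k)" "normal x \<bullet> normal x = 1"
      using norm_normal[OF that] norm_normal[OF x]
      by (simp_all add: norm_eq_1 nx) (simp add: normal_def inner_axis hp_nth)
    then have "(norm (normal z - normal x))\<^sup>2 = 2 + 2 * V (z $ k)"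
      unfolding power2_norm_eq_inner by (simp add: inner_diff_left inner_diff_right inner_commute)
    then show ?thesis by (simp add: real_sqrt_unique)
  qed
  have "isCont (\<lambda>z. sqrt (2 + 2 * V (z $ k))) x"
    by (intro continuous_intros isCont_o2[OF _ isCont_V])
  then have "((\<lambda>z. sqrt (2 + 2 * V (z $ k))) \<longlongrightarrow> sqrt (2 + 2 * V (x $ k))) (at x within surf)"
    using continuous_at_imp_continuous_at_within continuous_within by blast
  then have l: "((\<lambda>z. sqrt (2 + 2 * V (z $ k))) \<longlongrightarrow> 0) (at x within surf)"
    using V_nonpos[of 0] y0 by simp
  show ?thesis unfolding continuous_within
  proof (rule LIM_zero_cancel, rule Lim_null_comparison[OF _ l])
    show "\<forall>\<^sub>F z in at x within surf. norm (normal z - normal x) \<le> sqrt (2 + 2 * V (z $ k))"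
      using n by (auto simp: eventually_at_filter)
  qed
qed

lemma open_core: "open core"
proof -
  have "core = body \<inter> {x. 0 < normp k x}" by (auto simp: core_def)
  moreover have "open {x. 0 < normp k x}"
    by (intro open_Collect_less continuous_normp continuous_on_const)
  ultimately show ?thesis using open_body by auto
qed

lemma continuous_rproj: "continuous_on core rproj"
  unfolding rproj_def[abs_def]
  by (intro continuous_intros continuous_Q_nth continuous_normp continuous_hp) (auto simp: core_def)

text \<open>\<open>rproj\<close> preserves heights, so points of \<open>core\<close> are projected
  to surface points of the strip; the tip and the top are approximated by such points along a curve
  over one horizontal direction.\<close>

lemma surf_generic_point:
  assumes x: "x \<in> surf" and r: "0 < r"
  obtains p where "p \<in> surf" "p \<in> strip" "dist p x < r"
proof (cases "x \<in> strip")
  case True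
  then show ?thesis using that[of x] x r by simp
next
  case False
  then have yp: "x $ k = 0 \<or> x $ k = T" using x by (auto simp: surf_def strip_def)
  then have "Q (x $ k) = 0" using Q_0 Q_T by auto
  then have "hp x = 0" using x by (simp add: surf_def normp_eq)
  then have xe: "x = x $ k *\<^sub>R axis k 1" using hp_decomp[of x] by simp
  obtain \<tau> :: "real^'n" and b :: real where \<tau>: "\<tau> $ k = 0" "norm \<tau> = 1" using unit_decomp[OF norm_axis_1[of k]] by blast
  have h\<tau>: "hp \<tau> = \<tau>" using \<tau>(1) by (simp add: hp_def)
  define q where "q y = sqrt (Q y) *\<^sub>R \<tau> + y *\<^sub>R axis k 1" for y
  have "isCont q (x $ k)" unfolding q_def[abs_def]
    by (intro continuous_intros isCont_o2[OF continuous_Q isCont_real_sqrt])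
  then obtain d where d: "d > 0" "\<And>y. dist y (x $ k) < d \<Longrightarrow> dist (q y) (q (x $ k)) < r"
    using r unfolding continuous_at_eps_delta by (metis dist_norm)
  have "x $ k \<in> closure {0<..<T}" using yp T_gt_1 by auto
  then obtain y where y: "y \<in> {0<..<T}" "dist y (x $ k) < d" using d(1) closure_approachable by blast
  have qx: "q (x $ k) = x" using \<open>Q (x $ k) = 0\<close> xe by (simp add: q_def)
  have qk: "q y $ k = y" "normp k (q y) = sqrt (Q y)"
    using nth_scale[of "sqrt (Q y)" \<tau> y] normp_scale[of "sqrt (Q y)" \<tau> y] h\<tau> \<tau>(2) Q_pos[of y] y(1)
    by (auto simp: q_def normp_eq)
  show ?thesis
  proof (rule that[of "q y"])
    show "q y \<in> surf" using qk y(1) Q_pos[of y] by (simp add: surf_def)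
    show "q y \<in> strip" using qk y(1) by (simp add: strip_def)
    show "dist (q y) x < r" using d(2)[OF y(2)] qx by simp
  qed
qed

text \<open>The ball contains a surface point of the strip, and its preimage under
  \<open>rproj\<close> is open and nonempty: it contains that point with its horizontal part halved.
  The weight is positive there, and a nonempty open set is not negligible.\<close>

lemma measure_surface_ball_pos:
  assumes x: "x \<in> surf" and r: "0 < r"
  shows "0 < measure surface_measure (ball x r)"
proof (rule ccontr)
  assume "\<not> 0 < measure surface_measure (ball x r)"
  then have m0: "measure surface_measure (ball x r) = 0" by (simp add: zero_less_measure_iff)
  obtain p where p: "p \<in> surf" "p \<in> strip" "dist p x < r" using surf_generic_point[OF x r] by blast
  have q: "0 < Q (p $ k)" using p(2) Q_pos by (simp add: strip_def)
  then have np: "normp k p = sqrt (Q (p $ k))" using p(1) real_sqrt_unique[OF _ normp_nonneg, of p] by (simp add: surf_def)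
  define z where "z = (1/2) *\<^sub>R hp p + p $ k *\<^sub>R axis k 1"
  have zk: "z $ k = p $ k" "normp k z = 1 / 2 * normp k p"
    unfolding z_def by (rule nth_scale) (simp add: normp_scale)
  have hz: "hp z = (1/2) *\<^sub>R hp p" by (simp add: vec_eq_iff hp_nth z_def axis_def)
  have "normp k z < sqrt (Q (z $ k))" using q by (simp add: zk np)
  then have zc: "z \<in> core" using q p(2) by (simp add: core_def body_iff zk np strip_def)
  have "rproj z = p" using q np hp_decomp[of p] by (simp add: rproj_def zk hz)
  define W where "W = core \<inter> rproj -` ball x r"
  have "z \<in> W" using zc p(3) \<open>rproj z = p\<close> by (simp add: W_def dist_commute)
  have Wo: "open W" unfolding W_def by (rule continuous_open_preimage[OF continuous_rproj open_core open_ball])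
  have i: "integrable lborel (\<lambda>y. dens y * indicator (ball x r) (rproj y))"
    by (rule integrable_dens_times[where B = 1]) (auto simp: indicator_def)
  have "(\<integral>y. indicator (ball x r) y \<partial>surface_measure) = measure surface_measure (ball x r)"
    by (simp add: sets_surface_measure)
  then have "(\<integral>y. dens y * indicator (ball x r) (rproj y) \<partial>lborel) = 0"
    using m0 by (subst (asm) integral_surface_measure) (auto intro!: borel_measurable_indicator)
  then have "AE y in lborel. dens y * indicator (ball x r) (rproj y) = 0"
    using integral_nonneg_eq_0_iff_AE[OF i] dens_nonneg by auto
  then have "AE y in lborel. y \<notin> W"
  proof eventually_elim
    case (elim y)
    have "dens y > 0" if "y \<in> core"
    proof -
      have "0 < Q (y $ k)" "0 < P (y $ k)" using core_strip[OF that] Q_pos P_pos by (auto simp: strip_def)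
      then show ?thesis using that card_ge_2 by (simp add: dens_def)
    qed
    then show ?case using elim by (auto simp: W_def)
  qed
  then have "W \<in> null_sets lborel" using Wo by (subst (asm) AE_iff_null_sets[symmetric]) auto
  then have "W \<in> null_sets lebesgue" by (simp add: null_sets_completionI)
  then have "negligible W" by (simp add: negligible_iff_null_sets)
  then show False using open_not_negligible[OF Wo] \<open>z \<in> W\<close> by blast
qed

text \<open>The measure is carried by the surface, along which the normal is continuous, so its
  averages over shrinking balls tend to \<open>nu x\<close>; all these balls have positive
  mass.\<close>

lemma surf_subset_reduced_boundary: "surf \<subseteq> reduced_boundary body"
proof
  fix x assume x: "x \<in> surf"
  let ?m = "\<lambda>r. measure surface_measure (ball x r)"
  have "((\<lambda>r. (1 / ?m r) *\<^sub>R set_lebesgue_integral surface_measure (ball x r) nu) \<longlongrightarrow> nu x) (at_right 0)"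
  proof (rule tendstoI)
    fix e :: real assume e: "e > 0"
    obtain d where d: "d > 0" "\<And>y. y \<in> surf \<Longrightarrow> dist y x < d \<Longrightarrow> dist (normal y) (normal x) < e / 2"
      using normal_continuous_within_surf[OF x] e unfolding continuous_within_eps_delta
      by (metis half_gt_zero)
    have "eventually (\<lambda>r. r \<in> {0<..<d}) (at_right 0)"
      by (rule eventually_at_right_real) (use d in simp)
    then show "\<forall>\<^sub>F r in at_right 0. dist ((1 / ?m r) *\<^sub>R set_lebesgue_integral surface_measure (ball x r) nu) (nu x) < e"
    proof eventually_elim
      case (elim r)
      then have r: "0 < r" "r < d" by auto
      have mp: "0 < ?m r" by (rule measure_surface_ball_pos[OF x r(1)])
      have i1: "integrable surface_measure (\<lambda>y. indicator (ball x r) y *\<^sub>R nu y)"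
        by (rule surf.integrable_const_bound[of _ 1]) (auto simp: norm_nu indicator_def sets_surface_measure)
      have i2: "integrable surface_measure (\<lambda>y. indicator (ball x r) y *\<^sub>R nu x)"
        by (rule surf.integrable_const_bound[of _ 1]) (auto simp: norm_nu indicator_def sets_surface_measure)
      have i3: "integrable surface_measure (\<lambda>y. e / 2 * indicator (ball x r) y)"
        by (rule surf.integrable_const_bound[of _ "e / 2"]) (use e in \<open>auto simp: indicator_def sets_surface_measure\<close>)
      have "(\<integral>y. indicator (ball x r) y *\<^sub>R nu x \<partial>surface_measure) = ?m r *\<^sub>R nu x"
        by (subst integral_scaleR_left) (auto simp: sets_surface_measure less_top[symmetric])
      then have eq: "set_lebesgue_integral surface_measure (ball x r) nu - ?m r *\<^sub>R nu x
        = (\<integral>y. indicator (ball x r) y *\<^sub>R nu y - indicator (ball x r) y *\<^sub>R nu x \<partial>surface_measure)"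
        using i1 i2 by (simp add: set_lebesgue_integral_def)
      have "norm (set_lebesgue_integral surface_measure (ball x r) nu - ?m r *\<^sub>R nu x)
        \<le> (\<integral>y. norm (indicator (ball x r) y *\<^sub>R nu y - indicator (ball x r) y *\<^sub>R nu x) \<partial>surface_measure)"
        by (rule ord_eq_le_trans[OF arg_cong[OF eq, of norm] integral_norm_bound])
      also have "\<dots> \<le> (\<integral>y. e / 2 * indicator (ball x r) y \<partial>surface_measure)"
      proof (rule integral_mono_AE)
        show "AE y in surface_measure. norm (indicator (ball x r) y *\<^sub>R nu y - indicator (ball x r) y *\<^sub>R nu x) \<le> e / 2 * indicator (ball x r) y"
          using AE_surface_measure
        proof eventually_elim
          case (elim y)
          show ?case
          proof (cases "y \<in> ball x r")
            case True
            then have "dist (normal y) (normal x) < e / 2" using d(2)[OF elim] r by (simp add: dist_commute)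
            then show ?thesis using True elim x by (simp add: nu_def dist_norm)
          qed simp
        qed
      qed (use i1 i2 i3 in auto)
      also have "\<dots> = e / 2 * ?m r" by (simp add: sets_surface_measure)
      finally have le: "norm (set_lebesgue_integral surface_measure (ball x r) nu - ?m r *\<^sub>R nu x) \<le> e / 2 * ?m r" .
      have "(1 / ?m r) *\<^sub>R set_lebesgue_integral surface_measure (ball x r) nu - nu x
         = (1 / ?m r) *\<^sub>R (set_lebesgue_integral surface_measure (ball x r) nu - ?m r *\<^sub>R nu x)"
        using mp by (simp add: scaleR_diff_right)
      then have "dist ((1 / ?m r) *\<^sub>R set_lebesgue_integral surface_measure (ball x r) nu) (nu x)
         = (1 / ?m r) * norm (set_lebesgue_integral surface_measure (ball x r) nu - ?m r *\<^sub>R nu x)"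
        using mp by (simp add: dist_norm)
      also have "\<dots> \<le> (1 / ?m r) * (e / 2 * ?m r)" using le mp by (intro mult_left_mono) auto
      also have "\<dots> < e" using mp e by simp
      finally show ?case .
    qed
  qed
  then show "x \<in> reduced_boundary body"
    unfolding reduced_boundary_def mem_Collect_eq
    using gauss_green_body measure_surface_ball_pos[OF x] norm_nu by blast
qed

lemma reduced_boundary_body: "reduced_boundary body = surf"
  using reduced_boundary_subset surf_subset_reduced_boundary by blast

end

section \<open>Calibration\<close>

text \<open>Follows from (1 + t^m)^(1/m) \<ge> t. With t the squared ratio of the horizontal length
  to its admissible maximum, it bounds the length of the truncated field.\<close>

lemma soft_cap_le: "0 \<le> t \<Longrightarrow> 0 < m \<Longrightarrow> t * ((1 + t ^ m) powr (- (1 / (2 * real m))))\<^sup>2 \<le> 1"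
proof -
  assume t: "0 \<le> t" and m: "0 < m"
  have p: "0 < 1 + t ^ m" using t by (simp add: add_pos_nonneg)
  have "((1 + t ^ m) powr (- (1 / (2 * real m))))\<^sup>2 = (1 + t ^ m) powr (- (1 / real m))"
    by (simp add: power2_eq_square powr_add[symmetric])
  moreover have "t \<le> (1 + t ^ m) powr (1 / real m)"
  proof (cases "t = 0")
    case False
    have "t = (t ^ m) powr (1 / real m)" using t False m by (simp add: powr_realpow[symmetric] powr_powr)
    also have "\<dots> \<le> (1 + t ^ m) powr (1 / real m)" using t by (intro powr_mono2) auto
    finally show ?thesis .
  qed simp
  then have "t * (1 + t ^ m) powr (- (1 / real m)) \<le> (1 + t ^ m) powr (1 / real m) * (1 + t ^ m) powr (- (1 / real m))"
    by (intro mult_right_mono) auto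
  ultimately show ?thesis using p by (simp add: powr_add[symmetric])
qed

text \<open>Unlike min 1 (1 / sqrt t), the soft cap is below 1 already at t = 1, where it is 2^(-1 /
  (2 m)). The estimate ln (1 + t^m) / m \<le> ln 2 / m + ln (max 1 t) shows that the loss disappears
  even if t varies with m, provided it tends to 1.\<close>

lemma soft_cap_limit:
  assumes t: "\<And>j. 0 \<le> t j" "t \<longlonglongrightarrow> 1"
  shows "(\<lambda>j. (1 + t j ^ Suc j) powr (- (1 / (2 * real (Suc j))))) \<longlonglongrightarrow> 1"
proof -
  define u where "u j = ln (1 + t j ^ Suc j) / real (Suc j)" for j
  have p: "1 \<le> 1 + t j ^ Suc j" for j using t(1) by simp
  have "u \<longlonglongrightarrow> 0"
  proof (rule tendsto_sandwich)
    show "\<forall>\<^sub>F j in sequentially. 0 \<le> u j" using p by (intro always_eventually) (simp add: u_def del: power_Suc)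
    show "\<forall>\<^sub>F j in sequentially. u j \<le> ln 2 * (1 / real (Suc j)) + ln (max 1 (t j))"
    proof (intro always_eventually allI)
      fix j
      have "t j ^ Suc j \<le> max 1 (t j) ^ Suc j" using t(1) by (intro power_mono) auto
      moreover have "1 \<le> max 1 (t j) ^ Suc j" by (intro one_le_power) auto
      ultimately have "1 + t j ^ Suc j \<le> 2 * max 1 (t j) ^ Suc j" by linarith
      then have "ln (1 + t j ^ Suc j) \<le> ln (2 * max 1 (t j) ^ Suc j)" using p[of j] by (intro ln_mono) linarith+
      also have "\<dots> = ln 2 + real (Suc j) * ln (max 1 (t j))"
        by (subst ln_mult) (auto simp: ln_realpow simp del: power_Suc of_nat_Suc intro: less_le_trans[of 0 1])
      finally have "u j \<le> (ln 2 + real (Suc j) * ln (max 1 (t j))) / real (Suc j)"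
        unfolding u_def by (intro divide_right_mono) auto
      then show "u j \<le> ln 2 * (1 / real (Suc j)) + ln (max 1 (t j))"
        by (simp add: add_divide_distrib del: of_nat_Suc)
    qed
    have l1: "(\<lambda>j. 1 / real (Suc j)) \<longlonglongrightarrow> 0" using LIMSEQ_inverse_real_of_nat by (simp add: inverse_eq_divide)
    have l2: "(\<lambda>j. ln (max 1 (t j))) \<longlonglongrightarrow> ln (max 1 1)"
      by (intro tendsto_ln tendsto_max t(2) tendsto_const) simp
    show "(\<lambda>j. ln 2 * (1 / real (Suc j)) + ln (max 1 (t j))) \<longlonglongrightarrow> 0"
      using tendsto_add[OF tendsto_mult[OF tendsto_const[of "ln 2"] l1] l2] by simp
  qed simp
  then have "(\<lambda>j. exp (- (1 / 2) * u j)) \<longlonglongrightarrow> exp (- (1 / 2) * 0)"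
    by (intro tendsto_exp tendsto_mult tendsto_const)
  moreover have "exp (- (1 / 2) * u j) = (1 + t j ^ Suc j) powr (- (1 / (2 * real (Suc j))))" for j
    using p[of j] by (simp add: powr_def u_def del: power_Suc of_nat_Suc)
  ultimately show ?thesis by simp
qed

context convex_drop
begin

text \<open>The factor \<open>cap m t\<close> is a smooth substitute for \<open>min 1 (1 / sqrt t)\<close>, which it approaches as
  \<open>m\<close> tends to infinity.\<close>

definition cap :: "nat \<Rightarrow> real \<Rightarrow> real" where
  "cap m t = (1 + t ^ m) powr (- (1 / (2 * real m)))"

text \<open>The argument of \<open>cap\<close> is the squared quotient of the horizontal length p
  |x'| by its admissible maximum sqrt (1 - q^2), so the truncation sets in where the untruncated
  field would exceed length 1.\<close>

definition capped :: "nat \<Rightarrow> (real \<Rightarrow> real) \<Rightarrow> (real \<Rightarrow> real) \<Rightarrow> real^'n \<Rightarrow> real^'n" where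
  "capped m p q x = (p (x $ k) * cap m ((p (x $ k))\<^sup>2 / (1 - (q (x $ k))\<^sup>2) * (normp k x)\<^sup>2)) *\<^sub>R hp x
      + q (x $ k) *\<^sub>R axis k 1"

lemma C1_gradient_normp: "C1_gradient (\<lambda>x. (normp k x)\<^sup>2) (\<lambda>x. 2 *\<^sub>R hp x)"
proof -
  have bl: "bounded_linear hp" using linear_hp by (simp add: linear_conv_bounded_linear)
  have hh: "hp x \<bullet> hp h = hp x \<bullet> h" for x h by (simp add: hp_def[of h] inner_diff_right hp_inner_axis)
  have n: "(\<lambda>x. (normp k x)\<^sup>2) = (\<lambda>x. hp x \<bullet> hp x)" by (simp add: normp_eq power2_norm_eq_inner)
  have "((\<lambda>x. (normp k x)\<^sup>2) has_derivative (\<lambda>h. (2 *\<^sub>R hp x) \<bullet> h)) (at x)" for x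
    unfolding n
  proof (rule has_derivative_eq_rhs)
    show "((\<lambda>x. hp x \<bullet> hp x) has_derivative (\<lambda>h. hp x \<bullet> hp h + hp h \<bullet> hp x)) (at x)"
      by (rule has_derivative_inner) (rule bounded_linear_imp_has_derivative[OF bl])+
    show "(\<lambda>h. hp x \<bullet> hp h + hp h \<bullet> hp x) = (\<lambda>h. (2 *\<^sub>R hp x) \<bullet> h)"
    proof
      fix h show "hp x \<bullet> hp h + hp h \<bullet> hp x = (2 *\<^sub>R hp x) \<bullet> h"
        using hh[of x h] inner_commute[of "hp h" "hp x"] unfolding inner_scaleR_left by linarith
    qed
  qed
  moreover have "continuous_on UNIV (\<lambda>x. 2 *\<^sub>R hp x)" by (intro continuous_intros continuous_hp)
  ultimately show ?thesis unfolding C1_gradient_def by blast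
qed

text \<open>Horizontal components are differentiated in horizontal directions only, so the height
  derivative of \<open>p\<close> does not enter the divergence. With t the argument of
  \<open>cap\<close>, cap' (t) 2 t = - cap (t) t^m / (1 + t^m), whence the divergence is q' + p cap
  (t) (n - 1 - t^m / (1 + t^m)). The bracket lies between n - 2 \<ge> 0 and n - 1, which gives both
  bounds; the length is controlled by \<open>soft_cap_le\<close>.\<close>

lemma capped_field:
  assumes p: "\<And>y. (p has_real_derivative p' y) (at y)" "continuous_on UNIV p'" "\<And>y. 0 < p y"
    and q: "\<And>y. (q has_real_derivative q' y) (at y)" "continuous_on UNIV q'" "\<And>y. \<bar>q y\<bar> < 1"
    and m: "0 < m"
  obtains g where "\<And>i. C1_gradient (\<lambda>x. capped m p q x $ i) (g i)"
    "\<And>x. q' (x $ k) \<le> (\<Sum>i\<in>UNIV. g i x $ i)"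
    "\<And>x. (\<Sum>i\<in>UNIV. g i x $ i) \<le> q' (x $ k) + real (CARD('n) - 1) * p (x $ k)"
    "\<And>x. norm (capped m p q x) \<le> 1"
proof -
  define a where "a y = (p y)\<^sup>2 / (1 - (q y)\<^sup>2)" for y
  define a' where "a' y = (2 * p y * p' y * (1 - (q y)\<^sup>2) - (p y)\<^sup>2 * (- (2 * q y * q' y))) / ((1 - (q y)\<^sup>2) * (1 - (q y)\<^sup>2))" for y
  define U where "U x = a (x $ k) * (normp k x)\<^sup>2" for x
  define \<kappa> where "\<kappa> t = (- (1 / (2 * real m))) * (1 + t ^ m) powr (- (1 / (2 * real m)) - 1) * (real m * t ^ (m - 1))" for t
  have q1: "0 < 1 - (q y)\<^sup>2" for y
    using q(3)[of y] by (simp add: abs_square_less_1)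
  have cp: "continuous_on UNIV p" "continuous_on UNIV q"
    using p(1) q(1) by (meson DERIV_continuous continuous_at_imp_continuous_on)+
  have Da: "(a has_real_derivative a' y) (at y)" for y
  proof -
    have d1: "((\<lambda>y. (p y)\<^sup>2) has_real_derivative 2 * p y * p' y) (at y)"
      using p(1) by (auto intro!: derivative_eq_intros)
    have d2: "((\<lambda>y. 1 - (q y)\<^sup>2) has_real_derivative - (2 * q y * q' y)) (at y)"
      using q(1) by (auto intro!: derivative_eq_intros)
    show ?thesis unfolding a_def[abs_def] a'_def
      by (rule DERIV_divide[OF d1 d2]) (use q1[of y] in simp)
  qed
  have ca': "continuous_on UNIV a'"
    unfolding a'_def[abs_def] using q1 less_imp_neq[OF q1]
    by (intro continuous_intros cp p(2) q(2)) (auto simp: less_imp_neq[OF q1, symmetric])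
  have apos: "0 < a y" for y using p(3)[of y] q1[of y] by (simp add: a_def)
  have U0: "0 \<le> U x" for x using apos[of "x $ k"] by (simp add: U_def)
  have pos: "0 < 1 + U x ^ m" for x using U0[of x] by (simp add: add_pos_nonneg)
  define gU where "gU x = a (x $ k) *\<^sub>R (2 *\<^sub>R hp x) + (normp k x)\<^sup>2 *\<^sub>R (a' (x $ k) *\<^sub>R axis k 1)" for x
  have gU: "C1_gradient U gU"
    unfolding U_def[abs_def] gU_def[abs_def]
    by (intro C1_gradient_mult C1_gradient_normp C1_gradient_compose'[OF C1_gradient_coord Da ca'])
  have cU: "continuous_on UNIV U" by (rule C1_gradient_continuous[OF gU])
  have gG: "C1_gradient (\<lambda>x. cap m (U x)) (\<lambda>x. \<kappa> (U x) *\<^sub>R gU x)"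
  proof (rule C1_gradient_compose[OF gU])
    fix x
    have "((\<lambda>t. 1 + t ^ m) has_real_derivative real m * U x ^ (m - 1)) (at (U x))"
      by (auto intro!: derivative_eq_intros)
    from DERIV_fun_powr[OF this pos, of "- (1 / (2 * real m))"]
    show "(cap m has_real_derivative \<kappa> (U x)) (at (U x))"
      unfolding cap_def[abs_def] \<kappa>_def by simp
  next
    show "continuous_on UNIV (\<lambda>x. \<kappa> (U x))"
      unfolding \<kappa>_def using pos by (intro continuous_intros cU) (auto simp: less_imp_neq[symmetric])
  qed
  have gp: "C1_gradient (\<lambda>x. p (x $ k)) (\<lambda>x. p' (x $ k) *\<^sub>R axis k 1)"
    by (rule C1_gradient_compose'[OF C1_gradient_coord p(1,2)])
  have gq: "C1_gradient (\<lambda>x. q (x $ k)) (\<lambda>x. q' (x $ k) *\<^sub>R axis k 1)"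
    by (rule C1_gradient_compose'[OF C1_gradient_coord q(1,2)])
  define g where "g i x = (if i = k then q' (x $ k) *\<^sub>R axis k 1 else
     (p (x $ k) * cap m (U x)) *\<^sub>R axis i 1
     + x $ i *\<^sub>R (p (x $ k) *\<^sub>R (\<kappa> (U x) *\<^sub>R gU x) + cap m (U x) *\<^sub>R (p' (x $ k) *\<^sub>R axis k 1)))" for i x
  have comp: "capped m p q x $ i = (if i = k then q (x $ k) else (p (x $ k) * cap m (U x)) * x $ i)" for x i
    by (simp add: capped_def U_def a_def hp_nth axis_def)
  have C: "C1_gradient (\<lambda>x. capped m p q x $ i) (g i)" for i
  proof (cases "i = k")
    case True
    then show ?thesis using gq by (simp add: comp g_def[abs_def])
  next
    case False
    then show ?thesis using C1_gradient_mult[OF C1_gradient_mult[OF gp gG] C1_gradient_coord[of i]]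
      by (simp add: comp g_def[abs_def])
  qed
  have key: "\<kappa> t * (2 * t) = - cap m t * (t ^ m / (1 + t ^ m))" if "0 \<le> t" for t
  proof -
    have p1: "0 < 1 + t ^ m" using that by (simp add: add_pos_nonneg)
    have tm: "t ^ (m - 1) * t = t ^ m" using m by (metis power_minus_mult)
    have c: "(1 + t ^ m) powr (- (1 / (2 * real m)) - 1) = cap m t / (1 + t ^ m)"
      using p1 by (simp add: cap_def powr_diff)
    have "\<kappa> t * (2 * t) = (- (1 / (2 * real m)) * 2 * real m) * (cap m t / (1 + t ^ m)) * (t ^ (m - 1) * t)"
      unfolding \<kappa>_def c by (simp only: mult_ac)
    then have "\<kappa> t * (2 * t) = (- (1 / (2 * real m)) * 2 * real m) * (cap m t / (1 + t ^ m)) * t ^ m"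
      unfolding tm .
    then show ?thesis using m by simp
  qed
  have sum: "(\<Sum>i\<in>UNIV. g i x $ i) = q' (x $ k) + p (x $ k) * cap m (U x) * (real (CARD('n) - 1) - U x ^ m / (1 + U x ^ m))" for x
  proof -
    have gi: "g i x $ i = p (x $ k) * cap m (U x) + p (x $ k) * \<kappa> (U x) * 2 * a (x $ k) * (x $ i)\<^sup>2" if "i \<in> UNIV - {k}" for i
      using that by (simp add: g_def gU_def hp_nth axis_def power2_eq_square)
    have n2: "(\<Sum>i\<in>UNIV - {k}. (x $ i)\<^sup>2) = (normp k x)\<^sup>2" by (simp add: normp_def sum_nonneg)
    have "(\<Sum>i\<in>UNIV. g i x $ i) = q' (x $ k) + (\<Sum>i\<in>UNIV - {k}. g i x $ i)"
      by (subst sum.remove[of _ k]) (auto simp: g_def)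
    also have "(\<Sum>i\<in>UNIV - {k}. g i x $ i) = (\<Sum>i\<in>UNIV - {k}. p (x $ k) * cap m (U x) + p (x $ k) * \<kappa> (U x) * 2 * a (x $ k) * (x $ i)\<^sup>2)"
      by (rule sum.cong[OF refl gi])
    also have "\<dots> = real (CARD('n) - 1) * (p (x $ k) * cap m (U x)) + p (x $ k) * \<kappa> (U x) * 2 * a (x $ k) * (normp k x)\<^sup>2"
      unfolding sum.distrib sum_distrib_left[symmetric] n2 by (simp add: card_Diff_singleton)
    also have "p (x $ k) * \<kappa> (U x) * 2 * a (x $ k) * (normp k x)\<^sup>2 = p (x $ k) * (\<kappa> (U x) * (2 * U x))"
      by (simp add: U_def)
    also have "\<kappa> (U x) * (2 * U x) = - cap m (U x) * (U x ^ m / (1 + U x ^ m))" by (rule key[OF U0])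
    finally show ?thesis by (simp add: algebra_simps)
  qed
  have n1: "1 \<le> real (CARD('n) - 1)" using card_ge_2 by simp
  have frac: "0 \<le> U x ^ m / (1 + U x ^ m)" "U x ^ m / (1 + U x ^ m) \<le> 1" for x
    using U0[of x] pos[of x] by (auto simp: divide_le_eq)
  have cap01: "0 \<le> cap m (U x)" "cap m (U x) \<le> 1" for x
  proof -
    show "0 \<le> cap m (U x)" by (simp add: cap_def)
    have "(1 + U x ^ m) powr (- (1 / (2 * real m))) \<le> 1 powr (- (1 / (2 * real m)))"
      using U0[of x] by (intro powr_mono2') auto
    then show "cap m (U x) \<le> 1" by (simp add: cap_def)
  qed
  show ?thesis
  proof (rule that[OF C])
    fix x
    have pc: "0 \<le> p (x $ k) * cap m (U x)" "p (x $ k) * cap m (U x) \<le> p (x $ k)"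
      using p(3)[of "x $ k"] cap01[of x] by (auto simp: mult_left_le)
    have "0 \<le> p (x $ k) * cap m (U x) * (real (CARD('n) - 1) - U x ^ m / (1 + U x ^ m))"
      using p(3)[of "x $ k"] cap01[of x] n1 frac[of x] by (intro mult_nonneg_nonneg) auto
    then show "q' (x $ k) \<le> (\<Sum>i\<in>UNIV. g i x $ i)" unfolding sum by linarith
    have "p (x $ k) * cap m (U x) * (real (CARD('n) - 1) - U x ^ m / (1 + U x ^ m)) \<le> p (x $ k) * real (CARD('n) - 1)"
    proof (rule mult_mono[OF pc(2)])
      show "real (CARD('n) - 1) - U x ^ m / (1 + U x ^ m) \<le> real (CARD('n) - 1)" using frac[of x] by simp
      show "0 \<le> p (x $ k)" using p(3)[of "x $ k"] by simp
      show "0 \<le> real (CARD('n) - 1) - U x ^ m / (1 + U x ^ m)" using n1 frac[of x] by linarith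
    qed
    then show "(\<Sum>i\<in>UNIV. g i x $ i) \<le> q' (x $ k) + real (CARD('n) - 1) * p (x $ k)"
      unfolding sum by (simp add: mult.commute)
    have "(norm (capped m p q x))\<^sup>2 = (p (x $ k) * cap m (U x))\<^sup>2 * (normp k x)\<^sup>2 + (q (x $ k))\<^sup>2"
      unfolding capped_def a_def[symmetric] U_def[symmetric]
      by (subst norm_decomp) (auto simp: hp_nth normp_eq power_mult_distrib)
    also have "(p (x $ k) * cap m (U x))\<^sup>2 * (normp k x)\<^sup>2 = (1 - (q (x $ k))\<^sup>2) * (U x * (cap m (U x))\<^sup>2)"
      using q1[of "x $ k"] by (simp add: U_def a_def power_mult_distrib)
    also have "\<dots> \<le> (1 - (q (x $ k))\<^sup>2) * 1"
      using soft_cap_le[OF U0 m, of x] q1[of "x $ k"] by (intro mult_left_mono) (auto simp: cap_def)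
    finally have "(norm (capped m p q x))\<^sup>2 \<le> 1\<^sup>2" by simp
    then show "norm (capped m p q x) \<le> 1" by (rule power2_le_imp_le) simp
  qed
qed

text \<open>The constant of \<open>V_increment\<close> plus n - 1 times that of \<open>P_le\<close>:
  they bound the vertical and the horizontal part of the divergence of the calibration.\<close>

definition Cmc :: real where
  "Cmc = (1 / s\<^sup>2 + T powr (2 * s - 1)) + real (CARD('n) - 1) * (1 / s + T powr (2 * s - 1))"

definition Hmc :: "real^'n \<Rightarrow> real" where
  "Hmc x = indicator body x * (Cmc * (x $ k) powr (1 - 2 * s))"

text \<open>\<open>rproj\<close> preserves heights and \<open>core\<close> lies in the strip, so the
  tip and the top carry no mass.\<close>

lemma AE_surface_strip: "AE x in surface_measure. x \<in> surf \<and> x \<in> strip"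
proof -
  have "AE x in lborel. 0 < ennreal (dens x) \<longrightarrow> rproj x \<in> surf \<and> rproj x \<in> strip"
    by (rule AE_I2) (use core_strip rproj_surf in \<open>auto simp: dens_def indicator_def strip_def rproj_nth split: if_splits\<close>)
  then have "AE x in density lborel (\<lambda>x. ennreal (dens x)). rproj x \<in> surf \<and> rproj x \<in> strip"
    by (subst AE_density) auto
  moreover have "{x. x \<in> surf \<and> x \<in> strip} \<in> sets borel"
    using sets.Int[OF borel_surf borel_strip] by (simp add: Int_def)
  ultimately show ?thesis unfolding surface_measure_def
    by (subst AE_distr_iff) auto
qed

text \<open>Since the divergence is nonnegative everywhere, adding mass outside the body does not pay,
  although \<open>Hmc\<close> vanishes there.\<close>

lemma calibration:
  obtains Y g where
    "\<And>j i. C1_gradient (\<lambda>x. Y j x $ i) (g j i)"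
    "\<And>j x. norm (Y j x) \<le> 1"
    "\<And>j x. 0 \<le> (\<Sum>i\<in>UNIV. g j i x $ i)"
    "\<And>j x. x \<in> body \<Longrightarrow> (\<Sum>i\<in>UNIV. g j i x $ i) \<le> Hmc x"
    "(\<lambda>j. \<integral>x. Y j x \<bullet> nu x \<partial>surface_measure) \<longlonglongrightarrow> measure surface_measure UNIV"
proof -
  \<comment> \<open>The double successor gives \<open>e j < 1\<close>, hence
    \<open>l j > 0\<close>.\<close>
  define e where "e j = 1 / real (Suc (Suc j))" for j
  have e0: "0 < e j" "e j < 1" for j by (auto simp: e_def)
  have elim: "e \<longlonglongrightarrow> 0" unfolding e_def using LIMSEQ_Suc[OF LIMSEQ_inverse_real_of_nat] by (simp add: inverse_eq_divide)
  define l where "l j = 1 - e j" for j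
  have l: "0 < l j" "l j < 1" for j using e0[of j] by (auto simp: l_def)
  have llim: "l \<longlonglongrightarrow> 1" unfolding l_def using tendsto_diff[OF tendsto_const elim, of 1] by simp
  \<comment> \<open>Below the height \<open>e j\<close> the factor \<open>P\<close>, which blows up
    at 0, is replaced by its value at \<open>e j\<close>.\<close>
  have cPm: "continuous_on UNIV (\<lambda>y. P (max y (e j)))" for j
  proof -
    have "continuous_on {0<..} P" using isCont_P by (auto intro: continuous_at_imp_continuous_on)
    then show ?thesis by (rule continuous_on_compose2) (use e0[of j] in \<open>auto intro!: continuous_intros\<close>)
  qed
  have "\<exists>F. (\<forall>y. (F has_real_derivative (V (y + e j) - V y) / e j) (at y)) \<and> (\<forall>y. \<exists>\<xi>\<in>{y..y + e j}. F y = V \<xi>)" for j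
    by (rule forward_average[OF continuous_on_V e0(1)[of j]]) blast
  then have "\<exists>F. \<forall>j. (\<forall>y. (F j has_real_derivative (V (y + e j) - V y) / e j) (at y)) \<and> (\<forall>y. \<exists>\<xi>\<in>{y..y + e j}. F j y = V \<xi>)"
    by (intro choice allI)
  then obtain q0 where q0: "\<And>j y. (q0 j has_real_derivative (V (y + e j) - V y) / e j) (at y)"
    "\<And>j y. \<exists>\<xi>\<in>{y..y + e j}. q0 j y = V \<xi>" by blast
  have "\<exists>F. (\<forall>y. (F has_real_derivative (P (max (y + e j) (e j)) - P (max y (e j))) / e j) (at y)) \<and> (\<forall>y. \<exists>\<xi>\<in>{y..y + e j}. F y = P (max \<xi> (e j)))" for j
    by (rule forward_average[OF cPm e0(1)[of j]]) blast
  then have "\<exists>F. \<forall>j. (\<forall>y. (F j has_real_derivative (P (max (y + e j) (e j)) - P (max y (e j))) / e j) (at y)) \<and> (\<forall>y. \<exists>\<xi>\<in>{y..y + e j}. F j y = P (max \<xi> (e j)))"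
    by (intro choice allI)
  then obtain p where p: "\<And>j y. (p j has_real_derivative (P (max (y + e j) (e j)) - P (max y (e j))) / e j) (at y)"
    "\<And>j y. \<exists>\<xi>\<in>{y..y + e j}. p j y = P (max \<xi> (e j))" by blast
  \<comment> \<open>The factor \<open>l j < 1\<close> makes |q| < 1 strictly, as
    \<open>capped_field\<close> divides by 1 - q^2; \<open>V\<close> itself takes the values -1 and
    1.\<close>
  define q where "q j y = l j * q0 j y" for j y
  define q' where "q' j y = l j * ((V (y + e j) - V y) / e j)" for j y
  have Dq: "(q j has_real_derivative q' j y) (at y)" for j y
    unfolding q_def[abs_def] q'_def by (rule DERIV_cmult[OF q0(1)])
  have cq': "continuous_on UNIV (q' j)" for j
    unfolding q'_def[abs_def] using e0(1)[of j]
    by (intro continuous_intros continuous_on_compose2[OF continuous_on_V[of UNIV]]) auto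
  have cp': "continuous_on UNIV (\<lambda>y. (P (max (y + e j) (e j)) - P (max y (e j))) / e j)" for j
  proof -
    have "continuous_on UNIV (\<lambda>y. P (max (y + e j) (e j)))"
      by (rule continuous_on_compose2[OF cPm, where f = "\<lambda>y. y + e j"]) (auto intro!: continuous_intros)
    then show ?thesis using cPm e0(1)[of j] by (intro continuous_intros) auto
  qed
  have ppos: "0 < p j y" for j y
    using p(2)[of y j] e0(1)[of j] by (auto intro!: P_pos)
  have q1: "\<bar>q j y\<bar> < 1" for j y
  proof -
    have "\<bar>q0 j y\<bar> \<le> 1" using q0(2)[of y j] V_le_1 V_ge_m1 by (auto simp: abs_le_iff minus_le_iff)
    then have "l j * \<bar>q0 j y\<bar> \<le> l j * 1" using l[of j] by (intro mult_left_mono) auto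
    also have "\<dots> < 1" using l[of j] by simp
    finally show ?thesis using l[of j] by (simp add: q_def abs_mult)
  qed
  define Y where "Y j = capped (Suc j) (p j) (q j)" for j
  have "\<exists>g. (\<forall>i. C1_gradient (\<lambda>x. Y j x $ i) (g i)) \<and> (\<forall>x. q' j (x $ k) \<le> (\<Sum>i\<in>UNIV. g i x $ i))
      \<and> (\<forall>x. (\<Sum>i\<in>UNIV. g i x $ i) \<le> q' j (x $ k) + real (CARD('n) - 1) * p j (x $ k)) \<and> (\<forall>x. norm (Y j x) \<le> 1)" for j
    unfolding Y_def
    by (rule capped_field[OF p(1) cp' ppos Dq cq' q1 zero_less_Suc]) blast
  then have "\<exists>g. \<forall>j. (\<forall>i. C1_gradient (\<lambda>x. Y j x $ i) (g j i)) \<and> (\<forall>x. q' j (x $ k) \<le> (\<Sum>i\<in>UNIV. g j i x $ i))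
      \<and> (\<forall>x. (\<Sum>i\<in>UNIV. g j i x $ i) \<le> q' j (x $ k) + real (CARD('n) - 1) * p j (x $ k)) \<and> (\<forall>x. norm (Y j x) \<le> 1)"
    by (intro choice allI)
  then obtain g where g: "\<And>j i. C1_gradient (\<lambda>x. Y j x $ i) (g j i)"
    "\<And>j x. q' j (x $ k) \<le> (\<Sum>i\<in>UNIV. g j i x $ i)"
    "\<And>j x. (\<Sum>i\<in>UNIV. g j i x $ i) \<le> q' j (x $ k) + real (CARD('n) - 1) * p j (x $ k)"
    and Y1: "\<And>j x. norm (Y j x) \<le> 1" by blast
  have q'0: "0 \<le> q' j y" for j y
    using V_mono[of y "y + e j"] e0(1)[of j] l[of j] by (simp add: q'_def)
  have up: "(\<Sum>i\<in>UNIV. g j i x $ i) \<le> Hmc x" if x: "x \<in> body" for j x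
  proof -
    let ?y = "x $ k"
    have y: "0 < ?y" "?y < T" using body_nth[OF x] by auto
    have "(V (?y + e j) - V ?y) / e j \<le> (1 / s\<^sup>2 + T powr (2 * s - 1)) * ?y powr (1 - 2 * s)"
      using V_increment[of ?y "?y + e j"] y e0(1)[of j] by (simp add: divide_le_eq mult_ac)
    moreover have "0 \<le> (V (?y + e j) - V ?y) / e j" using V_mono[of ?y "?y + e j"] e0(1)[of j] by simp
    then have "q' j ?y \<le> (V (?y + e j) - V ?y) / e j" unfolding q'_def using l[of j] by (intro mult_left_le_one_le) auto
    ultimately have a: "q' j ?y \<le> (1 / s\<^sup>2 + T powr (2 * s - 1)) * ?y powr (1 - 2 * s)" by linarith
    obtain \<xi> where \<xi>: "\<xi> \<in> {?y..?y + e j}" "p j ?y = P (max \<xi> (e j))" using p(2) by blast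
    \<comment> \<open>The window looks upward and \<open>P\<close> decreases, so neither averaging
      nor the truncation at \<open>e j\<close> exceeds the value at the height itself.\<close>
    have "p j ?y \<le> P ?y" unfolding \<xi>(2) using \<xi>(1) y by (intro P_antimono) auto
    also have "\<dots> \<le> (1 / s + T powr (2 * s - 1)) * ?y powr (1 - 2 * s)" using P_le y by simp
    finally have "real (CARD('n) - 1) * p j ?y \<le> real (CARD('n) - 1) * ((1 / s + T powr (2 * s - 1)) * ?y powr (1 - 2 * s))"
      by (intro mult_left_mono) auto
    moreover have "Hmc x = (1 / s\<^sup>2 + T powr (2 * s - 1)) * ?y powr (1 - 2 * s)
        + real (CARD('n) - 1) * ((1 / s + T powr (2 * s - 1)) * ?y powr (1 - 2 * s))"
      using x by (simp add: Hmc_def Cmc_def distrib_right)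
    ultimately show ?thesis using g(3)[of j x] a by linarith
  qed
  have squeeze: "x \<longlonglongrightarrow> y" if "\<And>j. x j \<in> {y..y + e j}" for x :: "nat \<Rightarrow> real" and y
  proof (rule tendsto_sandwich[where f = "\<lambda>_. y" and h = "\<lambda>j. y + e j"])
    show "(\<lambda>j. y + e j) \<longlonglongrightarrow> y" using tendsto_add[OF tendsto_const elim, of y] by simp
  qed (use that in auto)
  have lim: "(\<lambda>j. Y j x \<bullet> nu x) \<longlonglongrightarrow> 1" if x: "x \<in> surf" "x \<in> strip" for x
  proof -
    let ?y = "x $ k"
    have y: "0 < ?y" "?y < T" using x(2) by (auto simp: strip_def)
    have "\<exists>\<xi>. \<forall>j. \<xi> j \<in> {?y..?y + e j} \<and> q0 j ?y = V (\<xi> j)" using q0(2) by (intro choice) blast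
    then obtain \<xi> where \<xi>: "\<And>j. \<xi> j \<in> {?y..?y + e j}" "\<And>j. q0 j ?y = V (\<xi> j)" by blast
    have "(\<lambda>j. V (\<xi> j)) \<longlonglongrightarrow> V ?y"
      by (rule isCont_tendsto_compose[OF isCont_V squeeze[OF \<xi>(1)]])
    then have ql: "(\<lambda>j. q j ?y) \<longlonglongrightarrow> V ?y"
      unfolding q_def \<xi>(2) using tendsto_mult[OF llim] by fastforce
    have "\<exists>\<eta>. \<forall>j. \<eta> j \<in> {?y..?y + e j} \<and> p j ?y = P (max (\<eta> j) (e j))" using p(2) by (intro choice) blast
    then obtain \<eta> where \<eta>: "\<And>j. \<eta> j \<in> {?y..?y + e j}" "\<And>j. p j ?y = P (max (\<eta> j) (e j))" by blast
    have "(\<lambda>j. max (\<eta> j) (e j)) \<longlonglongrightarrow> max ?y 0" by (intro tendsto_max squeeze \<eta>(1) elim)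
    then have "(\<lambda>j. max (\<eta> j) (e j)) \<longlonglongrightarrow> ?y" using y by simp
    then have pl: "(\<lambda>j. p j ?y) \<longlonglongrightarrow> P ?y"
      unfolding \<eta>(2) by (rule isCont_tendsto_compose[OF isCont_P[OF y(1)]])
    have V1: "0 < 1 - (V ?y)\<^sup>2" using abs_V_less_1[OF y] by simp
    define t where "t j = (p j ?y)\<^sup>2 / (1 - (q j ?y)\<^sup>2) * (normp k x)\<^sup>2" for j
    have "t \<longlonglongrightarrow> (P ?y)\<^sup>2 / (1 - (V ?y)\<^sup>2) * (normp k x)\<^sup>2"
      unfolding t_def using V1 by (intro tendsto_intros pl ql) auto
    \<comment> \<open>On the surface the untruncated limit field has length exactly 1 by
      \<open>PQV\<close>, so the argument of \<open>cap\<close> tends to the threshold 1, the case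
      treated by \<open>soft_cap_limit\<close>.\<close>
    also have "(P ?y)\<^sup>2 / (1 - (V ?y)\<^sup>2) * (normp k x)\<^sup>2 = 1"
      using PQV[OF y] V1 x(1) by (simp add: surf_def field_simps)
    finally have tl: "t \<longlonglongrightarrow> 1" .
    have t0: "0 \<le> t j" for j
    proof -
      have "(q j ?y)\<^sup>2 < 1" using q1[of j ?y] by (simp add: abs_square_less_1)
      then show ?thesis by (simp add: t_def)
    qed
    have "(\<lambda>j. (p j ?y * cap (Suc j) (t j)) *\<^sub>R hp x + q j ?y *\<^sub>R axis k 1) \<longlonglongrightarrow> (P ?y * 1) *\<^sub>R hp x + V ?y *\<^sub>R axis k 1"
      unfolding cap_def by (intro tendsto_intros pl ql soft_cap_limit[OF t0 tl])
    then have "(\<lambda>j. Y j x) \<longlonglongrightarrow> normal x" by (simp add: Y_def capped_def t_def normal_def)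
    then have "(\<lambda>j. Y j x \<bullet> nu x) \<longlonglongrightarrow> normal x \<bullet> nu x" by (intro tendsto_inner tendsto_const)
    moreover have "normal x \<bullet> nu x = 1" using x(1) norm_normal[OF x(1)] by (simp add: nu_def norm_eq_1)
    ultimately show ?thesis by simp
  qed
  have cY: "continuous_on UNIV (Y j)" for j
    using C1_gradient_continuous[OF g(1)] by (subst continuous_on_componentwise) (auto simp: Basis_vec_def inner_axis)
  have [measurable]: "Y j \<in> borel_measurable borel" for j by (rule borel_measurable_continuous_onI[OF cY])
  have "(\<lambda>j. \<integral>x. Y j x \<bullet> nu x \<partial>surface_measure) \<longlonglongrightarrow> (\<integral>x. 1 \<partial>surface_measure)"
  proof (rule integral_dominated_convergence[where w = "\<lambda>_. 1"])
    show "AE x in surface_measure. (\<lambda>j. Y j x \<bullet> nu x) \<longlonglongrightarrow> 1"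
      using AE_surface_strip by eventually_elim (use lim in blast)
    show "AE x in surface_measure. norm (Y j x \<bullet> nu x) \<le> 1" for j
    proof (rule AE_I2)
      fix x show "norm (Y j x \<bullet> nu x) \<le> 1"
        using Cauchy_Schwarz_ineq2[of "Y j x" "nu x"] Y1[of j x] by (simp add: norm_nu)
    qed
  qed auto
  then have "(\<lambda>j. \<integral>x. Y j x \<bullet> nu x \<partial>surface_measure) \<longlonglongrightarrow> measure surface_measure UNIV" by simp
  with that[of Y g] g(1) Y1 order_trans[OF q'0 g(2)] up show ?thesis by simp
qed

section \<open>Integrability of the curvature\<close>

lemma Cmc_nonneg: "0 \<le> Cmc"
  using s_pos by (simp add: Cmc_def)

lemma Hmc_nonneg: "0 \<le> Hmc x"
  using Cmc_nonneg by (simp add: Hmc_def)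

lemma borel_Hmc[measurable]: "Hmc \<in> borel_measurable borel"
  unfolding Hmc_def[abs_def] by measurable

text \<open>Dividing (2 s - 1) p < s (n - 1) + 1 by s = 1 / (1 + \<alpha>) gives p (1 - \<alpha>) <
  n + \<alpha>, that is p - n < \<alpha> (p + 1).\<close>

lemma Hmc_powr_finite:
  assumes p: "1 \<le> p" "(p - real CARD('n)) / (p + 1) < \<alpha>"
  shows "(\<integral>\<^sup>+x. ennreal (\<bar>Hmc x\<bar> powr p) \<partial>lborel) < \<infinity>"
proof -
  have "(2 * s - 1) * p < s * real (CARD('n) - 1) + 1"
  proof -
    have "p - real CARD('n) < \<alpha> * (p + 1)" using p by (simp add: pos_divide_less_eq)
    then have "p * (1 - \<alpha>) < real CARD('n) + \<alpha>" by (simp add: algebra_simps)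
    then have "s * (p * (1 - \<alpha>)) < s * (real CARD('n) + \<alpha>)" using s_pos by simp
    moreover have s1: "s * (1 + \<alpha>) = 1" using \<alpha>_pos by (simp add: s_def)
    then have e: "2 * s - 1 = s * (1 - \<alpha>)" by (simp add: algebra_simps)
    have "(2 * s - 1) * p = s * (p * (1 - \<alpha>))" unfolding e by simp
    moreover have "s * real (CARD('n) - 1) + 1 = s * (real CARD('n) + \<alpha>)"
      using s1 card_ge_2 by (simp add: of_nat_diff algebra_simps)
    ultimately show ?thesis by linarith
  qed
  from nn_integral_nth_powr_finite[OF this]
  have fin: "(\<integral>\<^sup>+x. indicator body x * ennreal ((x $ k) powr (- ((2 * s - 1) * p))) \<partial>lborel) < \<infinity>" .
  have "\<bar>Hmc x\<bar> powr p = Cmc powr p * (indicator body x * (x $ k) powr (- ((2 * s - 1) * p)))" for x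
    using Cmc_nonneg p by (auto simp: Hmc_def indicator_def abs_mult powr_mult powr_powr algebra_simps)
  then have "(\<integral>\<^sup>+x. ennreal (\<bar>Hmc x\<bar> powr p) \<partial>lborel)
      = (\<integral>\<^sup>+x. ennreal (Cmc powr p) * (indicator body x * ennreal ((x $ k) powr (- ((2 * s - 1) * p)))) \<partial>lborel)"
    by (intro nn_integral_cong) (auto simp: indicator_def ennreal_mult[symmetric])
  also have "\<dots> = ennreal (Cmc powr p) * (\<integral>\<^sup>+x. indicator body x * ennreal ((x $ k) powr (- ((2 * s - 1) * p))) \<partial>lborel)"
    by (intro nn_integral_cmult) measurable
  also have "\<dots> < \<infinity>" using fin by (simp add: ennreal_mult_less_top)
  finally show ?thesis .
qed

lemma integrable_Hmc: "integrable lborel Hmc"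
proof (rule integrableI_nonneg)
  have "(1 - real CARD('n)) / (1 + 1) < \<alpha>" using card_ge_2 \<alpha>_pos by (intro order_le_less_trans[OF _ \<alpha>_pos]) auto
  from Hmc_powr_finite[OF order_refl this] show "(\<integral>\<^sup>+x. ennreal (Hmc x) \<partial>lborel) < \<infinity>"
    using Hmc_nonneg by simp
qed (auto simp: Hmc_nonneg)

lemma integrable_Hmc_lebesgue: "integrable lebesgue Hmc"
  using integrable_Hmc by (simp add: integrable_completion)

lemma Lp_on_Hmc:
  assumes "1 \<le> p" "(p - real CARD('n)) / (p + 1) < \<alpha>" and U: "U \<in> sets borel"
  shows "Lp_on p U Hmc"
  unfolding Lp_on_def set_borel_measurable_def
proof
  have [measurable]: "U \<in> sets borel" by (rule U)
  have "(\<lambda>x. indicator U x *\<^sub>R Hmc x) \<in> borel_measurable lborel" by measurable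
  then show "(\<lambda>x. indicator U x *\<^sub>R Hmc x) \<in> borel_measurable lebesgue" by (rule measurable_completion)
  have "(\<integral>\<^sup>+x. indicator U x * ennreal (\<bar>Hmc x\<bar> powr p) \<partial>lebesgue) = (\<integral>\<^sup>+x. indicator U x * ennreal (\<bar>Hmc x\<bar> powr p) \<partial>lborel)"
    by (intro nn_integral_completion) measurable
  also have "\<dots> \<le> (\<integral>\<^sup>+x. ennreal (\<bar>Hmc x\<bar> powr p) \<partial>lborel)"
    by (intro nn_integral_mono) (auto simp: indicator_def)
  also have "\<dots> < \<infinity>" by (rule Hmc_powr_finite[OF assms(1,2)])
  finally show "(\<integral>\<^sup>+x. indicator U x * ennreal (\<bar>Hmc x\<bar> powr p) \<partial>lebesgue) < \<infinity>" .
qed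

section \<open>Comparison of perimeters\<close>

lemma c1c_mono: "c1c U \<phi> \<Longrightarrow> c1c UNIV \<phi>"
  by (simp add: c1c_def)

lemma perimeter_body_le: "perimeter body U \<le> ereal (measure surface_measure UNIV)"
  unfolding perimeter_def
proof (rule SUP_least)
  fix \<phi> assume "\<phi> \<in> {\<phi>. c1c U \<phi> \<and> (\<forall>x. norm (\<phi> x) \<le> 1)}"
  then have \<phi>: "c1c UNIV \<phi>" "\<And>x. norm (\<phi> x) \<le> 1" using c1c_mono by auto
  have "(\<integral>x. \<phi> x \<bullet> nu x \<partial>surface_measure) \<le> (\<integral>x. 1 \<partial>surface_measure)"
  proof (rule integral_mono[OF vector_gauss_green(1)[OF \<phi>(1)]])
    fix x show "\<phi> x \<bullet> nu x \<le> 1"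
      using norm_cauchy_schwarz[of "\<phi> x" "nu x"] \<phi>(2)[of x] by (simp add: norm_nu)
  qed simp
  then show "ereal (set_lebesgue_integral lebesgue body (divg \<phi>)) \<le> ereal (measure surface_measure UNIV)"
    unfolding vector_gauss_green(2)[OF \<phi>(1)] by simp
qed

text \<open>The calibration is defined on the whole space and has to be cut off inside the ball.
  \<open>\<zeta>\<close> equals 1 on an open neighbourhood of \<open>K\<close>, so its gradient
  vanishes on \<open>K\<close> and the divergence of the field is unchanged there.\<close>

lemma smooth_cutoff_ball:
  fixes K :: "(real^'n) set"
  assumes K: "compact K" "K \<subseteq> ball c0 r0" and "K \<noteq> {}"
  obtains \<zeta> \<zeta>' O' K' where "C1_gradient \<zeta> \<zeta>'" "\<And>x. 0 \<le> \<zeta> x" "\<And>x. \<zeta> x \<le> 1"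
    "open O'" "K \<subseteq> O'" "\<And>x. x \<in> O' \<Longrightarrow> \<zeta> x = 1"
    "compact K'" "K' \<subseteq> ball c0 r0" "\<And>x. x \<notin> K' \<Longrightarrow> \<zeta> x = 0"
proof -
  obtain x1 where x1: "x1 \<in> K" "\<And>x. x \<in> K \<Longrightarrow> dist c0 x \<le> dist c0 x1"
    using continuous_attains_sup[OF K(1) assms(3) continuous_on_dist[OF continuous_on_const continuous_on_id, of K c0]]
    by auto
  define r1 where "r1 = dist c0 x1"
  have r1: "0 \<le> r1" "r1 < r0" "\<And>x. x \<in> K \<Longrightarrow> dist c0 x \<le> r1" using x1 K(2) by (auto simp: r1_def)
  \<comment> \<open>Two radii strictly between the largest distance r1 of a point of
    \<open>K\<close> and the radius r0. With the choice of \<kappa>, \<theta> is 3 at distance r2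
    and 0 at distance r3, which suits the thresholds 1 and 3 of \<open>smooth_step\<close>.\<close>
  define r2 where "r2 = (2 * r1 + r0) / 3"
  define r3 where "r3 = (r1 + 2 * r0) / 3"
  have r: "r1 < r2" "r2 < r3" "r3 < r0" using r1 by (auto simp: r2_def r3_def)
  define \<kappa> where "\<kappa> = 3 / (r3\<^sup>2 - r2\<^sup>2)"
  have den: "0 < r3\<^sup>2 - r2\<^sup>2" using r r1 by (simp add: power_strict_mono)
  have \<kappa>: "0 < \<kappa>" using den by (simp add: \<kappa>_def)
  obtain \<xi> \<xi>' :: "real \<Rightarrow> real" where \<xi>:
    "\<And>y. (\<xi> has_real_derivative \<xi>' y) (at y)" "continuous_on UNIV \<xi>'"
    "\<And>y. 0 \<le> \<xi> y" "\<And>y. \<xi> y \<le> 1" "\<And>y. y \<le> 1 \<Longrightarrow> \<xi> y = 0" "\<And>y. y \<ge> 3 \<Longrightarrow> \<xi> y = 1"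
    using smooth_step by metis
  define \<theta> where "\<theta> x = \<kappa> * (r3\<^sup>2 + (-1) * (norm (x - c0))\<^sup>2)" for x :: "real^'n"
  have "\<exists>g. C1_gradient (\<lambda>x. \<xi> (\<theta> x)) g"
    unfolding \<theta>_def
    using C1_gradient_compose'[OF C1_gradient_mult[OF C1_gradient_const C1_gradient_add[OF C1_gradient_const
        C1_gradient_mult[OF C1_gradient_const C1_gradient_power2_norm]]] \<xi>(1,2)] by blast
  then obtain g where g: "C1_gradient (\<lambda>x. \<xi> (\<theta> x)) g" by blast
  show ?thesis
  proof (rule that[OF g])
    show "open (ball c0 r2)" "compact (cball c0 r3)" by auto
    show "K \<subseteq> ball c0 r2" using r1(3) r by force
    show "cball c0 r3 \<subseteq> ball c0 r0" using r by auto
    show "\<xi> (\<theta> x) = 1" if "x \<in> ball c0 r2" for x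
    proof -
      have "(norm (x - c0))\<^sup>2 \<le> r2\<^sup>2" using that by (intro power_mono) (auto simp: dist_norm norm_minus_commute)
      then have "\<kappa> * (r3\<^sup>2 - r2\<^sup>2) \<le> \<theta> x" unfolding \<theta>_def using \<kappa> by (intro mult_left_mono) auto
      moreover have "3 / d * d = 3" if "0 < d" for d :: real using that by simp
      then have "\<kappa> * (r3\<^sup>2 - r2\<^sup>2) = 3" unfolding \<kappa>_def using den by blast
      ultimately show ?thesis using \<xi>(6) by simp
    qed
    show "\<xi> (\<theta> x) = 0" if "x \<notin> cball c0 r3" for x
    proof -
      have "r3\<^sup>2 \<le> (norm (x - c0))\<^sup>2" using that r r1 by (intro power_mono) (auto simp: dist_norm norm_minus_commute)
      then have "\<theta> x \<le> 0" using \<kappa> by (simp add: \<theta>_def mult_nonneg_nonpos)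
      then show ?thesis using \<xi>(5) by simp
    qed
  qed (use \<xi> in auto)
qed

text \<open>With D the divergence of the cut off calibration, D \<ge> 0 on \<open>F\<close>, D \<le>
  Hmc on the body and Hmc = 0 outside it; so integrating D over \<open>F\<close> instead of the body
  loses at most the difference of the curvature integrals. The integral over the body is a flux that
  tends to the full surface mass.\<close>

lemma perimeter_lower_bound:
  assumes F: "F \<in> sets lebesgue" and U: "closure body \<subseteq> ball c0 r0"
    and D: "compact (closure ((F - body) \<union> (body - F)))" "closure ((F - body) \<union> (body - F)) \<subseteq> ball c0 r0"
  shows "ereal (measure surface_measure UNIV - (set_lebesgue_integral lebesgue body Hmc - set_lebesgue_integral lebesgue F Hmc))
    \<le> perimeter F (ball c0 r0)"
proof -
  \<comment> \<open>Contains the body and \<open>F\<close> and stays in the ball; the cutoff is 1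
    near \<open>K\<close>, so both divergence integrals see the calibration itself.\<close>
  define K where "K = closure body \<union> closure ((F - body) \<union> (body - F))"
  have K: "compact K" "K \<subseteq> ball c0 r0"
    using D U bounded_body by (auto simp: K_def compact_closure intro: compact_Un)
  have FK: "F \<subseteq> K" "body \<subseteq> K" unfolding K_def using closure_subset[of body] closure_subset[of "(F - body) \<union> (body - F)"] by blast+
  have Kne: "K \<noteq> {}"
  proof -
    have "1 *\<^sub>R axis k 1 \<in> closure body" by (rule axis_in_closure) (use T_gt_1 in auto)
    then have "1 *\<^sub>R axis k 1 \<in> K" unfolding K_def by (rule UnI1)
    then show ?thesis by (metis empty_iff)
  qed
  obtain \<zeta> \<zeta>' O' K' where
    \<zeta>: "C1_gradient \<zeta> \<zeta>'" "\<And>x. 0 \<le> \<zeta> x" "\<And>x. \<zeta> x \<le> 1"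
    and O': "open O'" "K \<subseteq> O'" "\<And>x. x \<in> O' \<Longrightarrow> \<zeta> x = 1"
    and K': "compact K'" "K' \<subseteq> ball c0 r0" "\<And>x. x \<notin> K' \<Longrightarrow> \<zeta> x = 0"
    using smooth_cutoff_ball[OF K Kne] by blast
  obtain Y g where Y: "\<And>j i. C1_gradient (\<lambda>x. Y j x $ i) (g j i)"
    "\<And>j x. norm (Y j x) \<le> 1"
    "\<And>j x. 0 \<le> (\<Sum>i\<in>UNIV. g j i x $ i)"
    "\<And>j x. x \<in> body \<Longrightarrow> (\<Sum>i\<in>UNIV. g j i x $ i) \<le> Hmc x"
    "(\<lambda>j. \<integral>x. Y j x \<bullet> nu x \<partial>surface_measure) \<longlonglongrightarrow> measure surface_measure UNIV"
    using calibration by blast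
  let ?h = "set_lebesgue_integral lebesgue body Hmc - set_lebesgue_integral lebesgue F Hmc"
  have lower: "ereal ((\<integral>x. Y j x \<bullet> nu x \<partial>surface_measure) - ?h) \<le> perimeter F (ball c0 r0)" for j
  proof -
    define \<phi> where "\<phi> x = \<zeta> x *\<^sub>R Y j x" for x
    define G where "G i x = \<zeta> x *\<^sub>R g j i x + Y j x $ i *\<^sub>R \<zeta>' x" for i x
    have G: "C1_gradient (\<lambda>x. \<phi> x $ i) (G i)" for i
      using C1_gradient_mult[OF \<zeta>(1) Y(1)[of j i]] by (simp add: \<phi>_def G_def[abs_def])
    have c: "c1c (ball c0 r0) \<phi>"
      by (rule c1cI[OF G K'(1,2)]) (simp add: \<phi>_def K'(3))
    have n1: "norm (\<phi> x) \<le> 1" for x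
      using \<zeta>(2,3) Y(2) by (simp add: \<phi>_def mult_le_one)
    have dv: "divg \<phi> = (\<lambda>x. \<Sum>i\<in>UNIV. G i x $ i)"
      using C1_gradient_components(3)[of \<phi> G, OF G] by auto
    have dK: "divg \<phi> x = (\<Sum>i\<in>UNIV. g j i x $ i)" if "x \<in> K" for x
    proof -
      have "x \<in> O'" using that O'(2) by blast
      then have "\<zeta>' x = 0" "\<zeta> x = 1" using C1_gradient_eq_0[OF \<zeta>(1) O'(1)] O'(3) by auto
      then show ?thesis by (simp add: dv G_def)
    qed
    have cG: "continuous_on UNIV (G i)" for i using G[of i] by (simp add: C1_gradient_def)
    have cd: "continuous_on UNIV (divg \<phi>)" unfolding dv by (intro continuous_intros cG)
    have d0: "divg \<phi> x = 0" if "x \<notin> K'" for x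
    proof -
      have "G i x = 0" for i
        by (rule C1_gradient_eq_0[OF G, where S = "- K'" and c = 0]) (use that K' compact_imp_closed in \<open>auto simp: \<phi>_def\<close>)
      then show ?thesis by (simp add: dv)
    qed
    have id: "integrable lebesgue (divg \<phi>)"
    proof -
      obtain \<rho> where \<rho>: "K' \<subseteq> ball 0 \<rho>" using compact_imp_bounded[OF K'(1)] bounded_subset_ballD by blast
      have "bounded (divg \<phi> ` K')"
        by (intro compact_imp_bounded compact_continuous_image K' continuous_on_subset[OF cd]) auto
      then obtain B where "\<And>x. x \<in> K' \<Longrightarrow> \<bar>divg \<phi> x\<bar> \<le> B" by (auto simp: bounded_iff)
      then have B: "\<bar>divg \<phi> x\<bar> \<le> \<bar>B\<bar>" for x using d0[of x] by (cases "x \<in> K'") force+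
      have "integrable lborel (divg \<phi>)"
      proof (rule integrable_bounded_support[OF _ B])
        show "divg \<phi> \<in> borel_measurable borel" by (rule borel_measurable_continuous_onI[OF cd])
        show "divg \<phi> x = 0" if "x \<notin> cball 0 \<rho>" for x
        proof (rule d0)
          show "x \<notin> K'" using that \<rho> ball_subset_cball by blast
        qed
      qed
      then show ?thesis
        using integrable_completion[of "divg \<phi>" lborel] borel_measurable_continuous_onI[OF cd] by simp
    qed
    have bl: "body \<in> sets lebesgue" using borel_body by simp
    have iF: "integrable lebesgue (\<lambda>x. indicator F x *\<^sub>R divg \<phi> x)" "integrable lebesgue (\<lambda>x. indicator body x *\<^sub>R divg \<phi> x)"
      "integrable lebesgue (\<lambda>x. indicator F x *\<^sub>R Hmc x)" "integrable lebesgue (\<lambda>x. indicator body x *\<^sub>R Hmc x)"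
      by (intro integrable_mult_indicator F bl id integrable_Hmc_lebesgue)+
    have "set_lebesgue_integral lebesgue body (divg \<phi>) - ?h
       = (\<integral>x. indicator body x *\<^sub>R divg \<phi> x - (indicator body x *\<^sub>R Hmc x - indicator F x *\<^sub>R Hmc x) \<partial>lebesgue)"
      using iF by (simp add: set_lebesgue_integral_def)
    also have "\<dots> \<le> (\<integral>x. indicator F x *\<^sub>R divg \<phi> x \<partial>lebesgue)"
    proof (rule integral_mono)
      fix x
      \<comment> \<open>On the body minus \<open>F\<close> the claim is D \<le> Hmc, on
        \<open>F\<close> minus the body it is 0 \<le> D, and on the intersection both sides
        agree.\<close>
      have "0 \<le> divg \<phi> x" if "x \<in> F" using dK Y(3) FK that by auto
      moreover have "divg \<phi> x \<le> Hmc x" if "x \<in> body" using dK Y(4) FK that by auto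
      moreover have "Hmc x = 0" if "x \<notin> body" using that by (simp add: Hmc_def)
      ultimately show "indicator body x *\<^sub>R divg \<phi> x - (indicator body x *\<^sub>R Hmc x - indicator F x *\<^sub>R Hmc x) \<le> indicator F x *\<^sub>R divg \<phi> x"
        by (cases "x \<in> body"; cases "x \<in> F") auto
    qed (use iF in auto)
    finally have a: "set_lebesgue_integral lebesgue body (divg \<phi>) - ?h \<le> set_lebesgue_integral lebesgue F (divg \<phi>)"
      by (simp add: set_lebesgue_integral_def)
    have "set_lebesgue_integral lebesgue body (divg \<phi>) = (\<integral>x. \<phi> x \<bullet> nu x \<partial>surface_measure)"
      by (rule vector_gauss_green(2)[OF c1c_mono[OF c]])
    also have "\<dots> = (\<integral>x. Y j x \<bullet> nu x \<partial>surface_measure)"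
    proof (rule integral_cong_AE)
      have cY: "continuous_on UNIV (Y j)"
        using C1_gradient_continuous[OF Y(1)] by (subst continuous_on_componentwise) (auto simp: Basis_vec_def inner_axis)
      have [measurable]: "Y j \<in> borel_measurable borel" by (rule borel_measurable_continuous_onI[OF cY])
      show "(\<lambda>x. Y j x \<bullet> nu x) \<in> borel_measurable surface_measure" by measurable
      show "(\<lambda>x. \<phi> x \<bullet> nu x) \<in> borel_measurable surface_measure"
        using vector_gauss_green(1)[OF c1c_mono[OF c]] by auto
      show "AE x in surface_measure. \<phi> x \<bullet> nu x = Y j x \<bullet> nu x"
        using AE_surface_measure
      proof eventually_elim
        case (elim x)
        then have "x \<in> O'" using surf_subset_closure O'(2) unfolding K_def by blast
        then show ?case using O'(3) by (simp add: \<phi>_def)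
      qed
    qed
    finally have "ereal ((\<integral>x. Y j x \<bullet> nu x \<partial>surface_measure) - ?h) \<le> ereal (set_lebesgue_integral lebesgue F (divg \<phi>))"
      using a by simp
    also have "\<dots> \<le> perimeter F (ball c0 r0)"
      unfolding perimeter_def using c n1 by (intro SUP_upper) auto
    finally show ?thesis .
  qed
  have "(\<lambda>j. ereal ((\<integral>x. Y j x \<bullet> nu x \<partial>surface_measure) - ?h)) \<longlonglongrightarrow> ereal (measure surface_measure UNIV - ?h)"
    by (intro tendsto_intros Y(5))
  then show ?thesis by (rule LIMSEQ_le_const2) (use lower in auto)
qed

text \<open>The total surface mass bounds the perimeter of the body from above and, corrected by the
  curvature integrals, that of \<open>F\<close> from below. Both sets lie in the ball, so
  intersecting with it changes nothing.\<close>

lemma var_mean_curv_body: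
  assumes U: "closure body \<subseteq> ball c0 r0"
  shows "var_mean_curv body (ball c0 r0) Hmc"
  unfolding var_mean_curv_def
proof (intro conjI ballI impI)
  show "body \<in> sets lebesgue" using borel_body by simp
  show "perimeter body (ball c0 r0) < \<infinity>" using perimeter_body_le[of "ball c0 r0"] by (rule order_le_less_trans) simp
  show "set_integrable lebesgue (ball c0 r0) Hmc"
    unfolding set_integrable_def using integrable_Hmc_lebesgue by (intro integrable_mult_indicator) auto
  fix F assume F: "F \<in> sets lebesgue"
    and D: "compact (closure (F - body \<union> (body - F))) \<and> closure (F - body \<union> (body - F)) \<subseteq> ball c0 r0"
  have bU: "body \<inter> ball c0 r0 = body" using U closure_subset by blast
  have FU: "F \<inter> ball c0 r0 = F"
    using bU D closure_subset[of "F - body \<union> (body - F)"] by blast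
  let ?M = "measure surface_measure UNIV"
  let ?b = "set_lebesgue_integral lebesgue body Hmc" and ?f = "set_lebesgue_integral lebesgue F Hmc"
  have "perimeter body (ball c0 r0) - ereal ?b \<le> ereal ?M - ereal ?b"
    by (intro ereal_minus_mono perimeter_body_le order_refl)
  also have "\<dots> = ereal (?M - (?b - ?f)) - ereal ?f" by simp
  also have "\<dots> \<le> perimeter F (ball c0 r0) - ereal ?f"
    by (intro ereal_minus_mono perimeter_lower_bound[OF F U] order_refl) (use D in auto)
  finally show "perimeter body (ball c0 r0) - ereal (set_lebesgue_integral lebesgue (body \<inter> ball c0 r0) Hmc)
     \<le> perimeter F (ball c0 r0) - ereal (set_lebesgue_integral lebesgue (F \<inter> ball c0 r0) Hmc)"
    unfolding bU FU .
qed

end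

theorem theorem4p3:
  fixes k :: "'n::finite" and \<alpha> :: real and E :: "(real^'n) set"
  assumes "CARD('n) \<ge> 2"
    and "0 < \<alpha>" "\<alpha> < 1"
    and "E = {x. normp k x powr (1 + \<alpha>) < x $ k \<and> x $ k < 1}
             \<union> ball (axis k (1 + 1 / (1 + \<alpha>))) (sqrt (1 + (1 + \<alpha>) powr (-2)))"
  shows "convex E
    \<and> frontier E = reduced_boundary E
    \<and> (\<forall>z\<in>frontier E. C1_holder_hypersurface_at \<alpha> (frontier E) z)
    \<and> (\<forall>\<beta>>\<alpha>. \<not> C1_holder_hypersurface_at \<beta> (frontier E) 0)
    \<and> (\<forall>c R. closure E \<subseteq> ball c R \<longrightarrow>
         (\<exists>H. var_mean_curv E (ball c R) H \<and>
              (\<forall>p. 1 \<le> p \<and> \<alpha> > (p - real CARD('n)) / (p + 1) \<longrightarrow> Lp_on p (ball c R) H)))"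
proof -
  interpret convex_drop \<alpha> k
    by standard (use assms in auto)
  have E: "E = body" using assms(4) body_eq by simp
  have "\<exists>H. var_mean_curv E (ball c R) H \<and>
      (\<forall>p. 1 \<le> p \<and> \<alpha> > (p - real CARD('n)) / (p + 1) \<longrightarrow> Lp_on p (ball c R) H)"
    if "closure E \<subseteq> ball c R" for c R
    using that var_mean_curv_body[of c R] Lp_on_Hmc[of _ "ball c R"] unfolding E by auto
  then show ?thesis
    unfolding E frontier_body reduced_boundary_body
    using convex_body surf_regular surf_not_regular by blast
qed

end
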